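(* Given $n$ floating-point numbers, a correctly-rounded floating-point representation of their sum can be computed using $O(\mathrm{scan}(n))$ I/Os in the external-memory model, in a cache-oblivious manner, provided $\sigma(n)\le M$.
   Context: In the external-memory model, data move between an internal memory of size $M$ and external memory in blocks of size $B$. Complexity is the number of block transfers (I/Os). $\mathrm{scan}(n)=O(n/B)$ is the I/O complexity of scanning $n$ items. $\sigma(n)$ denotes the size of the intermediate representation used for the exact sum of $n$ floating-point numbers. That representation is an $(\alpha,\beta)$-regularized superaccumulator $\sum_i Y_iR^i$, where $R>2$ is a power of two and each $Y_i$ is an integer in $[-(R-1),R-1]$. Floating-point numbers are base-2 numbers $(-1)^b(1+2^{-t}M)2^{E-2^{l-1}-1}$, not necessarily normalized. It is assumed that $n$ is exactly representable as a sum of a constant number of floating-point numbers. *)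

theory Defs
  imports Complex_Main
begin

section \<open>Floating-point numbers\<close>

text \<open>
  A format has \<open>t\<close> mantissa bits and \<open>l\<close> exponent bits. Numbers need not be normalized, so the
  leading significand bit is explicit: with leading bit \<open>1\<close> the value is
  \<open>(-1)^b (1 + 2^(-t) M) 2^(E - 2^(l-1) - 1)\<close>, with leading bit \<open>0\<close> the summand \<open>1\<close> is absent.
  In particular zero is representable. There are no infinities or NaNs.
\<close>

datatype fl = Fl (sign_bit: nat) (lead_bit: nat) (expo: nat) (mant: nat)

definition is_fl :: "nat \<Rightarrow> nat \<Rightarrow> fl \<Rightarrow> bool" where
  "is_fl t l x \<longleftrightarrow> sign_bit x \<le> 1 \<and> lead_bit x \<le> 1 \<and> expo x < 2 ^ l \<and> mant x < 2 ^ t"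

definition fl_val :: "nat \<Rightarrow> nat \<Rightarrow> fl \<Rightarrow> real" where
  "fl_val t l x = (- 1) ^ sign_bit x * (real (lead_bit x) + real (mant x) / 2 ^ t)
     * 2 powi (int (expo x) - 2 ^ (l - 1) - 1)"

definition fl_sum :: "nat \<Rightarrow> nat \<Rightarrow> fl list \<Rightarrow> real" where
  "fl_sum t l xs = (\<Sum>x\<leftarrow>xs. fl_val t l x)"

text \<open>Rounding to nearest; either neighbour is allowed in case of a tie.\<close>

definition correctly_rounded :: "nat \<Rightarrow> nat \<Rightarrow> real \<Rightarrow> fl \<Rightarrow> bool" where
  "correctly_rounded t l s y \<longleftrightarrow>
     is_fl t l y \<and> (\<forall>z. is_fl t l z \<longrightarrow> \<bar>fl_val t l y - s\<bar> \<le> \<bar>fl_val t l z - s\<bar>)"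

text \<open>The bit string sign, leading bit, exponent, mantissa, read as a binary number.\<close>

definition fl_word :: "nat \<Rightarrow> nat \<Rightarrow> fl \<Rightarrow> int" where
  "fl_word t l x =
     ((int (sign_bit x) * 2 + int (lead_bit x)) * 2 ^ l + int (expo x)) * 2 ^ t + int (mant x)"


section \<open>Superaccumulators\<close>

text \<open>
  \<open>Y i\<close> is the component of weight \<open>R^i\<close>; indices may be negative. A superaccumulator stores its
  nonzero components only, so these determine its size.
\<close>

definition superacc :: "int \<Rightarrow> int \<Rightarrow> (int \<Rightarrow> int) \<Rightarrow> bool" where
  "superacc \<alpha> \<beta> Y \<longleftrightarrow> finite {i. Y i \<noteq> 0} \<and> (\<forall>i. - \<alpha> \<le> Y i \<and> Y i \<le> \<beta>)"

definition superacc_val :: "nat \<Rightarrow> (int \<Rightarrow> int) \<Rightarrow> real" where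
  "superacc_val R Y = (\<Sum>i | Y i \<noteq> 0. of_int (Y i) * real R powi i)"

definition superacc_size :: "(int \<Rightarrow> int) \<Rightarrow> nat" where
  "superacc_size Y = card {i. Y i \<noteq> 0}"

text \<open>
  Regularized representations are not unique. Taking the smallest one for each sum, and then the
  worst case over all inputs of length \<open>n\<close>, gives the least number of components with which
  every sum of \<open>n\<close> (hence, padding with zeros, of at most \<open>n\<close>) numbers can be represented.
\<close>

definition rep_size :: "nat \<Rightarrow> real \<Rightarrow> nat" where
  "rep_size R s =
     (LEAST k. \<exists>Y. superacc (int R - 1) (int R - 1) Y \<and> superacc_val R Y = s \<and> superacc_size Y = k)"

definition sigma :: "nat \<Rightarrow> nat \<Rightarrow> nat \<Rightarrow> nat \<Rightarrow> nat" where
  "sigma R t l n = Max {rep_size R (fl_sum t l xs) | xs. length xs = n \<and> (\<forall>x\<in>set xs. is_fl t l x)}"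


section \<open>Programs\<close>

text \<open>
  A sequential machine with registers and a flat word-addressed memory. A program is a finite
  syntactic object, so it uses a fixed number of registers; everything else has to live in memory.
  Its only interface to the memory are single-word loads and stores; it has no access to the
  cache parameters.
\<close>

datatype aexp = Const int | Reg nat
  | Add aexp aexp | Sub aexp aexp | Mul aexp aexp | Div aexp aexp | Mod aexp aexp

datatype bexp = Less aexp aexp | Neg bexp | Conj bexp bexp

datatype com = Skip
  | Assign nat aexp
  | Load nat aexp
  | Store aexp aexp
  | Seq com com
  | If bexp com com
  | While bexp com

type_synonym regs = "nat \<Rightarrow> int"
type_synonym memory = "nat \<Rightarrow> int"

primrec aval :: "aexp \<Rightarrow> regs \<Rightarrow> int" where
  "aval (Const c) s = c"
| "aval (Reg x) s = s x"
| "aval (Add a b) s = aval a s + aval b s"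
| "aval (Sub a b) s = aval a s - aval b s"
| "aval (Mul a b) s = aval a s * aval b s"
| "aval (Div a b) s = aval a s div aval b s"
| "aval (Mod a b) s = aval a s mod aval b s"

primrec bval :: "bexp \<Rightarrow> regs \<Rightarrow> bool" where
  "bval (Less a b) s \<longleftrightarrow> aval a s < aval b s"
| "bval (Neg b) s \<longleftrightarrow> \<not> bval b s"
| "bval (Conj a b) s \<longleftrightarrow> bval a s \<and> bval b s"

datatype access = Rd nat | Wr nat

text \<open>
  \<open>run W p (s, m) tr (s', m')\<close>: started with registers \<open>s\<close> and memory \<open>m\<close>, \<open>p\<close> terminates with
  registers \<open>s'\<close> and memory \<open>m'\<close>, and \<open>tr\<close> is the sequence of memory accesses it performs.
  Registers and memory cells hold words, i.e. integers of absolute value below \<open>W\<close>; a program that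
  loads, stores or assigns anything else, or that uses a negative address, is stuck and has no run.
  Values inside an expression are not checked: expressions are part of the fixed program and have no
  exponentiation, so their values occupy a constant number of words.
\<close>

inductive run :: "int \<Rightarrow> com \<Rightarrow> regs \<times> memory \<Rightarrow> access list \<Rightarrow> regs \<times> memory \<Rightarrow> bool"
  for W :: int where
  Skip: "run W Skip \<sigma> [] \<sigma>"
| Assign: "\<bar>aval a s\<bar> < W \<Longrightarrow> run W (Assign x a) (s, m) [] (s(x := aval a s), m)"
| Load: "0 \<le> aval a s \<Longrightarrow> aval a s < W \<Longrightarrow> \<bar>m (nat (aval a s))\<bar> < W \<Longrightarrow>
    run W (Load x a) (s, m) [Rd (nat (aval a s))] (s(x := m (nat (aval a s))), m)"
| Store: "0 \<le> aval a s \<Longrightarrow> aval a s < W \<Longrightarrow> \<bar>aval e s\<bar> < W \<Longrightarrow>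
    run W (Store a e) (s, m) [Wr (nat (aval a s))] (s, m(nat (aval a s) := aval e s))"
| Seq: "run W p \<sigma> tr1 \<sigma>' \<Longrightarrow> run W q \<sigma>' tr2 \<sigma>'' \<Longrightarrow> run W (Seq p q) \<sigma> (tr1 @ tr2) \<sigma>''"
| IfTrue: "bval b (fst \<sigma>) \<Longrightarrow> run W p \<sigma> tr \<sigma>' \<Longrightarrow> run W (If b p q) \<sigma> tr \<sigma>'"
| IfFalse: "\<not> bval b (fst \<sigma>) \<Longrightarrow> run W q \<sigma> tr \<sigma>' \<Longrightarrow> run W (If b p q) \<sigma> tr \<sigma>'"
| WhileFalse: "\<not> bval b (fst \<sigma>) \<Longrightarrow> run W (While b p) \<sigma> [] \<sigma>"
| WhileTrue: "bval b (fst \<sigma>) \<Longrightarrow> run W p \<sigma> tr1 \<sigma>' \<Longrightarrow> run W (While b p) \<sigma>' tr2 \<sigma>'' \<Longrightarrow>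
    run W (While b p) \<sigma> (tr1 @ tr2) \<sigma>''"

text \<open>
  A word of \<open>k * (t + l + log2 R + log2 (n + 1))\<close> bits: for constant \<open>k\<close>, it has room for a constant
  number of floating-point numbers, superaccumulator components and addresses.
\<close>

definition word_bound :: "nat \<Rightarrow> nat \<Rightarrow> nat \<Rightarrow> nat \<Rightarrow> nat \<Rightarrow> int" where
  "word_bound k t l R n = (2 ^ (t + l) * int R * (int n + 1)) ^ k"

definition init_regs :: "nat \<Rightarrow> nat \<Rightarrow> nat \<Rightarrow> nat \<Rightarrow> regs" where
  "init_regs n t l R = (\<lambda>_. 0)(0 := int n, 1 := int t, 2 := int l, 3 := int R)"


section \<open>External memory\<close>

text \<open>
  \<open>serves M B C D tr q\<close>: with an internal memory of \<open>M\<close> words in which exactly the blocks \<open>C\<close> are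
  resident and the blocks \<open>D\<close> among them modified, the accesses \<open>tr\<close> can be served with \<open>q\<close> block
  transfers, ending with empty internal memory. Block \<open>b\<close> consists of the addresses \<open>a\<close> with
  \<open>a div B = b\<close>. Fetching a block is one transfer, and so is writing back a modified one. The choice
  of what to fetch and evict is free, which is the optimal replacement of the ideal-cache model.
\<close>

inductive serves :: "nat \<Rightarrow> nat \<Rightarrow> nat set \<Rightarrow> nat set \<Rightarrow> access list \<Rightarrow> nat \<Rightarrow> bool"
  for M B :: nat where
  Done: "serves M B {} {} [] 0"
| Fetch: "b \<notin> C \<Longrightarrow> card (insert b C) * B \<le> M \<Longrightarrow> serves M B (insert b C) D tr q \<Longrightarrow>
    serves M B C D tr (Suc q)"
| Drop: "b \<in> C \<Longrightarrow> b \<notin> D \<Longrightarrow> serves M B (C - {b}) D tr q \<Longrightarrow> serves M B C D tr q"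
| Write_back: "b \<in> C \<Longrightarrow> b \<in> D \<Longrightarrow> serves M B (C - {b}) (D - {b}) tr q \<Longrightarrow>
    serves M B C D tr (Suc q)"
| Read: "a div B \<in> C \<Longrightarrow> serves M B C D tr q \<Longrightarrow> serves M B C D (Rd a # tr) q"
| Write: "a div B \<in> C \<Longrightarrow> serves M B C (insert (a div B) D) tr q \<Longrightarrow>
    serves M B C D (Wr a # tr) q"

definition ios_at_most :: "nat \<Rightarrow> nat \<Rightarrow> access list \<Rightarrow> nat \<Rightarrow> bool" where
  "ios_at_most M B tr q \<longleftrightarrow> (\<exists>q'\<le>q. serves M B {} {} tr q')"

definition scan :: "nat \<Rightarrow> nat \<Rightarrow> nat" where
  "scan B n = nat \<lceil>real n / real B\<rceil>"

end

theory Submission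
  imports Defs
begin

text \<open>
  Up to a common power of two, every input is an integer \<open>X * 2 ^ E\<close> with \<open>\<bar>X\<bar> < 2 ^ (t + 1)\<close>. One pass over
  the input merges the terms whose exponents lie in the same group of \<open>log2 R\<close> consecutive exponents; a
  merged coefficient fits into a word, so no carries are propagated. With \<open>G\<close> groups there are at most
  \<open>min n G\<close> coefficients. They are packed into the first cells of the memory, over input that has
  already been read; starting at address \<open>0\<close>, they occupy as few blocks as possible whatever \<open>B\<close> is.

  Powers of two whose exponents are \<open>2 * log2 R\<close> apart show that \<open>sigma\<close> is at least
  \<open>min n (2 ^ l div (2 * log2 R))\<close>, hence \<open>min n G \<le> 2 * M + 2\<close>. So the packed coefficients and the current input
  block fit into internal memory together: each hot block is transferred at most twice, the input is
  scanned once, and any further computation on the coefficients is free of transfers.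

  This is used to round by brute force. The bits of the exact sum \<open>S\<close> are recomputed one at a time, each
  by a carry through all lower exponents, which gives \<open>S div 2 ^ E\<close> for decreasing \<open>E\<close> until it needs more
  than a significand. As ties may be broken either way, half an ulp is rounded up and no sticky bit is needed.
\<close>

section \<open>Serving a trace with resident blocks and a stream\<close>

text \<open>Two scarcities shape the proof. The first is registers: the exact sum can have
  \<open>2 ^ l\<close> bits or more, while the program has a fixed number of word-sized registers,
  so the sum is never held as a whole. What is held is the quotient by \<open>2 ^ e\<close> of the
  entries up to exponent \<open>e\<close>. It is bounded by the sum of the absolute coefficients,
  and this stays below \<open>H = 2 * T * R * (n + 1)\<close> because each of the \<open>n\<close>
  terms contributes less than \<open>2 * T * R\<close>. The second is internal memory, which may be
  just two blocks. The lower bound on \<open>sigma\<close> loses a factor of two, since it forces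
  only one digit per two groups; packing 32 entries into a cell more than makes up for this. An
  entry takes a field of base \<open>Z = L * (2 * H)\<close>, and \<open>Z\<close> is four times the
  base of \<open>word_bound\<close>, hence at most its square. So a word of size
  \<open>Z ^ 40\<close>, ample for 32 fields, is available with exponent 80.\<close>

primrec addr :: "access \<Rightarrow> nat" where
  "addr (Rd a) = a"
| "addr (Wr a) = a"

text \<open>Below \<open>A\<close> the trace is unrestricted; from \<open>A\<close> on its addresses are nondecreasing and in \<open>{lo..<hi}\<close>.\<close>

definition streams :: "nat \<Rightarrow> nat \<Rightarrow> nat \<Rightarrow> access list \<Rightarrow> bool" where
  "streams A lo hi tr \<longleftrightarrow>
     sorted (filter (\<lambda>a. A \<le> a) (map addr tr)) \<and> (\<forall>a\<in>set tr. A \<le> addr a \<longrightarrow> lo \<le> addr a \<and> addr a < hi)"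

lemma streams_append:
  assumes "streams A lo mid tr1" "streams A mid hi tr2" "lo \<le> mid" "mid \<le> hi"
  shows "streams A lo hi (tr1 @ tr2)"
  using assms unfolding streams_def by (fastforce simp: sorted_append)

lemma streams_below: "(\<And>a. a \<in> set tr \<Longrightarrow> addr a < A) \<Longrightarrow> streams A lo hi tr"
proof -
  assume "\<And>a. a \<in> set tr \<Longrightarrow> addr a < A"
  then have *: "\<And>a. a \<in> set tr \<Longrightarrow> \<not> A \<le> addr a" by force
  then have "filter (\<lambda>a. A \<le> a) (map addr tr) = []" by (auto simp: filter_empty_conv)
  then show ?thesis using * by (simp add: streams_def)
qed

lemma streams_single: "streams A (addr a) (Suc (addr a)) [a]"
  unfolding streams_def by simp

lemma serves_flush:
  assumes "finite C" "D \<subseteq> C"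
  shows "\<exists>q\<le>card C. serves M B C D [] q"
  using assms
proof (induction C arbitrary: D rule: finite_induct)
  case empty
  then show ?case using serves.Done by auto
next
  case (insert x C)
  then obtain q where q: "q \<le> card C" "serves M B C (D - {x}) [] q"
    using insert.IH[of "D - {x}"] by blast
  have C: "insert x C - {x} = C" using insert by auto
  show ?case
  proof (cases "x \<in> D")
    case True
    then show ?thesis using serves.Write_back[of x "insert x C" D M B "[]" q] q C insert by auto
  next
    case False
    then show ?thesis using serves.Drop[of x "insert x C" D M B "[]" q] q C insert
      by (auto intro!: exI[of _ q])
  qed
qed

lemma serves_fetch:
  assumes "serves M B {..<h} {} tr q" "h * B \<le> M"
  shows "serves M B {} {} tr (q + h)"
proof -
  \<comment> \<open>\<open>serves\<close> describes the future, so the induction runs backwards in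
    time: when \<open>j\<close> fetches are still to come, only the blocks below
    \<open>h - j\<close> are resident.\<close>
  have "j \<le> h \<Longrightarrow> serves M B {..<h - j} {} tr (q + j)" for j
  proof (induction j)
    case (Suc j)
    have i: "insert (h - Suc j) {..<h - Suc j} = {..<h - j}" using Suc.prems by auto
    have "(h - j) * B \<le> M" using assms(2) by (meson diff_le_self le_trans mult_le_mono1)
    then show ?case using serves.Fetch[of "h - Suc j" "{..<h - Suc j}" B M "{}" tr "q + j"] Suc i by simp
  qed (use assms in simp)
  from this[of h] show ?thesis by simp
qed

lemma serves_access:
  assumes "addr a div B \<in> C" "serves M B C (D \<union> (case a of Rd _ \<Rightarrow> {} | Wr x \<Rightarrow> {x div B})) tr q"
  shows "serves M B C D (a # tr) q"
  using assms by (cases a) (auto intro: serves.Read serves.Write)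

lemma serves_resident_stream:
  assumes "(h + 1) * B \<le> M" "1 \<le> B" "A \<le> h * B" "h \<le> s" "s \<le> N" "D \<subseteq> insert s {..<h}"
    and "sorted (filter (\<lambda>a. A \<le> a) (map addr tr))"
    and "\<And>a. a \<in> set tr \<Longrightarrow> addr a div B < h \<or> s \<le> addr a div B \<and> addr a div B \<le> N"
  shows "\<exists>q\<le>h + 1 + 2 * (N - s). serves M B (insert s {..<h}) D tr q"
  using assms(4-)
proof (induction tr arbitrary: s D)
  case Nil
  have "card (insert s {..<h}) \<le> h + 1" by (simp add: card_insert_if)
  moreover obtain q where "q \<le> card (insert s {..<h})" "serves M B (insert s {..<h}) D [] q"
    using serves_flush[of "insert s {..<h}" D M B] Nil(3) by auto
  ultimately show ?case by (intro exI[of _ q]) auto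
next
  case (Cons a tr)
  let ?b = "addr a div B"
  define D' where "D' D = D \<union> (case a of Rd _ \<Rightarrow> {} | Wr x \<Rightarrow> {x div B})" for D
  have D': "D' D \<subseteq> insert s' {..<h}" if "D \<subseteq> insert s' {..<h}" "?b \<in> insert s' {..<h}" for D s'
    using that unfolding D'_def by (cases a) auto
  have srt: "sorted (filter (\<lambda>a. A \<le> a) (map addr tr))"
    using Cons.prems(4) by (simp split: if_splits)
  show ?case
  proof (cases "?b \<in> insert s {..<h}")
    case True
    have "\<exists>q\<le>h + 1 + 2 * (N - s). serves M B (insert s {..<h}) (D' D) tr q"
      using Cons.prems by (intro Cons.IH srt D' True) auto
    then show ?thesis using serves_access[OF True] unfolding D'_def by blast
  next
    case False
    then have b: "s < ?b" "?b \<le> N" using Cons.prems(5)[of a] by auto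
    have "A \<le> addr a"
    proof (rule ccontr)
      assume "\<not> A \<le> addr a"
      then have "addr a < h * B" using assms(3) by simp
      then show False using False by (simp add: less_mult_imp_div_less)
    qed
    have "?b \<le> addr x div B" if "x \<in> set tr" "\<not> addr x div B < h" for x
    proof -
      have "A \<le> addr x" using that(2) assms(3)
        by (meson le_trans less_mult_imp_div_less linorder_not_less)
      then show ?thesis using Cons.prems(4) \<open>A \<le> addr a\<close> that by (auto intro: div_le_mono)
    qed
    then have "\<exists>q\<le>h + 1 + 2 * (N - ?b). serves M B (insert ?b {..<h}) (D' (D - {s})) tr q"
      using Cons.prems b by (intro Cons.IH srt D') (fastforce simp: not_less)+
    then obtain q where q: "q \<le> h + 1 + 2 * (N - ?b)"
        "serves M B (insert ?b {..<h}) (D' (D - {s})) tr q" by blast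
    have "serves M B (insert ?b {..<h}) (D - {s}) (a # tr) q"
      by (rule serves_access) (use q in \<open>auto simp: D'_def\<close>)
    moreover have "card (insert ?b {..<h}) * B \<le> M" using assms(1) by (simp add: card_insert_if False)
    ultimately have "serves M B {..<h} (D - {s}) (a # tr) (Suc q)"
      using serves.Fetch[of ?b "{..<h}"] False by auto
    moreover have "insert s {..<h} - {s} = {..<h}" using Cons.prems by auto
    ultimately have s: "serves M B (insert s {..<h} - {s}) (D - {s}) (a # tr) (Suc q)" by simp
    show ?thesis
    proof (cases "s \<in> D")
      case True
      have "serves M B (insert s {..<h}) D (a # tr) (Suc (Suc q))"
        by (rule serves.Write_back[OF _ True s]) simp
      then show ?thesis using q b by (intro exI[of _ "Suc (Suc q)"]) auto
    next
      case False
      have "serves M B (insert s {..<h}) D (a # tr) (Suc q)"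
        by (rule serves.Drop[OF _ False]) (use s False in simp_all)
      then show ?thesis using q b by (intro exI[of _ "Suc q"]) auto
    qed
  qed
qed

lemma div_le_scan: "1 \<le> B \<Longrightarrow> n div B \<le> scan B n"
  unfolding scan_def by (metis ceiling_mono floor_divide_of_nat_eq floor_le_ceiling nat_int nat_mono)

text \<open>Fetching \<open>h + 1\<close> blocks and then serving the trace costs at most
  \<open>2 * N + 4\<close> transfers. Both \<open>N\<close> and \<open>1\<close> are at most
  \<open>scan B n\<close>, so the factor 8 is safe. The bound \<open>Suc n\<close> admits the output
  cell at address \<open>n\<close>.\<close>

lemma streams_ios:
  assumes "streams A lo (Suc n) tr" "A \<le> n" "1 \<le> n" "1 \<le> B" "2 * B \<le> M" "3 * A \<le> M \<or> A \<le> 1"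
  shows "ios_at_most M B tr (8 * scan B n)"
proof -
  define h where "h = (A + B - 1) div B"
  define N where "N = n div B"
  have hB: "h * B \<le> A + B - 1" unfolding h_def by simp
  have AhB: "A \<le> h * B"
  proof -
    have "A + B - 1 < h * B + B" unfolding h_def using assms(4)
dividend_less_div_times[of B] by (simp add: add.commute)
    then show ?thesis using assms(4) by simp
  qed
  \<comment> \<open>Room for the hot blocks and one stream block. If \<open>B < A\<close>, then
    \<open>(h + 1) * B \<le> A + 2 * B - 1 < 3 * A\<close>; otherwise at most one block is hot and
    two blocks fit.\<close>
  have M: "(h + 1) * B \<le> M"
  proof (cases "A \<le> B")
    case True
    then have "h * B < 2 * B" using hB assms(4) by linarith
    then have "h \<le> 1" by simp
    then have "(h + 1) * B \<le> 2 * B" by (intro mult_le_mono1) simp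
    then show ?thesis using assms(5) by (rule order_trans)
  next
    case False
    then show ?thesis using hB assms(4-6) by (auto simp: algebra_simps)
  qed
  have "h * B < (N + 2) * B"
  proof -
    have "n < N * B + B" unfolding N_def using assms(4)
dividend_less_div_times[of B] by (simp add: add.commute)
    then show ?thesis using hB assms(2,4) by (simp add: algebra_simps)
  qed
  then have "h < N + 2" by (rule mult_less_cancel2[THEN iffD1, THEN conjunct2])
  then have h: "h \<le> N + 1" by simp
  have srt: "sorted (filter (\<lambda>a. A \<le> a) (map addr tr))" using assms(1) by (simp add: streams_def)
  have blk: "addr a div B < h \<or> h \<le> addr a div B \<and> addr a div B \<le> N + 1" if "a \<in> set tr" for a
  proof (cases "A \<le> addr a")
    case True
    then have "addr a \<le> n" using assms(1) that by (auto simp: streams_def)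
    then have "addr a div B \<le> N" unfolding N_def by (rule div_le_mono)
    then show ?thesis by linarith
  next
    case False
    then have "addr a < h * B" using AhB by simp
    then show ?thesis by (simp add: less_mult_imp_div_less)
  qed
  \<comment> \<open>The stream slot starts out with block \<open>h\<close>. This is block
    \<open>N + 1\<close> when the hot blocks already cover address \<open>n\<close>, hence the bound
    \<open>N + 1\<close> instead of \<open>N\<close>.\<close>
  obtain q where q: "q \<le> h + 1 + 2 * (N + 1 - h)" "serves M B (insert h {..<h}) {} tr q"
    using serves_resident_stream[OF M assms(4) AhB order_refl h _ srt, of "{}"] blk by auto
  moreover have "insert h {..<h} = {..<h + 1}" by auto
  ultimately have s: "serves M B {} {} tr (q + (h + 1))" using serves_fetch[of M B "h + 1"] M by auto
  have "1 \<le> scan B n" using assms(3,4) by (simp add: scan_def Suc_leI)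
  moreover have "N \<le> scan B n" unfolding N_def using div_le_scan assms(4) by simp
  moreover have "q + (h + 1) \<le> 2 * N + 4" if "h = N+1" using q that by simp
  ultimately have "q + (h + 1) \<le> 8 * scan B n" using q(1) h by linarith
  then show ?thesis unfolding ios_at_most_def using s by blast
qed

section \<open>A lower bound on the superaccumulator size\<close>

text \<open>A geometric sum that telescopes: \<open>(Q - 1) * Q powi b\<close> plus anything below
  \<open>Q powi b\<close> stays below \<open>Q powi (b + 1)\<close>.\<close>

lemma digits_below_less:
  fixes Q :: real
  assumes "finite I" "\<And>i. i \<in> I \<Longrightarrow> i < (m::int)" "1 < Q"
  shows "(\<Sum>i\<in>I. (Q - 1) * Q powi i) < Q powi m"
  using assms(1,2)
proof (induction I arbitrary: m rule: finite_linorder_max_induct)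
  case empty
  then show ?case using assms(3) by simp
next
  case (insert b I)
  have "(\<Sum>i\<in>insert b I. (Q - 1) * Q powi i) = (Q - 1) * Q powi b + (\<Sum>i\<in>I. (Q - 1) * Q powi i)"
    using insert by (subst sum.insert) auto
  also have "\<dots> < (Q - 1) * Q powi b + Q powi b" using insert by simp
  also have "\<dots> = Q powi (b + 1)" using assms(3) by (simp add: power_int_add algebra_simps)
  also have "\<dots> \<le> Q powi m" using insert(4)[of b] assms(3) by (intro power_int_increasing) auto
  finally show ?case .
qed

lemma multiple_of_high_powers:
  fixes Q m :: int
  assumes "\<And>i. i \<in> I \<Longrightarrow> m \<le> i" "0 < Q"
  shows "\<exists>u::int. (\<Sum>i\<in>I. of_int (Y i) * real_of_int Q powi i) = of_int u * real_of_int Q powi m"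
proof -
  have "of_int (Y i) * real_of_int Q powi i = of_int (Y i * Q ^ nat (i - m)) * real_of_int Q powi m" if "i \<in> I" for i
  proof -
    have "real_of_int Q powi i = real_of_int Q powi (i - m) * real_of_int Q powi m"
      using assms(2) by (subst power_int_add[symmetric]) auto
    then show ?thesis using assms(1)[OF that] by (simp add: power_int_def)
  qed
  then have "(\<Sum>i\<in>I. of_int (Y i) * real_of_int Q powi i)
      = (\<Sum>i\<in>I. real_of_int (Y i * Q ^ nat (i - m)) * real_of_int Q powi m)" by (intro sum.cong) auto
  also have "\<dots> = of_int (\<Sum>i\<in>I. Y i * Q ^ nat (i - m)) * real_of_int Q powi m"
    by (simp add: sum_distrib_right)
  finally show ?thesis by blast
qed

text \<open>Every pair of positions \<open>m\<close>, \<open>m + 1\<close> with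
  \<open>m = 2 * j + o'\<close> must carry a nonzero digit of \<open>Y\<close>. Otherwise the digits
  above are a multiple of \<open>R powi (m + 2)\<close> and those below sum to less than
  \<open>R powi m\<close> in absolute value. The ones of the given sum up to position
  \<open>m\<close> add up to at least \<open>R powi m\<close> and less than twice that. Comparing
  the two, a multiple of \<open>R powi (m + 2)\<close> would lie strictly between \<open>0\<close>
  and \<open>3 * R powi m\<close>, although \<open>R * R\<close> exceeds 3.\<close>

lemma sparse_sum_needs_digits:
  fixes o' :: int
  assumes Y: "superacc (int R - 1) (int R - 1) Y" and "2 < R"
    and val: "superacc_val R Y = (\<Sum>j<N. real R powi (2 * int j + o'))"
  shows "N \<le> superacc_size Y"
proof -
  define I where "I = {i. Y i \<noteq> 0}"
  let ?Q = "real R"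
  have fin: "finite I" using Y by (simp add: superacc_def I_def)
  have dig: "\<bar>Y i\<bar> \<le> int R - 1" for i
  proof -
    have "- (int R - 1) \<le> Y i" "Y i \<le> int R - 1" using Y unfolding superacc_def by blast+
    then show ?thesis by linarith
  qed
  have Q: "2 < ?Q" using assms(2) by simp
  have "\<exists>i\<in>I. (i - o') div 2 = int j" if "j < N" for j
  proof (rule ccontr)
    assume none: "\<not> ?thesis"
    define m where "m = 2 * int j + o'"
    define low where "low = (\<Sum>i\<in>{i \<in> I. i < m}. of_int (Y i) * ?Q powi i)"
    have Isplit: "I = {i \<in> I. i < m} \<union> {i \<in> I. m + 2 \<le> i}"
    proof -
      have "i < m \<or> m + 2 \<le> i" if "i \<in> I" for i
      proof -
        have "(i - o') div 2 \<noteq> int j" using none that by blast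
        then show ?thesis unfolding m_def by linarith
      qed
      then show ?thesis by auto
    qed
    have "superacc_val R Y = (\<Sum>i\<in>I. of_int (Y i) * ?Q powi i)"
      unfolding superacc_val_def I_def by simp
    also have "\<dots> = (\<Sum>i\<in>{i \<in> I. i < m} \<union> {i \<in> I. m + 2 \<le> i}. of_int (Y i) * ?Q powi i)"
      by (rule sum.cong[OF Isplit refl])
    also have "\<dots> = low + (\<Sum>i\<in>{i \<in> I. m + 2 \<le> i}. of_int (Y i) * ?Q powi i)"
      unfolding low_def using fin by (intro sum.union_disjoint) auto
    finally have split1: "superacc_val R Y = low + (\<Sum>i\<in>{i \<in> I. m + 2 \<le> i}. of_int (Y i) * ?Q powi i)" .
    obtain u1 where u1: "(\<Sum>i\<in>{i \<in> I. m + 2 \<le> i}. of_int (Y i) * ?Q powi i) = of_int u1 * ?Q powi (m + 2)"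
      using multiple_of_high_powers[of "{i \<in> I. m + 2 \<le> i}" "m + 2" "int R" Y] assms(2) by auto
    have Nsplit: "{..<N} = {..<j} \<union> ({j} \<union> {j<..<N})" using that by auto
    have "(\<Sum>j<N. ?Q powi (2 * int j + o'))
       = (\<Sum>a\<in>{..<j} \<union> ({j} \<union> {j<..<N}). ?Q powi (2 * int a + o'))"
      by (rule sum.cong[OF Nsplit refl])
    also have "\<dots> = (\<Sum>a<j. ?Q powi (2 * int a + o')) + (\<Sum>a\<in>{j} \<union> {j<..<N}. ?Q powi (2 * int a + o'))"
      by (rule sum.union_disjoint) auto
    also have "(\<Sum>a\<in>{j} \<union> {j<..<N}. ?Q powi (2 * int a + o')) = ?Q powi m + (\<Sum>a\<in>{j<..<N}. ?Q powi (2 * int a + o'))"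
      by (subst sum.union_disjoint) (auto simp: m_def)
    finally have "(\<Sum>j<N. ?Q powi (2 * int j + o'))
       = (\<Sum>a<j. ?Q powi (2 * int a + o')) + ?Q powi m + (\<Sum>a\<in>{j<..<N}. ?Q powi (2 * int a + o'))"
      by simp
    moreover have "\<exists>u. (\<Sum>a\<in>{j<..<N}. ?Q powi (2 * int a + o')) = of_int u * ?Q powi (m + 2)"
    proof -
      have "(\<Sum>a\<in>{j<..<N}. ?Q powi (2 * int a + o')) = (\<Sum>i\<in>(\<lambda>a. 2 * int a + o') ` {j<..<N}. of_int 1 * ?Q powi i)"
        by (subst sum.reindex) (auto simp: inj_on_def)
      then show ?thesis using multiple_of_high_powers[of "(\<lambda>a. 2 * int a + o') ` {j<..<N}" "m + 2" "int R" "\<lambda>_. 1"] assms(2)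
        by (force simp: m_def)
    qed
    then obtain u2 where u2: "(\<Sum>a\<in>{j<..<N}. ?Q powi (2 * int a + o')) = of_int u2 * ?Q powi (m + 2)" ..
    define below where "below = (\<Sum>a<j. ?Q powi (2 * int a + o'))"
    ultimately have eq: "below + ?Q powi m - low = of_int (u1 - u2) * ?Q powi (m + 2)"
      using split1 u1 u2 val by (simp add: below_def left_diff_distrib)
    have "\<bar>low\<bar> \<le> (\<Sum>i\<in>{i \<in> I. i < m}. (?Q - 1) * ?Q powi i)"
      unfolding low_def
    proof (rule order_trans[OF sum_abs], rule sum_mono)
      fix i
      have "real_of_int \<bar>Y i\<bar> \<le> ?Q - 1" using dig[of i] assms(2)
        by (metis of_int_1 of_int_diff of_int_le_iff of_int_of_nat_eq)
      then show "\<bar>of_int (Y i) * ?Q powi i\<bar> \<le> (?Q - 1) * ?Q powi i"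
        using Q by (simp add: abs_mult mult_right_mono)
    qed
    also have "\<dots> < ?Q powi m" using fin Q by (intro digits_below_less) auto
    finally have low: "\<bar>low\<bar> < ?Q powi m" .
    have "below \<le> (\<Sum>i\<in>(\<lambda>a. 2 * int a + o') ` {..<j}. (?Q - 1) * ?Q powi i)"
      unfolding below_def using Q by (subst sum.reindex) (auto simp: inj_on_def intro!: sum_mono)
    also have "\<dots> < ?Q powi m" using Q by (intro digits_below_less) (auto simp: m_def)
    finally have below: "below < ?Q powi m" .
    have "0 \<le> below" unfolding below_def using Q by (intro sum_nonneg) auto
    then have pos: "0 < of_int (u1 - u2) * ?Q powi (m + 2)" using eq low by linarith
    moreover have "0 < ?Q powi (m + 2)" using Q by (intro zero_less_power_int) simp
    ultimately have "0 < real_of_int (u1 - u2)" by (rule zero_less_mult_pos2)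
    then have "0 < u1 - u2" by simp
    then have "1 \<le> real_of_int (u1 - u2)" by linarith
    then have "?Q powi (m + 2) \<le> of_int (u1 - u2) * ?Q powi (m + 2)" using Q by simp
    also have "\<dots> < 3 * ?Q powi m" using eq low below by linarith
    also have "\<dots> \<le> (?Q * ?Q) * ?Q powi m"
    proof -
      have "2 * 2 \<le> ?Q * ?Q" using Q by (intro mult_mono) auto
      then show ?thesis using Q by (intro mult_right_mono) auto
    qed
    also have "\<dots> = ?Q powi (m + 2)" using Q by (simp add: power_int_add power2_eq_square)
    finally show False by simp
  qed
  \<comment> \<open>The pairs are disjoint: sending a position to the index of its pair maps the
    support of \<open>Y\<close> onto at least \<open>N\<close> indices.\<close>
  then have "int ` {..<N} \<subseteq> (\<lambda>i. (i - o') div 2) ` I" by force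
  then have "card (int ` {..<N}) \<le> card ((\<lambda>i. (i - o') div 2) ` I)" using fin by (intro card_mono) auto
  also have "\<dots> \<le> card I" using fin by (rule card_image_le)
  finally show ?thesis unfolding superacc_size_def I_def by (simp add: card_image)
qed

lemma rep_size_sparse_sum:
  fixes o' :: int
  assumes "2 < R"
  shows "N \<le> rep_size R (\<Sum>j<N. real R powi (2 * int j + o'))"
proof -
  let ?s = "\<Sum>j<N. real R powi (2 * int j + o')"
  let ?P = "\<lambda>k. \<exists>Y. superacc (int R - 1) (int R - 1) Y \<and> superacc_val R Y = ?s \<and> superacc_size Y = k"
  \<comment> \<open>The digits 0 and 1 give one regularized representation, so \<open>LEAST\<close>
    ranges over a nonempty set and its value is attained by some \<open>Y\<close>.\<close>
  define I where "I = (\<lambda>j. 2 * int j + o') ` {..<N}"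
  define Y where "Y i = (if i \<in> I then 1 else 0 :: int)" for i
  have supp: "{i. Y i \<noteq> 0} = I" by (auto simp: Y_def)
  have "superacc (int R - 1) (int R - 1) Y"
    unfolding superacc_def supp using assms by (auto simp: Y_def I_def)
  moreover have "superacc_val R Y = ?s"
    unfolding superacc_val_def supp by (simp add: Y_def I_def sum.reindex inj_on_def)
  ultimately have "?P (superacc_size Y)" by blast
  then have "?P (rep_size R ?s)" unfolding rep_size_def by (rule LeastI)
  then show ?thesis using sparse_sum_needs_digits[OF _ assms] by metis
qed

lemma finite_is_fl: "finite {x. is_fl t l x}"
proof (rule finite_surj)
  show "{x. is_fl t l x} \<subseteq> (\<lambda>(a, b, c, d). Fl a b c d) ` ({..1} \<times> {..1} \<times> {..<2 ^ l} \<times> {..<2 ^ t})"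
  proof
    fix x assume "x \<in> {x. is_fl t l x}"
    then show "x \<in> (\<lambda>(a, b, c, d). Fl a b c d) ` ({..1} \<times> {..1} \<times> {..<2 ^ l} \<times> {..<2 ^ t})"
      by (intro image_eqI[of _ _ "(sign_bit x, lead_bit x, expo x, mant x)"]) (simp_all add: is_fl_def)
  qed
qed simp

lemma rep_size_le_sigma:
  assumes "length xs = n" "\<forall>x\<in>set xs. is_fl t l x"
  shows "rep_size R (fl_sum t l xs) \<le> sigma R t l n"
proof -
  have "finite {xs. set xs \<subseteq> {x. is_fl t l x} \<and> length xs = n}"
    by (rule finite_lists_length_eq[OF finite_is_fl])
  moreover have "{rep_size R (fl_sum t l xs) | xs. length xs = n \<and> (\<forall>x\<in>set xs. is_fl t l x)}
     = (\<lambda>xs. rep_size R (fl_sum t l xs)) ` {xs. set xs \<subseteq> {x. is_fl t l x} \<and> length xs = n}" by auto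
  ultimately show ?thesis unfolding sigma_def using assms by (intro Max_ge) auto
qed

text \<open>Powers of two whose exponents are \<open>2 r\<close> apart and multiples of \<open>r\<close> leave, in base \<open>2 ^ r\<close>, a
  zero digit between any two ones, which no choice of signed digits can merge.\<close>

lemma sigma_lower_bound:
  assumes "2 \<le> r" "1 \<le> l"
  shows "min n (2 ^ l div (2 * r)) \<le> sigma (2 ^ r) t l n"
proof -
  define N where "N = min n (2 ^ l div (2 * r))"
  \<comment> \<open>Stored exponents start at \<open>bias mod r\<close>: subtracting the bias then
    leaves \<open>r * (2 * j - bias div r)\<close>, a multiple of \<open>r\<close>, so each input is
    an exact power of the radix \<open>2 ^ r\<close>.\<close>
  define bias :: nat where "bias = 2 ^ (l - 1) + 1"
  define o' where "o' = - (int (bias div r))"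
  define x where "x j = Fl 0 1 (bias mod r + 2 * r * j) 0" for j
  define xs where "xs = map x [0..<N] @ replicate (n - N) (Fl 0 0 0 0)"
  have R: "(2::nat) < 2 ^ r"
  proof -
    have "(2::nat) ^ 2 \<le> 2 ^ r" using assms(1) by (intro power_increasing) auto
    then show ?thesis by simp
  qed
  have "is_fl t l (x j)" if "j < N" for j
  proof -
    have "Suc j \<le> 2 ^ l div (2 * r)" using that by (simp add: N_def)
    then have "2 * r * Suc j \<le> 2 * r * (2 ^ l div (2 * r))" by (rule mult_le_mono2)
    also have "\<dots> \<le> 2 ^ l" by simp
    finally have "2 * r * j + 2 * r \<le> 2 ^ l" by simp
    moreover have "bias mod r < r" using assms(1) by simp
    ultimately have "bias mod r + 2 * r * j < 2 ^ l" by linarith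
    then show ?thesis by (simp add: x_def is_fl_def)
  qed
  then have fl: "\<forall>x\<in>set xs. is_fl t l x" by (auto simp: xs_def is_fl_def)
  have len: "length xs = n" by (simp add: xs_def N_def)
  have val: "fl_val t l (x j) = real (2 ^ r) powi (2 * int j + o')" for j
  proof -
    have "int bias = int r * int (bias div r) + int (bias mod r)" by (simp flip: of_nat_mult of_nat_add)
    moreover have "int bias = 2 ^ (l - 1) + 1" by (simp add: bias_def)
    ultimately have "int (bias mod r + 2 * r * j) - 2 ^ (l - 1) - 1 = int r * (2 * int j + o')"
      by (simp add: o'_def algebra_simps)
    then show ?thesis unfolding fl_val_def x_def
      by (simp only: fl.sel) (simp add: power_int_mult)
  qed
  have "fl_sum t l xs = (\<Sum>j\<leftarrow>[0..<N]. fl_val t l (x j)) + (\<Sum>x\<leftarrow>replicate (n - N) (Fl 0 0 0 0). fl_val t l x)"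
    by (simp add: fl_sum_def xs_def o_def)
  also have "(\<Sum>x\<leftarrow>replicate (n - N) (Fl 0 0 0 0). fl_val t l x) = 0"
    by (simp add: map_replicate_const sum_list_replicate fl_val_def)
  also have "(\<Sum>j\<leftarrow>[0..<N]. fl_val t l (x j)) = (\<Sum>j<N. real (2 ^ r) powi (2 * int j + o'))"
    by (simp only: val) (simp add: interv_sum_list_conv_sum_set_nat atLeast0LessThan)
  finally have "N \<le> rep_size (2 ^ r) (fl_sum t l xs)" using rep_size_sparse_sum[OF R] by simp
  then show ?thesis using rep_size_le_sigma[OF len fl] unfolding N_def by (rule order_trans)
qed

section \<open>Rounding of integers\<close>

text \<open>The value in units of \<open>2 powi (- t - 2 ^ (l - 1) - 1)\<close>, the smallest
  positive number of the format.\<close>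

definition fl_int :: "nat \<Rightarrow> fl \<Rightarrow> int" where
  "fl_int t x = (- 1) ^ sign_bit x * (int (lead_bit x) * 2 ^ t + int (mant x)) * 2 ^ expo x"

lemma fl_val_eq_fl_int:
  "fl_val t l x = of_int (fl_int t x) * 2 powi (- int t - 2 ^ (l - 1) - 1)"
proof -
  have pow: "2 powi (int t + int e + b) = 2 ^ t * 2 ^ e * (2::real) powi b" for e b
    by (simp add: power_int_add)
  have "int (expo x) - 2 ^ (l - 1) - 1 = int t + int (expo x) + (- int t - 2 ^ (l - 1) - 1)" by simp
  then have "(2::real) powi (int (expo x) - 2 ^ (l - 1) - 1)
      = 2 ^ t * 2 ^ expo x * 2 powi (- int t - 2 ^ (l - 1) - 1)"
    using pow by metis
  then have "fl_val t l x = (- 1) ^ sign_bit x * ((real (lead_bit x) + real (mant x) / 2 ^ t) * 2 ^ t)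
      * 2 ^ expo x * 2 powi (- int t - 2 ^ (l - 1) - 1)"
    unfolding fl_val_def by simp
  also have "(real (lead_bit x) + real (mant x) / 2 ^ t) * 2 ^ t = real (lead_bit x) * 2 ^ t + real (mant x)"
    by (simp add: field_simps)
  finally show ?thesis by (simp add: fl_int_def)
qed

lemma fl_sum_eq_fl_int:
  "fl_sum t l xs = of_int (\<Sum>x\<leftarrow>xs. fl_int t x) * 2 powi (- int t - 2 ^ (l - 1) - 1)"
  by (induction xs) (simp_all add: fl_sum_def fl_val_eq_fl_int distrib_right)

text \<open>For \<open>T = 2 ^ t\<close> and \<open>L = 2 ^ l\<close> the candidates
  \<open>X * 2 ^ e\<close> are exactly the integers \<open>fl_int t z\<close> of floating-point
  numbers \<open>z\<close>: without normalization, any significand goes with any exponent.\<close>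

definition best_approx :: "int \<Rightarrow> nat \<Rightarrow> int \<Rightarrow> int \<Rightarrow> bool" where
  "best_approx T L S v \<longleftrightarrow> (\<forall>X e. \<bar>X\<bar> < 2 * T \<and> e < L \<longrightarrow> \<bar>v - S\<bar> \<le> \<bar>X * 2 ^ e - S\<bar>)"

lemma fl_int_bounds:
  assumes "is_fl t l z"
  obtains X where "fl_int t z = X * 2 ^ expo z" "\<bar>X\<bar> < 2 * 2 ^ t" "expo z < 2 ^ l"
proof
  show "fl_int t z = ((- 1) ^ sign_bit z * (int (lead_bit z) * 2 ^ t + int (mant z))) * 2 ^ expo z"
    by (simp add: fl_int_def)
  have "int (mant z) < 2 ^ t" using assms unfolding is_fl_def by simp
  moreover have "int (lead_bit z) * 2 ^ t \<le> 1 * 2 ^ t"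
    using assms unfolding is_fl_def by (intro mult_right_mono) auto
  moreover have "0 \<le> int (lead_bit z) * 2 ^ t" by simp
  ultimately have "\<bar>int (lead_bit z) * 2 ^ t + int (mant z)\<bar> < 2 * 2 ^ t" by linarith
  then show "\<bar>(- 1) ^ sign_bit z * (int (lead_bit z) * 2 ^ t + int (mant z))\<bar> < 2 * 2 ^ t"
    by (simp only: abs_mult) (simp add: power_abs)
  show "expo z < 2 ^ l" using assms by (simp add: is_fl_def)
qed

lemma correctly_rounded_fl_int:
  assumes "is_fl t l y" "best_approx (2 ^ t) (2 ^ l) (\<Sum>x\<leftarrow>xs. fl_int t x) (fl_int t y)"
  shows "correctly_rounded t l (fl_sum t l xs) y"
proof -
  let ?S = "\<Sum>x\<leftarrow>xs. fl_int t x" and ?u = "2 powi (- int t - 2 ^ (l - 1) - 1) :: real"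
  have u: "\<bar>fl_val t l z - fl_sum t l xs\<bar> = of_int \<bar>fl_int t z - ?S\<bar> * ?u" for z
    unfolding fl_val_eq_fl_int fl_sum_eq_fl_int left_diff_distrib[symmetric] of_int_diff[symmetric] abs_mult
    by (simp del: of_int_diff)
  have "\<bar>fl_int t y - ?S\<bar> \<le> \<bar>fl_int t z - ?S\<bar>" if "is_fl t l z" for z
    using fl_int_bounds[OF that] assms(2) unfolding best_approx_def by metis
  then show ?thesis unfolding correctly_rounded_def u using assms(1)
    by (simp add: mult_right_mono del: of_int_abs of_int_diff)
qed

text \<open>Any other multiple of \<open>P\<close> is at least \<open>P\<close> away from
  \<open>x * P\<close>, hence at least \<open>P / 2\<close> away from \<open>S\<close>.\<close>

lemma nearest_multiple:
  fixes P :: int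
  assumes "2 * \<bar>x * P - S\<bar> \<le> P"
  shows "\<bar>x * P - S\<bar> \<le> \<bar>k * P - S\<bar>"
proof (cases "k = x")
  case False
  have "0 \<le> 2 * \<bar>x * P - S\<bar>" by simp
  also note assms
  finally have "0 \<le> P" .
  have "1 * P \<le> \<bar>k - x\<bar> * P" using False \<open>0 \<le> P\<close> by (intro mult_right_mono) auto
  also have "\<dots> = \<bar>k * P - x * P\<bar>" using \<open>0 \<le> P\<close> by (simp add: abs_mult flip: left_diff_distrib)
  finally show ?thesis using assms by (smt (verit))
qed simp

text \<open>For positive \<open>E\<close> this is the floor of \<open>S / 2 ^ E + 1 / 2\<close>, so
  ties go upwards. It needs only the quotient at \<open>E - 1\<close>.\<close>

definition round_half :: "int \<Rightarrow> nat \<Rightarrow> int" where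
  "round_half S E = (if E = 0 then S else (S div 2 ^ (E - 1) + 1) div 2)"

lemma round_half_error: "2 * \<bar>round_half S E * 2 ^ E - S\<bar> \<le> 2 ^ E"
proof (cases E)
  case (Suc e)
  define q where "q = S div 2 ^ e"
  have x: "round_half S E * 2 ^ E = (2 * ((q + 1) div 2)) * 2 ^ e"
    by (simp add: round_half_def Suc q_def)
  have S: "S = q * 2 ^ e + S mod 2 ^ e" unfolding q_def by (rule div_mult_mod_eq[symmetric])
  have r: "0 \<le> S mod 2 ^ e" "S mod 2 ^ e < 2 ^ e" by simp_all
  consider "2 * ((q + 1) div 2) = q" | "2 * ((q + 1) div 2) = q + 1" by linarith
  then show ?thesis
  proof cases
    case 1
    have "q * 2 ^ e - S = - (S mod 2 ^ e)" using S by linarith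
    then show ?thesis using r unfolding x 1 by (simp add: Suc less_imp_le)
  next
    case 2
    have "(q + 1) * 2 ^ e - S = 2 ^ e - S mod 2 ^ e" unfolding distrib_right using S by linarith
    moreover have "\<bar>2 ^ e - S mod 2 ^ e\<bar> \<le> 2 ^ e" using r by linarith
    ultimately show ?thesis unfolding x 2 by (simp add: Suc)
  qed
qed (simp add: round_half_def)

text \<open>Multiples of \<open>2 ^ E\<close> are beaten by \<open>nearest_multiple\<close>. A
  candidate with a smaller exponent has absolute value at most
  \<open>2 * T * 2 ^ (E - 1) = T * 2 ^ E\<close>, while \<open>S\<close> lies at or beyond
  \<open>T * 2 ^ E\<close> or \<open>- T * 2 ^ E\<close>. That number separates the candidate from
  \<open>S\<close> and is itself a multiple of \<open>2 ^ E\<close>.\<close>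

lemma round_half_best:
  assumes "0 < E \<Longrightarrow> 2 * T \<le> S div 2 ^ (E - 1) \<or> S div 2 ^ (E - 1) < - (2 * T)" "0 < T"
  shows "best_approx T L S (round_half S E * 2 ^ E)"
  unfolding best_approx_def
proof (intro allI impI)
  fix X :: int and e assume X: "\<bar>X\<bar> < 2 * T \<and> e < L"
  note near = nearest_multiple[OF round_half_error]
  show "\<bar>round_half S E * 2 ^ E - S\<bar> \<le> \<bar>X * 2 ^ e - S\<bar>"
  proof (cases "E \<le> e")
    case True
    then have "X * 2 ^ e = (X * 2 ^ (e - E)) * 2 ^ E" by (simp flip: power_add)
    then show ?thesis using near by metis
  next
    case False
    then have E: "0 < E" "e \<le> E - 1" by auto
    define D :: int where "D = 2 ^ (E - 1)"
    have D: "2 ^ E = 2 * D" using E by (cases E) (auto simp: D_def)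
    have "\<bar>X * 2 ^ e\<bar> \<le> (2 * T) * D"
      unfolding abs_mult D_def using X E by (intro mult_mono) (auto intro: power_increasing)
    moreover have "S = (S div D) * D + S mod D" by (rule div_mult_mod_eq[symmetric])
    moreover have "0 \<le> S mod D" "S mod D < D" by (simp_all add: D_def)
    moreover have "(2 * T) * D \<le> (S div D) * D \<or> (S div D) * D \<le> (- (2 * T) - 1) * D"
      using assms(1)[OF E(1)] by (fold D_def) (auto simp: D_def intro!: mult_right_mono)
    moreover have "T * (2 * D) = (2 * T) * D" by simp
    ultimately have "T * 2 ^ E \<le> S \<and> X * 2 ^ e \<le> T * 2 ^ E \<or> S \<le> - T * 2 ^ E \<and> - T * 2 ^ E \<le> X * 2 ^ e"
      unfolding D left_diff_distrib minus_mult_left[symmetric] by linarith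
    then show ?thesis using near[of S E T] near[of S E "- T"] by linarith
  qed
qed

section \<open>Carry after rounding, and overflow\<close>

lemma saturated_best:
  assumes "0 < L" "0 < T" "(2 * T - 1) * 2 ^ (L - 1) \<le> s * S" "s = 1 \<or> s = - 1"
  shows "best_approx T L (S::int) (s * (2 * T - 1) * 2 ^ (L - 1))"
  unfolding best_approx_def
proof (intro allI impI)
  fix X :: int and e assume X: "\<bar>X\<bar> < 2 * T \<and> e < L"
  then have "e \<le> L - 1" "\<bar>X\<bar> \<le> 2 * T - 1" by auto
  then have "\<bar>X * 2 ^ e\<bar> \<le> (2 * T - 1) * 2 ^ (L - 1)"
    unfolding abs_mult by (intro mult_mono) (auto intro: power_increasing)
  then show "\<bar>s * (2 * T - 1) * 2 ^ (L - 1) - S\<bar> \<le> \<bar>X * 2 ^ e - S\<bar>"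
    using assms(3,4) by (auto simp: left_diff_distrib)
qed

text \<open>Rounding can produce \<open>2 * T\<close> or \<open>- (2 * T)\<close>, just too large
  for a significand. Both are even, so halving them is exact.\<close>

definition carry_out :: "int \<Rightarrow> int \<times> nat \<Rightarrow> int \<times> nat" where
  "carry_out T = (\<lambda>(X, E). if \<bar>X\<bar> = 2 * T then (X div 2, E + 1) else (X, E))"

definition saturate :: "int \<Rightarrow> nat \<Rightarrow> int \<times> nat \<Rightarrow> int \<times> nat" where
  "saturate T L = (\<lambda>(X, E). if L \<le> E then (if X < 0 then - (2 * T - 1) else 2 * T - 1, L - 1) else (X, E))"

text \<open>The exponent \<open>L\<close> marks overflow: even the quotient at the top exponent does
  not fit. From then on only its sign matters, and the extreme number of that sign lies between
  \<open>S\<close> and all other candidates.\<close>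

lemma saturate_overflow_best:
  assumes "2 * T \<le> S div 2 ^ (L - 1) \<or> S div 2 ^ (L - 1) < - (2 * T)" "0 < T" "0 < L"
    and "saturate T L (carry_out T (S div 2 ^ (L - 1), L)) = (X, E)"
  shows "\<bar>X\<bar> < 2 * T \<and> E < L \<and> best_approx T L S (X * 2 ^ E)"
proof -
  define D :: int where "D = 2 ^ (L - 1)"
  define s :: int where "s = (if S div D < 0 then - 1 else 1)"
  have XE: "X = s * (2 * T - 1)" "E = L - 1"
    using assms(4) by (auto simp: saturate_def carry_out_def s_def D_def split: if_splits)
  have "S = (S div D) * D + S mod D" by (rule div_mult_mod_eq[symmetric])
  moreover have "0 \<le> S mod D" "S mod D < D" by (simp_all add: D_def)
  moreover have "(2 * T) * D \<le> (S div D) * D \<and> s = 1 \<or> (S div D) * D \<le> (- (2 * T) - 1) * D \<and> s = - 1"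
    using assms(1,2) unfolding s_def by (fold D_def) (auto simp: D_def intro!: mult_right_mono)
  moreover have D: "0 < D" by (simp add: D_def)
  ultimately have "s = 1 \<and> (2 * T) * D \<le> S \<or> s = - 1 \<and> S < - ((2 * T) * D)"
    unfolding left_diff_distrib minus_mult_left[symmetric] by linarith
  then have "(2 * T - 1) * D \<le> s * S" using D unfolding left_diff_distrib by auto
  then have "best_approx T L S (s * (2 * T - 1) * 2 ^ (L - 1))"
    using assms(2,3) by (intro saturated_best) (auto simp: s_def D_def)
  then show ?thesis using assms(2,3) by (simp add: XE s_def)
qed

lemma round_half_range:
  assumes "- (2 * T) \<le> S div 2 ^ E" "S div 2 ^ E < 2 * T"
  shows "\<bar>round_half S E\<bar> \<le> 2 * T"
proof (cases E)
  case 0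
  then show ?thesis using assms by (simp add: round_half_def)
next
  case (Suc e)
  have "S div 2 ^ E = (S div 2 ^ e) div 2"
    unfolding Suc power_Suc2 by (simp add: zdiv_zmult2_eq)
  then show ?thesis using assms by (simp add: round_half_def Suc)
qed

lemma saturate_round_best:
  assumes "0 < E \<Longrightarrow> 2 * T \<le> S div 2 ^ (E - 1) \<or> S div 2 ^ (E - 1) < - (2 * T)"
    and "- (2 * T) \<le> S div 2 ^ E" "S div 2 ^ E < 2 * T" "0 < T" "E < L"
    and "saturate T L (carry_out T (round_half S E, E)) = (X, E')"
  shows "\<bar>X\<bar> < 2 * T \<and> E' < L \<and> best_approx T L S (X * 2 ^ E')"
proof (cases "\<bar>round_half S E\<bar> = 2 * T")
  case False
  then show ?thesis using assms round_half_range[OF assms(2,3)] round_half_best[of E T S L]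
    by (auto simp: saturate_def carry_out_def)
next
  case True
  then have even: "2 * (round_half S E div 2) = round_half S E" by presburger
  show ?thesis
  proof (cases "E + 1 < L")
    case True
    then have XE: "X = round_half S E div 2" "E' = E + 1"
      using assms(6) \<open>\<bar>round_half S E\<bar> = 2 * T\<close> by (auto simp: saturate_def carry_out_def)
    have "X * 2 ^ E' = (2 * (round_half S E div 2)) * 2 ^ E" by (simp add: XE)
    then have "X * 2 ^ E' = round_half S E * 2 ^ E" unfolding even .
    moreover have "\<bar>X\<bar> < 2 * T" using XE even \<open>\<bar>round_half S E\<bar> = 2 * T\<close> assms(4) by linarith
    ultimately show ?thesis using round_half_best[of E T S L] assms(1,4) True XE(2) by metis
  next
    case False
    define s :: int where "s = (if round_half S E < 0 then - 1 else 1)"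
    have E: "E = L - 1" using False assms(5) by simp
    have XE: "X = s * (2 * T - 1)" "E' = L - 1"
      using assms(4-6) E \<open>\<bar>round_half S E\<bar> = 2 * T\<close> by (auto simp: saturate_def carry_out_def s_def)
    have r: "round_half S E = s * (2 * T)" using \<open>\<bar>round_half S E\<bar> = 2 * T\<close> by (auto simp: s_def)
    define D where "D = T * 2 ^ E"
    define P :: int where "P = 2 ^ E"
    \<comment> \<open>The rounded value overflows at the top exponent, and \<open>S\<close> is
      within half a unit of it. So \<open>S\<close> is at or beyond the largest finite value, which
      is one unit closer to zero.\<close>
    have "2 * \<bar>s * (2 * D) - S\<bar> \<le> P"
      using round_half_error[of S E] unfolding r D_def P_def by (simp add: mult.assoc)
    moreover have "0 < P" "s = 1 \<or> s = - 1" by (auto simp: s_def P_def)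
    ultimately have "2 * D - P \<le> s * S" by (elim disjE) (simp_all, arith+)
    then have "(2 * T - 1) * 2 ^ E \<le> s * S" by (simp add: D_def P_def left_diff_distrib mult.assoc)
    then have "best_approx T L S (s * (2 * T - 1) * 2 ^ (L - 1))"
      using assms(4,5) by (intro saturated_best) (auto simp: s_def E)
    then show ?thesis using assms(4,5) by (simp add: XE s_def)
  qed
qed

definition encode :: "int \<Rightarrow> int \<Rightarrow> int \<Rightarrow> int \<Rightarrow> int" where
  "encode T L X E = (((if X < 0 then 1 else 0) * 2 + \<bar>X\<bar> div T) * L + E) * T + \<bar>X\<bar> mod T"

lemma encode_fl_word:
  fixes X :: int
  assumes "\<bar>X\<bar> < 2 * 2 ^ t" "E < 2 ^ l"
  obtains y where "is_fl t l y" "fl_int t y = X * 2 ^ E" "fl_word t l y = encode (2 ^ t) (2 ^ l) X (int E)"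
proof -
  define y where "y = Fl (if X < 0 then 1 else 0) (nat (\<bar>X\<bar> div 2 ^ t)) E (nat (\<bar>X\<bar> mod 2 ^ t))"
  have "\<bar>X\<bar> div 2 ^ t < 2"
  proof (rule ccontr)
    assume "\<not> ?thesis"
    then have "2 * 2 ^ t \<le> (\<bar>X\<bar> div 2 ^ t) * 2 ^ t" by (intro mult_right_mono) auto
    also have "\<dots> \<le> (\<bar>X\<bar> div 2 ^ t) * 2 ^ t + \<bar>X\<bar> mod 2 ^ t" by simp
    also have "\<dots> = \<bar>X\<bar>" by (rule div_mult_mod_eq)
    finally show False using assms(1) by simp
  qed
  then have d: "0 \<le> \<bar>X\<bar> div 2 ^ t" "\<bar>X\<bar> div 2 ^ t \<le> 1" by (simp_all add: pos_imp_zdiv_nonneg_iff)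
  have m: "0 \<le> \<bar>X\<bar> mod 2 ^ t" "\<bar>X\<bar> mod 2 ^ t < 2 ^ t" by simp_all
  have "is_fl t l y" unfolding is_fl_def y_def using d m assms(2)
    by (auto simp: nat_less_iff)
  moreover have "(\<bar>X\<bar> div 2 ^ t) * 2 ^ t + \<bar>X\<bar> mod 2 ^ t = \<bar>X\<bar>" by (rule div_mult_mod_eq)
  then have "fl_int t y = X * 2 ^ E" unfolding fl_int_def y_def using d m by auto
  moreover have "fl_word t l y = encode (2 ^ t) (2 ^ l) X (int E)"
    unfolding fl_word_def encode_def y_def using d m by simp
  ultimately show ?thesis using that by blast
qed

lemma fl_word_bounds:
  assumes "is_fl t l x"
  shows "0 \<le> fl_word t l x" "fl_word t l x < 4 * (2 ^ l * 2 ^ t)"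
proof -
  show "0 \<le> fl_word t l x" by (simp add: fl_word_def)
  have "int (sign_bit x) \<le> 1" "int (lead_bit x) \<le> 1" "int (expo x) + 1 \<le> 2 ^ l" and m: "int (mant x) < 2 ^ t"
    using assms unfolding is_fl_def by simp_all (metis Suc_leI of_nat_1 of_nat_Suc of_nat_le_iff of_nat_numeral of_nat_power add.commute)
  then have "(int (sign_bit x) * 2 + int (lead_bit x)) * 2 ^ l \<le> 3 * 2 ^ l" by (intro mult_right_mono) auto
  then have "(int (sign_bit x) * 2 + int (lead_bit x)) * 2 ^ l + int (expo x) \<le> 4 * 2 ^ l - 1"
    using \<open>int (expo x) + 1 \<le> 2 ^ l\<close> by linarith
  then have "((int (sign_bit x) * 2 + int (lead_bit x)) * 2 ^ l + int (expo x)) * 2 ^ t \<le> (4 * 2 ^ l - 1) * 2 ^ t"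
    by (intro mult_right_mono) auto
  then show "fl_word t l x < 4 * (2 ^ l * 2 ^ t)" using m unfolding fl_word_def left_diff_distrib by linarith
qed

lemma fl_word_decode:
  assumes "is_fl t l x"
  shows "fl_word t l x mod 2 ^ t = int (mant x)"
    "fl_word t l x div 2 ^ t mod 2 ^ l = int (expo x)"
    "fl_word t l x div (2 ^ t * 2 ^ l) mod 2 = int (lead_bit x)"
    "fl_word t l x div (2 ^ t * 2 ^ l * 2) = int (sign_bit x)"
proof -
  have b: "int (mant x) < 2 ^ t" "int (expo x) < 2 ^ l" "int (lead_bit x) < 2"
    using assms unfolding is_fl_def by simp_all
  show "fl_word t l x mod 2 ^ t = int (mant x)" unfolding fl_word_def using b by simp
  have 1: "fl_word t l x div 2 ^ t = (int (sign_bit x) * 2 + int (lead_bit x)) * 2 ^ l + int (expo x)"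
    unfolding fl_word_def using b by simp
  then show "fl_word t l x div 2 ^ t mod 2 ^ l = int (expo x)" using b by simp
  have 2: "fl_word t l x div (2 ^ t * 2 ^ l) = int (sign_bit x) * 2 + int (lead_bit x)"
    using 1 b by (simp add: zdiv_zmult2_eq)
  then show "fl_word t l x div (2 ^ t * 2 ^ l) mod 2 = int (lead_bit x)" using b by simp
  show "fl_word t l x div (2 ^ t * 2 ^ l * 2) = int (sign_bit x)"
    using 2 b by (subst zdiv_zmult2_eq) auto
qed

section \<open>Weakest preconditions for cache-resident code\<close>

text \<open>Total correctness with the trace hidden: all that is kept of it is that every access is
  below \<open>A\<close>. This makes resident computation free however long it takes. Code that also
  touches the stream is treated with \<open>run\<close> directly.\<close>

definition wp :: "int \<Rightarrow> nat \<Rightarrow> com \<Rightarrow> (regs \<Rightarrow> memory \<Rightarrow> bool) \<Rightarrow> regs \<Rightarrow> memory \<Rightarrow> bool" where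
  "wp W A c Q s m \<longleftrightarrow>
     (\<exists>tr s' m'. run W c (s, m) tr (s', m') \<and> (\<forall>a\<in>set tr. addr a < A) \<and> Q s' m')"

lemma wp_mono: "wp W A c Q s m \<Longrightarrow> (\<And>s' m'. Q s' m' \<Longrightarrow> Q' s' m') \<Longrightarrow> wp W A c Q' s m"
  unfolding wp_def by blast

lemma wp_Skip: "Q s m \<Longrightarrow> wp W A Skip Q s m"
  unfolding wp_def using run.Skip by fastforce

lemma wp_Assign: "\<bar>aval a s\<bar> < W \<Longrightarrow> Q (s(x := aval a s)) m \<Longrightarrow> wp W A (Assign x a) Q s m"
  unfolding wp_def using run.Assign by fastforce

lemma wp_Load:
  assumes "aval a s = int b" "b < A" "int b < W" "\<bar>m b\<bar> < W" "Q (s(x := m b)) m"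
  shows "wp W A (Load x a) Q s m"
  unfolding wp_def using run.Load[of a s W m x] assms
  by (intro exI[of _ "[Rd b]"] exI[of _ "s(x := m b)"] exI[of _ m]) auto

lemma wp_Store:
  assumes "aval a s = int b" "b < A" "int b < W" "\<bar>aval e s\<bar> < W" "Q s (m(b := aval e s))"
  shows "wp W A (Store a e) Q s m"
  unfolding wp_def using run.Store[of a s W e m] assms
  by (intro exI[of _ "[Wr b]"] exI[of _ s] exI[of _ "m(b := aval e s)"]) auto

lemma wp_Seq:
  assumes "wp W A c1 (\<lambda>s m. wp W A c2 Q s m) s m"
  shows "wp W A (Seq c1 c2) Q s m"
proof -
  from assms obtain tr1 s1 m1 where 1: "run W c1 (s, m) tr1 (s1, m1)" "\<forall>a\<in>set tr1. addr a < A"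
    and "wp W A c2 Q s1 m1" unfolding wp_def by blast
  then obtain tr2 s2 m2 where 2: "run W c2 (s1, m1) tr2 (s2, m2)" "\<forall>a\<in>set tr2. addr a < A" "Q s2 m2"
    unfolding wp_def by blast
  have "run W (Seq c1 c2) (s, m) (tr1 @ tr2) (s2, m2)" by (rule run.Seq[OF 1(1) 2(1)])
  moreover have "\<forall>a\<in>set (tr1 @ tr2). addr a < A" using 1(2) 2(2) by auto
  ultimately show ?thesis unfolding wp_def using 2(3) by blast
qed

lemma wp_If:
  assumes "bval b s \<Longrightarrow> wp W A c1 Q s m" "\<not> bval b s \<Longrightarrow> wp W A c2 Q s m"
  shows "wp W A (If b c1 c2) Q s m"
proof (cases "bval b s")
  case True
  then show ?thesis using assms(1) run.IfTrue[of b "(s, m)"] unfolding wp_def by fastforce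
next
  case False
  then show ?thesis using assms(2) run.IfFalse[of b "(s, m)"] unfolding wp_def by fastforce
qed

lemma wp_While:
  fixes \<mu> :: "regs \<Rightarrow> nat"
  assumes "I s m"
    and step: "\<And>s m. I s m \<Longrightarrow> bval b s \<Longrightarrow> wp W A c (\<lambda>s' m'. I s' m' \<and> \<mu> s' < \<mu> s) s m"
    and exit: "\<And>s m. I s m \<Longrightarrow> \<not> bval b s \<Longrightarrow> Q s m"
  shows "wp W A (While b c) Q s m"
  using assms(1)
proof (induction "\<mu> s" arbitrary: s m rule: less_induct)
  case less
  show ?case
  proof (cases "bval b s")
    case True
    obtain tr1 s1 m1 where 1: "run W c (s, m) tr1 (s1, m1)" "\<forall>a\<in>set tr1. addr a < A"
      "I s1 m1" "\<mu> s1 < \<mu> s"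
      using step[OF less.prems True] unfolding wp_def by blast
    obtain tr2 s2 m2 where 2: "run W (While b c) (s1, m1) tr2 (s2, m2)" "\<forall>a\<in>set tr2. addr a < A" "Q s2 m2"
      using less.hyps[OF 1(4,3)] unfolding wp_def by blast
    have "run W (While b c) (s, m) (tr1 @ tr2) (s2, m2)"
      using run.WhileTrue[of b "(s, m)" W c] True 1(1) 2(1) by simp
    moreover have "\<forall>a\<in>set (tr1 @ tr2). addr a < A" using 1(2) 2(2) by auto
    ultimately show ?thesis unfolding wp_def using 2(3) by blast
  next
    case False
    have "run W (While b c) (s, m) [] (s, m)" by (rule run.WhileFalse) (use False in simp)
    then show ?thesis using exit[OF less.prems False] unfolding wp_def by (metis empty_iff list.set(1))
  qed
qed

section \<open>Packed lists of coefficients\<close>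

definition fields :: "int \<Rightarrow> (nat \<Rightarrow> int) \<Rightarrow> nat \<Rightarrow> int" where
  "fields Z d q = (\<Sum>j<32. d (32 * q + j) * Z ^ j)"

lemma digit_sum_bounds:
  fixes Z :: int
  assumes "\<And>j. 0 \<le> f j \<and> f j < Z"
  shows "0 \<le> (\<Sum>j<k. f j * Z ^ j) \<and> (\<Sum>j<k. f j * Z ^ j) < Z ^ k"
proof (induction k)
  case (Suc k)
  have Z: "0 \<le> Z" using assms[of 0] by linarith
  have "f k * Z ^ k \<le> (Z - 1) * Z ^ k" using assms[of k] Z by (intro mult_right_mono) auto
  moreover have "0 \<le> f k * Z ^ k" using assms[of k] Z by simp
  ultimately show ?case using Suc by (auto simp: algebra_simps)
qed simp

lemma digit_sum_nth:
  fixes Z :: int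
  assumes d: "\<And>j. 0 \<le> f j \<and> f j < Z" and "i < k"
  shows "(\<Sum>j<k. f j * Z ^ j) div Z ^ i mod Z = f i"
proof -
  have Z: "0 < Z" using d[of 0] by linarith
  have "{..<k} = {..<i} \<union> ({i} \<union> {Suc i..<k})" using assms(2) by auto
  then have "(\<Sum>j<k. f j * Z ^ j) = (\<Sum>j\<in>{..<i} \<union> ({i} \<union> {Suc i..<k}). f j * Z ^ j)" by (rule sum.cong) simp
  also have "\<dots> = (\<Sum>j<i. f j * Z ^ j) + (\<Sum>j\<in>{i} \<union> {Suc i..<k}. f j * Z ^ j)"
    by (rule sum.union_disjoint) auto
  also have "(\<Sum>j\<in>{i} \<union> {Suc i..<k}. f j * Z ^ j) = f i * Z ^ i + (\<Sum>j\<in>{Suc i..<k}. f j * Z ^ j)"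
    by (subst sum.union_disjoint) auto
  also have "(\<Sum>j\<in>{Suc i..<k}. f j * Z ^ j) = (\<Sum>j\<in>{Suc i..<k}. f j * Z ^ (j - Suc i)) * Z * Z ^ i"
    unfolding sum_distrib_right
  proof (rule sum.cong[OF refl])
    fix j assume "j \<in> {Suc i..<k}"
    then have "Z ^ j = Z ^ (j - Suc i) * Z * Z ^ i"
      by (metis atLeastLessThan_iff le_add_diff_inverse2 mult.assoc power_Suc power_add)
    then show "f j * Z ^ j = f j * Z ^ (j - Suc i) * Z * Z ^ i" by simp
  qed
  finally have "(\<Sum>j<k. f j * Z ^ j)
      = (\<Sum>j<i. f j * Z ^ j) + (f i + (\<Sum>j\<in>{Suc i..<k}. f j * Z ^ (j - Suc i)) * Z) * Z ^ i"
    by (simp add: distrib_right)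
  moreover have "(\<Sum>j<i. f j * Z ^ j) div Z ^ i = 0"
    using digit_sum_bounds[of f Z i] d by (simp add: div_pos_pos_trivial)
  ultimately have "(\<Sum>j<k. f j * Z ^ j) div Z ^ i = f i + (\<Sum>j\<in>{Suc i..<k}. f j * Z ^ (j - Suc i)) * Z"
    using Z by simp
  then show ?thesis using d[of i] by simp
qed

lemma fields_bounds:
  assumes "\<And>i. 0 \<le> d i \<and> d i < Z"
  shows "0 \<le> fields Z d q" "fields Z d q < Z ^ 32"
  unfolding fields_def using digit_sum_bounds[of "\<lambda>j. d (32 * q + j)" Z 32] assms by auto

lemma fields_nth:
  assumes "\<And>i. 0 \<le> d i \<and> d i < Z"
  shows "fields Z d (i div 32) div Z ^ (i mod 32) mod Z = d i"
  unfolding fields_def using digit_sum_nth[of "\<lambda>j. d (32 * (i div 32) + j)" Z "i mod 32" 32] assms by simp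

lemma fields_upd:
  "fields Z (d(i := d i + x)) q = fields Z d q + (if q = i div 32 then x * Z ^ (i mod 32) else 0)"
proof (cases "q = i div 32")
  case True
  have "fields Z (d(i := d i + x)) q = (\<Sum>j<32. d (32 * q + j) * Z ^ j + (if j = i mod 32 then x * Z ^ j else 0))"
    unfolding fields_def
  proof (rule sum.cong[OF refl])
    fix j :: nat assume "j \<in> {..<32}"
    then have "32 * q + j = i \<longleftrightarrow> j = i mod 32" using True by (metis add_left_cancel mult_div_mod_eq)
    then show "(d(i := d i + x)) (32 * q + j) * Z ^ j
      = d (32 * q + j) * Z ^ j + (if j = i mod 32 then x * Z ^ j else 0)"
      by (auto simp: distrib_right)
  qed
  then show ?thesis using True by (simp add: sum.distrib fields_def)
next
  case False
  then have "32 * q + j \<noteq> i" if "j < 32" for j using that by auto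
  then show ?thesis using False by (simp add: fields_def)
qed

text \<open>Only cells that hold at least one entry are constrained. If 32 divides
  \<open>len\<close>, the cell for the next entry may still contain input.\<close>

definition stored :: "int \<Rightarrow> (nat \<Rightarrow> int) \<Rightarrow> nat \<Rightarrow> memory \<Rightarrow> bool" where
  "stored Z d len m \<longleftrightarrow> (\<forall>q. 32 * q < len \<longrightarrow> m q = fields Z d q)"

text \<open>Covers both changing an entry (\<open>i < len\<close>) and appending one
  (\<open>i = len\<close>). The contents of the affected cell are a separate assumption because
  \<open>stored\<close> says nothing about a fresh cell.\<close>

lemma stored_upd:
  assumes "stored Z d len m" "i \<le> len" "m (i div 32) = fields Z d (i div 32)" "len' \<le> max len (Suc i)"
  shows "stored Z (d(i := d i + x)) len' (m(i div 32 := m (i div 32) + x * Z ^ (i mod 32)))"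
  unfolding stored_def fields_upd
proof (intro allI impI)
  fix q assume q: "32 * q < len'"
  show "(m(i div 32 := m (i div 32) + x * Z ^ (i mod 32))) q
      = fields Z d q + (if q = i div 32 then x * Z ^ (i mod 32) else 0)"
  proof (cases "q = i div 32")
    case False
    have "32 * q < len"
    proof (rule ccontr)
      assume "\<not> 32 * q < len"
      then have "32 * q = i" using q assms(2,4) by auto
      then show False using False by auto
    qed
    then show ?thesis using assms(1) False by (simp add: stored_def)
  qed (use assms(3) in simp)
qed

text \<open>An entry \<open>(k, c)\<close> stands for \<open>c * 2 ^ k\<close>; the bias \<open>H\<close> makes its field nonnegative.\<close>

type_synonym entries = "(nat \<times> int) list"

section \<open>Sums of entries and the carry between consecutive exponents\<close>

definition vsum :: "entries \<Rightarrow> int" where "vsum al = (\<Sum>(k, c)\<leftarrow>al. c * 2 ^ k)"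
definition asum :: "entries \<Rightarrow> int" where "asum al = (\<Sum>(k, c)\<leftarrow>al. \<bar>c\<bar>)"
definition ksum :: "entries \<Rightarrow> nat \<Rightarrow> int" where "ksum al x = (\<Sum>(k, c)\<leftarrow>al. if k = x then c else 0)"
definition low :: "entries \<Rightarrow> nat \<Rightarrow> int" where "low al e = (\<Sum>(k, c)\<leftarrow>al. if k \<le> e then c * 2 ^ k else 0)"

lemma low_0: "low al 0 = ksum al 0"
  by (induction al) (auto simp: low_def ksum_def)

lemma low_Suc: "low al (Suc e) = low al e + ksum al (Suc e) * 2 ^ Suc e"
  by (induction al) (auto simp: low_def ksum_def distrib_right le_Suc_eq)

text \<open>The carry step: the next quotient depends on the previous quotient alone, not on the
  remainder lost in it, because nested floor divisions compose.\<close>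

lemma low_div_Suc: "low al (Suc e) div 2 ^ Suc e = low al e div 2 ^ e div 2 + ksum al (Suc e)"
proof -
  have "low al (Suc e) div 2 ^ Suc e = ksum al (Suc e) + low al e div 2 ^ Suc e"
    unfolding low_Suc by (rule div_mult_self1) simp
  also have "low al e div 2 ^ Suc e = low al e div 2 ^ e div 2"
    unfolding power_Suc2 by (simp add: zdiv_zmult2_eq)
  finally show ?thesis by simp
qed

lemma vsum_low: "\<exists>u. vsum al = low al e + u * 2 ^ Suc e"
proof (induction al)
  case (Cons a al)
  obtain k c where a: "a = (k, c)" by fastforce
  from Cons obtain u where u: "vsum al = low al e + u * 2 ^ Suc e" by blast
  show ?case
  proof (cases "k \<le> e")
    case True
    then show ?thesis using u by (auto simp: vsum_def low_def a)
  next
    case False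
    then have "(2::int) ^ k = 2 ^ (k - Suc e) * 2 ^ Suc e" by (simp flip: power_add power_Suc)
    then have "vsum (a # al) = low (a # al) e + (u + c * 2 ^ (k - Suc e)) * 2 ^ Suc e"
      using u False by (simp add: vsum_def low_def a distrib_right)
    then show ?thesis by blast
  qed
qed (simp add: vsum_def low_def)

text \<open>Entries with larger keys contribute multiples of \<open>2 ^ Suc e\<close>, so bit
  \<open>e\<close> of the exact sum can be read off the prefix quotient.\<close>

lemma low_div_mod_2: "low al e div 2 ^ e mod 2 = vsum al div 2 ^ e mod 2"
proof -
  obtain u where "vsum al = low al e + u * 2 ^ Suc e" using vsum_low by blast
  then have "vsum al = low al e + (2 * u) * 2 ^ e" by simp
  then have "vsum al div 2 ^ e = 2 * u + low al e div 2 ^ e" by (simp only: div_mult_self1) simp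
  then show ?thesis by simp
qed

lemma low_eq_vsum: "(\<And>k c. (k, c) \<in> set al \<Longrightarrow> k \<le> e) \<Longrightarrow> low al e = vsum al"
  unfolding low_def vsum_def by (intro arg_cong[where f = sum_list] map_cong) auto

lemma asum_nonneg: "0 \<le> asum al"
  by (induction al) (auto simp: asum_def)

lemma abs_low_le: "\<bar>low al e\<bar> \<le> asum al * 2 ^ e"
proof (induction al)
  case (Cons a al)
  obtain k c where a: "a = (k, c)" by fastforce
  have "\<bar>if k \<le> e then c * 2 ^ k else 0\<bar> \<le> \<bar>c\<bar> * 2 ^ e"
    by (auto simp: abs_mult intro!: mult_left_mono power_increasing)
  then show ?case using Cons unfolding low_def asum_def by (simp add: a distrib_right)
qed (simp add: low_def asum_def)

text \<open>Keeps the carry in one word: relative to \<open>2 ^ e\<close>, an entry with key at most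
  \<open>e\<close> weighs no more than its coefficient.\<close>

lemma abs_low_div_le: "\<bar>low al e div 2 ^ e\<bar> \<le> asum al"
proof -
  have *: "- asum al * 2 ^ e \<le> low al e" "low al e \<le> asum al * 2 ^ e" using abs_low_le[of al e] by (auto simp: abs_le_iff)
  have "(- asum al * 2 ^ e) div 2 ^ e \<le> low al e div 2 ^ e" by (rule zdiv_mono1[OF *(1)]) simp
  moreover have "low al e div 2 ^ e \<le> (asum al * 2 ^ e) div 2 ^ e" by (rule zdiv_mono1[OF *(2)]) simp
  moreover have "(- asum al * 2 ^ e) div 2 ^ e = - asum al" by (rule nonzero_mult_div_cancel_right) simp
  moreover have "(asum al * 2 ^ e) div 2 ^ e = asum al" by (rule nonzero_mult_div_cancel_right) simp
  ultimately show ?thesis by linarith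
qed

lemma abs_ksum_le: "\<bar>ksum al x\<bar> \<le> asum al"
  by (induction al) (auto simp: ksum_def asum_def)

lemma asum_take_le: "asum (take i al) \<le> asum al"
  using asum_nonneg[of "drop i al"]
  by (metis add.commute append_take_drop_id asum_def le_add_same_cancel2 map_append sum_list_append)

lemma abs_entry_le: "i < length al \<Longrightarrow> \<bar>snd (al ! i)\<bar> \<le> asum al"
proof (induction al arbitrary: i)
  case (Cons a al)
  then show ?case using asum_nonneg[of al] by (cases i) (fastforce simp: asum_def split: prod.splits)+
qed simp

lemma ksum_take_Suc:
  "i < length al \<Longrightarrow> ksum (take (Suc i) al) x = ksum (take i al) x + (if fst (al ! i) = x then snd (al ! i) else 0)"
  by (simp add: take_Suc_conv_app_nth ksum_def split: prod.split)

text \<open>With coefficients below \<open>H\<close> in absolute value, \<open>c + H\<close> lies in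
  \<open>[0, 2 * H)\<close>, so key and coefficient are quotient and remainder by
  \<open>2 * H\<close>. The value 0 past the end turns appending into adding to an empty
  field.\<close>

definition digits :: "int \<Rightarrow> entries \<Rightarrow> nat \<Rightarrow> int" where
  "digits H al i = (if i < length al then int (fst (al ! i)) * (2 * H) + snd (al ! i) + H else 0)"

lemma digit_bounds:
  assumes "asum al < H" "\<And>k c. (k, c) \<in> set al \<Longrightarrow> int k < L" "0 < L"
  shows "0 \<le> digits H al i \<and> digits H al i < L * (2 * H)"
    "i < length al \<Longrightarrow> digits H al i div (2 * H) = int (fst (al ! i))"
    "i < length al \<Longrightarrow> digits H al i mod (2 * H) - H = snd (al ! i)"
proof -
  have H: "0 < H" using assms(1) asum_nonneg[of al] by linarith
  have c: "0 \<le> snd (al ! i) + H \<and> snd (al ! i) + H < 2 * H" if "i < length al"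
    using abs_entry_le[OF that] assms(1) by linarith
  have d: "digits H al i = (snd (al ! i) + H) + int (fst (al ! i)) * (2 * H)" if "i < length al"
    using that by (simp add: digits_def)
  show "i < length al \<Longrightarrow> digits H al i div (2 * H) = int (fst (al ! i))"
    using d c H by (simp add: div_pos_pos_trivial)
  show "i < length al \<Longrightarrow> digits H al i mod (2 * H) - H = snd (al ! i)"
    using d c H by (simp add: mod_pos_pos_trivial)
  show "0 \<le> digits H al i \<and> digits H al i < L * (2 * H)"
  proof (cases "i < length al")
    case True
    then have "int (fst (al ! i)) + 1 \<le> L" using assms(2)[of "fst (al ! i)" "snd (al ! i)"] by simp
    then have "(int (fst (al ! i)) + 1) * (2 * H) \<le> L * (2 * H)" using H by (intro mult_right_mono) auto
    moreover have "0 \<le> int (fst (al ! i)) * (2 * H)" using H by simp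
    ultimately show ?thesis using d[OF True] c[OF True] by (simp add: distrib_right)
  next
    case False
    then show ?thesis using H assms(3) by (simp add: digits_def)
  qed
qed

lemma digits_append:
  "digits H (al @ [(k, c)]) = (digits H al)(length al := digits H al (length al) + (int k * (2 * H) + c + H))"
  by (rule ext) (auto simp: digits_def nth_append)

lemma digits_update:
  assumes "i < length al" "fst (al ! i) = k"
  shows "digits H (al[i := (k, snd (al ! i) + c)]) = (digits H al)(i := digits H al i + c)"
  by (rule ext) (use assms in \<open>auto simp: digits_def nth_list_update\<close>)

lemma vsum_append: "vsum (al @ [(k, c)]) = vsum al + c * 2 ^ k"
  by (simp add: vsum_def)

lemma asum_append: "asum (al @ [(k, c)]) = asum al + \<bar>c\<bar>"
  by (simp add: asum_def)

lemma vsum_update: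
  "i < length al \<Longrightarrow> fst (al ! i) = k \<Longrightarrow> vsum (al[i := (k, snd (al ! i) + c)]) = vsum al + c * 2 ^ k"
proof (induction al arbitrary: i)
  case (Cons a al)
  then show ?case by (cases i) (auto simp: vsum_def case_prod_beta distrib_right)
qed simp

lemma asum_update:
  "i < length al \<Longrightarrow> fst (al ! i) = k \<Longrightarrow> asum (al[i := (k, snd (al ! i) + c)]) \<le> asum al + \<bar>c\<bar>"
proof (induction al arbitrary: i)
  case (Cons a al)
  then show ?case by (cases i) (auto simp: asum_def case_prod_beta)
qed simp

section \<open>The summation program\<close>

notation Seq (infixr ";;" 60)

text \<open>The constants are \<open>rT = 2 ^ t\<close>, \<open>rL = 2 ^ l\<close>, \<open>rr = log2 R\<close>, the bias \<open>rH\<close> of coefficients and the base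
  \<open>rZ\<close> of fields. While entries are traversed, \<open>rpw = rZ ^ (ridx mod 32)\<close> selects the field \<open>rent\<close> of the
  cell \<open>rcell\<close>.\<close>

abbreviation (input) "rn \<equiv> 0 :: nat"
abbreviation (input) "rt \<equiv> 1 :: nat"
abbreviation (input) "rl \<equiv> 2 :: nat"
abbreviation (input) "rR \<equiv> 3 :: nat"
abbreviation (input) "rT \<equiv> 4 :: nat"
abbreviation (input) "rL \<equiv> 5 :: nat"
abbreviation (input) "rr \<equiv> 6 :: nat"
abbreviation (input) "rH \<equiv> 7 :: nat"
abbreviation (input) "rZ \<equiv> 8 :: nat"
abbreviation (input) "ri \<equiv> 9 :: nat"
abbreviation (input) "rlen \<equiv> 10 :: nat"
abbreviation (input) "rw \<equiv> 11 :: nat"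
abbreviation (input) "rk \<equiv> 12 :: nat"
abbreviation (input) "rc \<equiv> 13 :: nat"
abbreviation (input) "rj \<equiv> 14 :: nat"
abbreviation (input) "ridx \<equiv> 15 :: nat"
abbreviation (input) "rpw \<equiv> 16 :: nat"
abbreviation (input) "rcell \<equiv> 17 :: nat"
abbreviation (input) "rent \<equiv> 18 :: nat"
abbreviation (input) "rpos \<equiv> 19 :: nat"
abbreviation (input) "rppw \<equiv> 20 :: nat"
abbreviation (input) "rE \<equiv> 21 :: nat"
abbreviation (input) "rF \<equiv> 22 :: nat"
abbreviation (input) "rx \<equiv> 23 :: nat"
abbreviation (input) "rv \<equiv> 24 :: nat"
abbreviation (input) "rQ \<equiv> 25 :: nat"
abbreviation (input) "rflag \<equiv> 26 :: nat"
abbreviation (input) "re \<equiv> 27 :: nat"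
abbreviation (input) "rout \<equiv> 28 :: nat"
abbreviation (input) "rs \<equiv> 29 :: nat"

definition Eq :: "aexp \<Rightarrow> aexp \<Rightarrow> bexp" where
  "Eq a b = Conj (Neg (Less a b)) (Neg (Less b a))"

lemma bval_Eq [simp]: "bval (Eq a b) s \<longleftrightarrow> aval a s = aval b s"
  unfolding Eq_def by auto

definition times_pow2 :: "nat \<Rightarrow> nat \<Rightarrow> com" where
  "times_pow2 x y =
     Assign rj (Const 0) ;;
     While (Less (Reg rj) (Reg y))
       (Assign x (Mul (Reg x) (Const 2)) ;; Assign rj (Add (Reg rj) (Const 1)))"

lemma wp_times_pow2:
  assumes "s y = int e" "x \<noteq> rj" "y \<noteq> rj" "y \<noteq> x" "\<bar>s x\<bar> * 2 ^ e < W" "int e < W"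
    and Q: "\<And>s'. s' x = s x * 2 ^ e \<Longrightarrow> (\<And>z. z \<noteq> x \<Longrightarrow> z \<noteq> rj \<Longrightarrow> s' z = s z) \<Longrightarrow> Q s' m"
  shows "wp W A (times_pow2 x y) Q s m"
  unfolding times_pow2_def
proof (rule wp_Seq, rule wp_Assign)
  show "\<bar>aval (Const 0) s\<bar> < W" using assms(6) by simp
  define I where "I s' m' \<longleftrightarrow> m' = m \<and> (\<exists>i\<le>e. s' rj = int i \<and> s' x = s x * 2 ^ i) \<and>
      (\<forall>z. z \<noteq> x \<longrightarrow> z \<noteq> rj \<longrightarrow> s' z = s z)" for s' m'
  show "wp W A (While (Less (Reg rj) (Reg y))
       (Assign x (Mul (Reg x) (Const 2)) ;; Assign rj (Add (Reg rj) (Const 1)))) Q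
       (s(rj := aval (Const 0) s)) m"
  proof (rule wp_While[where I = I and \<mu> = "\<lambda>s'. e - nat (s' rj)"])
    show "I (s(rj := aval (Const 0) s)) m" using assms(2) by (auto simp: I_def intro!: exI[of _ 0])
  next
    fix s' m' assume I: "I s' m'" and "bval (Less (Reg rj) (Reg y)) s'"
    then obtain i where i: "i < e" "s' rj = int i" "s' x = s x * 2 ^ i"
      using assms(1,3,4) by (auto simp: I_def)
    have "\<bar>s x\<bar> * 2 ^ Suc i \<le> \<bar>s x\<bar> * 2 ^ e" using i by (intro mult_left_mono power_increasing) auto
    then have "\<bar>s' x * 2\<bar> < W" using assms(5) by (simp add: i abs_mult)
    then show "wp W A (Assign x (Mul (Reg x) (Const 2)) ;; Assign rj (Add (Reg rj) (Const 1)))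
        (\<lambda>s'' m''. I s'' m'' \<and> e - nat (s'' rj) < e - nat (s' rj)) s' m'"
      using i I assms(2,6) by (intro wp_Seq wp_Assign) (auto simp: I_def intro!: exI[of _ "Suc i"])
  next
    fix s' m' assume I: "I s' m'" and b: "\<not> bval (Less (Reg rj) (Reg y)) s'"
    then obtain i where i: "i \<le> e" "s' rj = int i" "s' x = s x * 2 ^ i" by (auto simp: I_def)
    moreover have "s' y = int e" using I assms(1,3,4) by (simp add: I_def)
    ultimately have "i = e" using b by simp
    then show "Q s' m'" using Q[of s'] I i by (auto simp: I_def)
  qed
qed

definition for_entries :: "com \<Rightarrow> com" where
  "for_entries c =
     Assign ridx (Const 0) ;; Assign rpw (Const 1) ;;
     While (Less (Reg ridx) (Reg rlen))
       (Load rcell (Div (Reg ridx) (Const 32)) ;;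
        Assign rent (Mod (Div (Reg rcell) (Reg rpw)) (Reg rZ)) ;;
        c ;;
        Assign ridx (Add (Reg ridx) (Const 1)) ;;
        If (Less (Mod (Reg ridx) (Const 32)) (Const 1))
          (Assign rpw (Const 1)) (Assign rpw (Mul (Reg rpw) (Reg rZ))))"

lemma wp_for_entries:
  assumes st: "stored Z d len m" and d: "\<And>i. 0 \<le> d i \<and> d i < Z"
    and s: "s rlen = int len" "s rZ = Z" and W: "len \<le> 32 * A" "int len < W" "Z ^ 32 \<le> W" "1 < Z"
    and J0: "J 0 s"
    and stable: "\<And>i s x v. J i s \<Longrightarrow> x \<in> {ridx, rpw, rcell, rent} \<Longrightarrow> J i (s(x := v))"
    and body: "\<And>i s'. i < len \<Longrightarrow> J i s' \<Longrightarrow> s' ridx = int i \<Longrightarrow> s' rent = d i \<Longrightarrow> s' rpw = Z ^ (i mod 32)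
       \<Longrightarrow> s' rlen = int len \<Longrightarrow> s' rZ = Z
       \<Longrightarrow> wp W A c (\<lambda>s'' m''. m'' = m \<and> J (Suc i) s'' \<and> (\<forall>x\<in>{ridx, rpw, rlen, rZ}. s'' x = s' x)) s' m"
    and Q: "\<And>s'. J len s' \<Longrightarrow> s' ridx = int len \<Longrightarrow> s' rpw = Z ^ (len mod 32) \<Longrightarrow> s' rlen = int len \<Longrightarrow> s' rZ = Z \<Longrightarrow> Q s' m"
  shows "wp W A (for_entries c) Q s m"
proof -
  have Zpow: "Z ^ j < W" if "j < 32" for j
    using power_strict_increasing[OF that W(4)] W(3) by linarith
  have W1: "1 < W" using Zpow[of 1] W(4) by simp
  define I where "I s' m' \<longleftrightarrow> m' = m \<and> (\<exists>i\<le>len. J i s' \<and> s' ridx = int i \<and> s' rpw = Z ^ (i mod 32)) \<and>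
    s' rlen = int len \<and> s' rZ = Z" for s' m'
  show ?thesis
    unfolding for_entries_def
  proof (intro wp_Seq wp_Assign)
    show "\<bar>aval (Const 0) s\<bar> < W" using W1 by simp
    show "\<bar>aval (Const 1) (s(ridx := aval (Const 0) s))\<bar> < W" using W1 by simp
  next
    let ?s0 = "s(ridx := aval (Const 0) s)"
    let ?s1 = "?s0(rpw := aval (Const 1) ?s0)"
    show "wp W A (While (Less (Reg ridx) (Reg rlen))
       (Load rcell (Div (Reg ridx) (Const 32)) ;;
        Assign rent (Mod (Div (Reg rcell) (Reg rpw)) (Reg rZ)) ;;
        c ;;
        Assign ridx (Add (Reg ridx) (Const 1)) ;;
        If (Less (Mod (Reg ridx) (Const 32)) (Const 1))
          (Assign rpw (Const 1)) (Assign rpw (Mul (Reg rpw) (Reg rZ))))) Q ?s1 m"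
    proof (rule wp_While[where I = I and \<mu> = "\<lambda>s'. len - nat (s' ridx)"])
      have "J 0 ?s1" using J0 stable by simp
      then show "I ?s1 m" using s by (auto simp: I_def intro!: exI[of _ 0])
    next
      fix s' m' assume I: "I s' m'" and "bval (Less (Reg ridx) (Reg rlen)) s'"
      then obtain i where i: "i < len" "J i s'" "s' ridx = int i" "s' rpw = Z ^ (i mod 32)"
        and s': "s' rlen = int len" "s' rZ = Z" and m': "m' = m" by (auto simp: I_def)
      have cell: "m (i div 32) = fields Z d (i div 32)" using st i(1) by (auto simp: stored_def)
      have cb: "\<bar>m (i div 32)\<bar> < W" unfolding cell using fields_bounds[of d Z "i div 32", OF d] W(3) by linarith
      have dW: "\<bar>d i\<bar> < W" using d[of i] Zpow[of 1] by simp
      let ?s2 = "s'(rcell := m (i div 32))"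
      let ?s3 = "?s2(rent := d i)"
      show "wp W A (Load rcell (Div (Reg ridx) (Const 32)) ;;
        Assign rent (Mod (Div (Reg rcell) (Reg rpw)) (Reg rZ)) ;;
        c ;;
        Assign ridx (Add (Reg ridx) (Const 1)) ;;
        If (Less (Mod (Reg ridx) (Const 32)) (Const 1))
          (Assign rpw (Const 1)) (Assign rpw (Mul (Reg rpw) (Reg rZ))))
        (\<lambda>s'' m''. I s'' m'' \<and> len - nat (s'' ridx) < len - nat (s' ridx)) s' m'"
        unfolding m'
      proof (rule wp_Seq, rule wp_Load[where b = "i div 32"])
        show "aval (Div (Reg ridx) (Const 32)) s' = int (i div 32)" using i by (simp add: zdiv_int)
        show "i div 32 < A" using i(1) W(1) by linarith
        show "int (i div 32) < W" using i(1) W(2) by linarith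
        show "\<bar>m (i div 32)\<bar> < W" by (rule cb)
        have ent: "aval (Mod (Div (Reg rcell) (Reg rpw)) (Reg rZ)) ?s2 = d i"
          using i s' cell fields_nth[of d Z i, OF d] by simp
        show "wp W A (Assign rent (Mod (Div (Reg rcell) (Reg rpw)) (Reg rZ)) ;;
          c ;;
          Assign ridx (Add (Reg ridx) (Const 1)) ;;
          If (Less (Mod (Reg ridx) (Const 32)) (Const 1))
            (Assign rpw (Const 1)) (Assign rpw (Mul (Reg rpw) (Reg rZ))))
          (\<lambda>s'' m''. I s'' m'' \<and> len - nat (s'' ridx) < len - nat (s' ridx)) ?s2 m"
        proof (rule wp_Seq, rule wp_Assign, unfold ent, rule dW, rule wp_Seq)
          have "J i ?s3" using i(2) stable by simp
          then have "wp W A c (\<lambda>s'' m''. m'' = m \<and> J (Suc i) s'' \<and> (\<forall>x\<in>{ridx, rpw, rlen, rZ}. s'' x = ?s3 x)) ?s3 m"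
            by (rule body[OF i(1)]) (use i s' in simp_all)
          then show "wp W A c (\<lambda>s m. wp W A (Assign ridx (Add (Reg ridx) (Const 1)) ;;
            If (Less (Mod (Reg ridx) (Const 32)) (Const 1))
            (Assign rpw (Const 1)) (Assign rpw (Mul (Reg rpw) (Reg rZ))))
            (\<lambda>s'' m''. I s'' m'' \<and> len - nat (s'' ridx) < len - nat (s' ridx)) s m) ?s3 m"
          proof (rule wp_mono)
            fix s4 m4 assume 4: "m4 = m \<and> J (Suc i) s4 \<and> (\<forall>x\<in>{ridx, rpw, rlen, rZ}. s4 x = ?s3 x)"
            then have s4: "s4 ridx = int i" "s4 rpw = Z ^ (i mod 32)" "s4 rlen = int len" "s4 rZ = Z"
              using i s' by auto
            let ?s5 = "s4(ridx := int (Suc i))"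
            have fin: "I (?s5(rpw := Z ^ (Suc i mod 32))) m \<and> len - nat ((?s5(rpw := Z ^ (Suc i mod 32))) ridx) < len - nat (s' ridx)"
              using 4 s4 stable i unfolding I_def by (auto intro!: exI[of _ "Suc i"])
            have a: "aval (Add (Reg ridx) (Const 1)) s4 = int (Suc i)" using s4 by simp
            have md: "int (Suc i) mod 32 = int (Suc i mod 32)" by (simp add: zmod_int)
            show "wp W A (Assign ridx (Add (Reg ridx) (Const 1)) ;;
              If (Less (Mod (Reg ridx) (Const 32)) (Const 1))
              (Assign rpw (Const 1)) (Assign rpw (Mul (Reg rpw) (Reg rZ))))
              (\<lambda>s'' m''. I s'' m'' \<and> len - nat (s'' ridx) < len - nat (s' ridx)) s4 m4"
            proof (rule wp_Seq, rule wp_Assign, unfold a)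
              show "\<bar>int (Suc i)\<bar> < W" using i(1) W(2) by linarith
              show "wp W A (If (Less (Mod (Reg ridx) (Const 32)) (Const 1))
                (Assign rpw (Const 1)) (Assign rpw (Mul (Reg rpw) (Reg rZ))))
                (\<lambda>s'' m''. I s'' m'' \<and> len - nat (s'' ridx) < len - nat (s' ridx)) ?s5 m4"
              proof (rule wp_If)
                assume "bval (Less (Mod (Reg ridx) (Const 32)) (Const 1)) ?s5"
                then have "Suc i mod 32 = 0" using md by simp
                then show "wp W A (Assign rpw (Const 1))
                  (\<lambda>s'' m''. I s'' m'' \<and> len - nat (s'' ridx) < len - nat (s' ridx)) ?s5 m4"
                  using fin 4 W1 by (intro wp_Assign) auto
              next
                assume "\<not> bval (Less (Mod (Reg ridx) (Const 32)) (Const 1)) ?s5"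
                then have "Suc i mod 32 \<noteq> 0" using md by simp
                then have "Suc i mod 32 = Suc (i mod 32)" by (simp add: mod_Suc split: if_splits)
                then have "aval (Mul (Reg rpw) (Reg rZ)) ?s5 = Z ^ (Suc i mod 32)" using s4 by simp
                then show "wp W A (Assign rpw (Mul (Reg rpw) (Reg rZ)))
                  (\<lambda>s'' m''. I s'' m'' \<and> len - nat (s'' ridx) < len - nat (s' ridx)) ?s5 m4"
                  using fin 4 Zpow[of "Suc i mod 32"] W(4) by (intro wp_Assign) auto
              qed
            qed
          qed
        qed
      qed
    next
      fix s' m' assume I: "I s' m'" "\<not> bval (Less (Reg ridx) (Reg rlen)) s'"
      then show "Q s' m'" using Q[of s'] unfolding I_def by auto
    qed
  qed
qed

section \<open>Prefix quotients by carrying over the packed entries\<close>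

definition key_is :: "nat \<Rightarrow> bexp" where
  "key_is x = Eq (Div (Reg rent) (Mul (Const 2) (Reg rH))) (Reg x)"

definition entry_coeff :: aexp where
  "entry_coeff = Sub (Mod (Reg rent) (Mul (Const 2) (Reg rH))) (Reg rH)"

text \<open>Leaves in \<open>rv\<close> the quotient by \<open>2 ^ e\<close> of the sum of all entries with key at most \<open>e\<close>, computed by
  carrying from each exponent to the next. Every exponent rescans all entries, which costs time but no
  block transfers.\<close>

definition prefix_sum :: com where
  "prefix_sum =
     Assign rx (Const 0) ;; Assign rv (Const 0) ;;
     While (Neg (Less (Reg re) (Reg rx)))
       (Assign rv (Div (Reg rv) (Const 2)) ;;
        for_entries (If (key_is rx) (Assign rv (Add (Reg rv) entry_coeff)) Skip) ;;
        Assign rx (Add (Reg rx) (Const 1)))"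

text \<open>A significand is below \<open>2 * T\<close> and is shifted by less than
  \<open>log2 R\<close> bits, so \<open>2 * T * R\<close> bounds a coefficient and \<open>H\<close>
  bounds any sum of \<open>n\<close> of them. \<open>L * (2 * H)\<close> leaves room for a key below
  \<open>L\<close> next to a biased coefficient.\<close>

locale params =
  fixes t l r n :: nat and W T L R H Z :: int
  assumes l: "1 \<le> l" and r: "2 \<le> r" and n: "1 \<le> n"
    and T_def: "T = 2 ^ t" and L_def: "L = 2 ^ l" and R_def: "R = 2 ^ r"
    and H_def: "H = 2 * T * R * (int n + 1)" and Z_def: "Z = L * (2 * H)"
    and W: "Z ^ 40 \<le> W"
begin

lemma T: "1 \<le> T" and L: "2 \<le> L" and R: "4 \<le> R"
proof -
  show "1 \<le> T" by (simp add: T_def)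
  have "(2::int) ^ 1 \<le> 2 ^ l" using l by (intro power_increasing) auto
  then show "2 \<le> L" by (simp add: L_def)
  have "(2::int) ^ 2 \<le> 2 ^ r" using r by (intro power_increasing) auto
  then show "4 \<le> R" by (simp add: R_def)
qed

lemma bounds:
  shows "2 * T * R \<le> H" "8 * T \<le> H" "2 * R \<le> H" "8 * int n \<le> H" "8 \<le> H" "4 * H \<le> Z" "8 * L \<le> Z" "32 \<le> Z"
    "T * L * 16 \<le> Z" "32 * Z \<le> W" "Z ^ 32 \<le> W" "Z < W"
proof -
  have n1: "2 \<le> int n + 1" using n by simp
  have TR: "4 \<le> T * R" using mult_mono[of 1 T 4 R] T R by simp
  have "2 * (T * R) * 1 \<le> 2 * (T * R) * (int n + 1)" using TR by (intro mult_left_mono) auto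
  then show 1: "2 * T * R \<le> H" by (simp add: H_def mult.assoc)
  have "T * 4 \<le> T * R" using T R by (intro mult_left_mono) auto
  then show "8 * T \<le> H" using 1 by simp
  have "1 * R \<le> T * R" using T R by (intro mult_right_mono) auto
  then show "2 * R \<le> H" using 1 by simp
  have "2 * 4 * (int n + 1) \<le> 2 * (T * R) * (int n + 1)" by (rule mult_right_mono) (use TR in linarith)+
  then have *: "8 * (int n + 1) \<le> H" by (simp add: H_def mult.assoc)
  then show "8 * int n \<le> H" by simp
  show H8: "8 \<le> H" using \<open>8 * int n \<le> H\<close> n by linarith
  have "2 * (2 * H) \<le> L * (2 * H)" using L H8 by (intro mult_right_mono) auto
  then show HZ: "4 * H \<le> Z" by (simp add: Z_def)
  have "L * 8 \<le> L * (2 * H)" using L H8 by (intro mult_left_mono) auto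
  then show "8 * L \<le> Z" by (simp add: Z_def)
  show Z32: "32 \<le> Z" using HZ H8 by linarith
  have "L * (2 * (8 * T)) \<le> L * (2 * H)" using L \<open>8 * T \<le> H\<close> by (intro mult_left_mono) auto
  then show "T * L * 16 \<le> Z" by (simp add: Z_def mult.commute mult.left_commute)
  have "32 * Z \<le> Z * Z" using Z32 by (intro mult_right_mono) auto
  also have "\<dots> = Z ^ 2" by (simp add: power2_eq_square)
  also have "\<dots> \<le> Z ^ 40" using Z32 by (intro power_increasing) auto
  finally show ZW: "32 * Z \<le> W" using W by linarith
  have "Z ^ 32 \<le> Z ^ 40" using Z32 by (intro power_increasing) auto
  then show "Z ^ 32 \<le> W" using W by linarith
  show "Z < W" using ZW Z32 by linarith
qed

lemma lengths: "int l < L" "int t < T" "int r < R"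
proof -
  have "int k < 2 ^ k" for k by (metis less_exp of_nat_less_iff of_nat_numeral of_nat_power)
  then show "int l < L" "int t < T" "int r < R" by (simp_all add: L_def T_def R_def)
qed

definition const_regs :: "regs \<Rightarrow> bool" where
  "const_regs s \<longleftrightarrow> s rn = int n \<and> s rR = R \<and> s rT = T \<and> s rL = L \<and> s rr = int r \<and> s rH = H \<and> s rZ = Z"

definition entries_ok :: "nat \<Rightarrow> entries \<Rightarrow> regs \<Rightarrow> memory \<Rightarrow> bool" where
  "entries_ok A al s m \<longleftrightarrow> const_regs s \<and> s rlen = int (length al) \<and> length al \<le> n \<and> length al \<le> 32 * A \<and>
     asum al < H \<and> (\<forall>(k, c)\<in>set al. int k < L) \<and> stored Z (digits H al) (length al) m"

lemma wp_entries:
  assumes ok: "entries_ok A al s m"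
    and J0: "J 0 s"
    and stable: "\<And>i s x v. J i s \<Longrightarrow> x \<in> {ridx, rpw, rcell, rent} \<Longrightarrow> J i (s(x := v))"
    and body: "\<And>i s'. i < length al \<Longrightarrow> J i s' \<Longrightarrow> s' ridx = int i
       \<Longrightarrow> s' rent div (2 * H) = int (fst (al ! i)) \<Longrightarrow> s' rent mod (2 * H) - H = snd (al ! i)
       \<Longrightarrow> s' rpw = Z ^ (i mod 32) \<Longrightarrow> s' rlen = int (length al) \<Longrightarrow> s' rZ = Z
       \<Longrightarrow> wp W A c (\<lambda>s'' m''. m'' = m \<and> J (Suc i) s'' \<and> (\<forall>x\<in>{ridx, rpw, rlen, rZ}. s'' x = s' x)) s' m"
    and Q: "\<And>s'. J (length al) s' \<Longrightarrow> s' rpw = Z ^ (length al mod 32) \<Longrightarrow> Q s' m"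
  shows "wp W A (for_entries c) Q s m"
proof -
  have ok': "asum al < H" "\<And>k c. (k, c) \<in> set al \<Longrightarrow> int k < L" "0 < L"
    using ok L by (auto simp: entries_ok_def)
  show ?thesis
  proof (rule wp_for_entries[where len = "length al" and d = "digits H al" and Z = Z and J = J])
    show "stored Z (digits H al) (length al) m" using ok by (simp add: entries_ok_def)
    show "0 \<le> digits H al i \<and> digits H al i < Z" for i unfolding Z_def using digit_bounds(1)[OF ok'] .
    show "s rlen = int (length al)" "s rZ = Z" "length al \<le> 32 * A"
      using ok by (simp_all add: entries_ok_def const_regs_def)
    have "length al \<le> n" using ok by (simp add: entries_ok_def)
    then show "int (length al) < W" using bounds by linarith
    show "Z ^ 32 \<le> W" "1 < Z" using bounds by linarith+
    show "J 0 s" by (rule J0)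
    show "\<And>i s x v. J i s \<Longrightarrow> x \<in> {ridx, rpw, rcell, rent} \<Longrightarrow> J i (s(x := v))" by (rule stable)
  next
    fix i s' assume "i < length al" "J i s'" "s' ridx = int i" "s' rent = digits H al i" "s' rpw = Z ^ (i mod 32)"
      "s' rlen = int (length al)" "s' rZ = Z"
    then show "wp W A c (\<lambda>s'' m''. m'' = m \<and> J (Suc i) s'' \<and> (\<forall>x\<in>{ridx, rpw, rlen, rZ}. s'' x = s' x)) s' m"
      using digit_bounds(2,3)[OF ok', where i = i] by (intro body) auto
  next
    fix s' assume "J (length al) s'" "s' rpw = Z ^ (length al mod 32)"
    then show "Q s' m" by (rule Q)
  qed
qed

lemma entries_ok_cong:
  "entries_ok A al s m \<Longrightarrow> (\<And>z. z \<in> {rn, rR, rT, rL, rr, rH, rZ, rlen} \<Longrightarrow> s' z = s z) \<Longrightarrow> entries_ok A al s' m"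
  unfolding entries_ok_def const_regs_def by simp

lemma wp_prefix_sum:
  assumes ok: "entries_ok A al s m" and e: "s re = int e" "int e < L"
    and Q: "\<And>s'. (\<And>z. z \<notin> {rx, rv, ridx, rpw, rcell, rent} \<Longrightarrow> s' z = s z) \<Longrightarrow> s' rv = low al e div 2 ^ e \<Longrightarrow> Q s' m"
  shows "wp W A prefix_sum Q s m"
proof -
  define frame where "frame s' \<longleftrightarrow> (\<forall>z. z \<notin> {rx, rv, ridx, rpw, rcell, rent} \<longrightarrow> s' z = s z)" for s' :: regs
  \<comment> \<open>\<open>val x\<close> is the content of \<open>rv\<close> before exponent
    \<open>x\<close> is processed, that is, the quotient at \<open>x - 1\<close>; at the start
    nothing has been carried.\<close>
  define val where "val x = (case x of 0 \<Rightarrow> 0 | Suc x' \<Rightarrow> low al x' div 2 ^ x')" for x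
  define I where "I s' m' \<longleftrightarrow> m' = m \<and> frame s' \<and> (\<exists>x\<le>Suc e. s' rx = int x \<and> s' rv = val x)" for s' m'
  have asum: "0 \<le> asum al" "asum al < H" using ok asum_nonneg by (auto simp: entries_ok_def)
  have val_le: "\<bar>val x\<bar> \<le> asum al" for x
    using asum abs_low_div_le[of al] by (auto simp: val_def split: nat.split)
  have val_Suc: "val (Suc x) = val x div 2 + ksum al x" for x
  proof (cases x)
    case 0
    then show ?thesis by (simp add: val_def low_0)
  next
    case (Suc y)
    then show ?thesis using low_div_Suc[of al y] by (simp add: val_def)
  qed
  have W0: "0 < W" using bounds by linarith
  show ?thesis
    unfolding prefix_sum_def
  proof (rule wp_Seq, rule wp_Assign, use W0 in simp, rule wp_Seq, rule wp_Assign, use W0 in simp,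
      rule wp_While[where I = I and \<mu> = "\<lambda>s'. Suc e - nat (s' rx)"])
    show "I (s(rx := aval (Const 0) s, rv := aval (Const 0) (s(rx := aval (Const 0) s)))) m"
      by (auto simp: I_def frame_def val_def intro!: exI[of _ 0])
  next
    fix s' m' assume I: "I s' m'" and "bval (Neg (Less (Reg re) (Reg rx))) s'"
    then obtain x where x: "x \<le> e" "s' rx = int x" "s' rv = val x" and fr: "frame s'" and m': "m' = m"
      using e by (auto simp: I_def frame_def)
    define J where "J i s'' \<longleftrightarrow> frame s'' \<and> s'' rx = int x \<and> s'' rv = val x div 2 + ksum (take i al) x" for i and s'' :: regs
    have Jb: "\<bar>val x div 2 + ksum (take i al) x\<bar> < W" for i
    proof -
      have "\<bar>val x div 2\<bar> \<le> asum al" using val_le[of x] by linarith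
      moreover have "\<bar>ksum (take i al) x\<bar> \<le> asum al" using abs_ksum_le[of "take i al" x] asum_take_le[of i al] by linarith
      ultimately show ?thesis using asum bounds by linarith
    qed
    have xW: "int (Suc x) < W" using x(1) e bounds by linarith
    show "wp W A
       (Assign rv (Div (Reg rv) (Const 2)) ;;
        for_entries (If (key_is rx) (Assign rv (Add (Reg rv) entry_coeff)) Skip) ;;
        Assign rx (Add (Reg rx) (Const 1)))
       (\<lambda>s'' m''. I s'' m'' \<and> Suc e - nat (s'' rx) < Suc e - nat (s' rx)) s' m'"
      unfolding m'
    proof (rule wp_Seq, rule wp_Assign)
      show "\<bar>aval (Div (Reg rv) (Const 2)) s'\<bar> < W" using Jb[of 0] x by (simp add: ksum_def)
      show "wp W A
       (for_entries (If (key_is rx) (Assign rv (Add (Reg rv) entry_coeff)) Skip) ;;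
        Assign rx (Add (Reg rx) (Const 1)))
       (\<lambda>s'' m''. I s'' m'' \<and> Suc e - nat (s'' rx) < Suc e - nat (s' rx)) (s'(rv := aval (Div (Reg rv) (Const 2)) s')) m"
      proof (rule wp_Seq, rule wp_entries[where J = J and al = al])
        show "entries_ok A al (s'(rv := aval (Div (Reg rv) (Const 2)) s')) m"
          by (rule entries_ok_cong[OF ok]) (use fr in \<open>auto simp: frame_def\<close>)
        show "J 0 (s'(rv := aval (Div (Reg rv) (Const 2)) s'))"
          using fr x by (simp add: J_def frame_def ksum_def)
      next
        fix i s'' y v assume "J i s''" "y \<in> {ridx, rpw, rcell, rent}"
        then show "J i (s''(y := v))" by (auto simp: J_def frame_def)
      next
        fix i s'' assume i: "i < length al" "J i s''" "s'' rent div (2 * H) = int (fst (al ! i))"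
          "s'' rent mod (2 * H) - H = snd (al ! i)"
        have rH: "s'' rH = H" using i(2) ok by (simp add: J_def frame_def entries_ok_def const_regs_def)
        show "wp W A (If (key_is rx) (Assign rv (Add (Reg rv) entry_coeff)) Skip)
          (\<lambda>s3 m3. m3 = m \<and> J (Suc i) s3 \<and> (\<forall>x\<in>{ridx, rpw, rlen, rZ}. s3 x = s'' x)) s'' m"
        proof (rule wp_If)
          assume "bval (key_is rx) s''"
          then have "fst (al ! i) = x" using i rH by (simp add: key_is_def J_def)
          then have "aval (Add (Reg rv) entry_coeff) s'' = val x div 2 + ksum (take (Suc i) al) x"
            using i rH by (simp add: entry_coeff_def J_def ksum_take_Suc)
          then show "wp W A (Assign rv (Add (Reg rv) entry_coeff))
            (\<lambda>s3 m3. m3 = m \<and> J (Suc i) s3 \<and> (\<forall>x\<in>{ridx, rpw, rlen, rZ}. s3 x = s'' x)) s'' m"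
            using i Jb[of "Suc i"] by (intro wp_Assign) (auto simp: J_def frame_def)
        next
          assume "\<not> bval (key_is rx) s''"
          then have "fst (al ! i) \<noteq> x" using i rH by (simp add: key_is_def J_def)
          then show "wp W A Skip (\<lambda>s3 m3. m3 = m \<and> J (Suc i) s3 \<and> (\<forall>x\<in>{ridx, rpw, rlen, rZ}. s3 x = s'' x)) s'' m"
            using i by (intro wp_Skip) (simp add: J_def ksum_take_Suc)
        qed
      next
        fix s'' assume J: "J (length al) s''"
        then have a: "aval (Add (Reg rx) (Const 1)) s'' = int (Suc x)" by (simp add: J_def)
        show "wp W A (Assign rx (Add (Reg rx) (Const 1)))
          (\<lambda>s'' m''. I s'' m'' \<and> Suc e - nat (s'' rx) < Suc e - nat (s' rx)) s'' m"
        proof (rule wp_Assign, unfold a)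
          show "\<bar>int (Suc x)\<bar> < W" using xW by simp
          show "I (s''(rx := int (Suc x))) m \<and> Suc e - nat ((s''(rx := int (Suc x))) rx) < Suc e - nat (s' rx)"
            using J x by (auto simp: I_def J_def frame_def val_Suc intro!: exI[of _ "Suc x"])
        qed
      qed
    qed
  next
    fix s' m' assume I: "I s' m'" and b: "\<not> bval (Neg (Less (Reg re) (Reg rx))) s'"
    then obtain x where x: "x \<le> Suc e" "s' rx = int x" "s' rv = val x" and fr: "frame s'" and m': "m' = m"
      by (auto simp: I_def)
    have "s' re = int e" using fr e by (simp add: frame_def)
    then have "x = Suc e" using b x by simp
    then show "Q s' m'" unfolding m' using Q[of s'] fr x by (auto simp: frame_def val_def)
  qed
qed

end

section \<open>Adding one input number to the packed entries\<close>

definition decode :: com where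
  "decode =
     Assign rc (Mul (Sub (Const 1) (Mul (Const 2) (Div (Reg rw) (Mul (Mul (Reg rT) (Reg rL)) (Const 2)))))
       (Add (Mul (Mod (Div (Reg rw) (Mul (Reg rT) (Reg rL))) (Const 2)) (Reg rT)) (Mod (Reg rw) (Reg rT)))) ;;
     Assign re (Mod (Div (Reg rw) (Reg rT)) (Reg rL)) ;;
     Assign rs (Mod (Reg re) (Reg rr)) ;;
     Assign rk (Sub (Reg re) (Reg rs)) ;;
     times_pow2 rc rs"

text \<open>The scan does not stop at a match, so that \<open>rpw\<close> always ends as the weight
  for a new entry; the weight of a match is saved in \<open>rppw\<close>.\<close>

definition search :: com where
  "search =
     Assign rpos (Const (- 1)) ;;
     for_entries (If (key_is rk) (Assign rpos (Reg ridx) ;; Assign rppw (Reg rpw)) Skip)"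

definition add_field :: com where
  "add_field =
     Load rcell (Div (Reg rpos) (Const 32)) ;;
     Store (Div (Reg rpos) (Const 32)) (Add (Reg rcell) (Mul (Reg rc) (Reg rppw)))"

text \<open>A fresh cell still contains input that has already been read, so it is cleared first.\<close>

definition new_entry :: com where
  "new_entry =
     Assign rpos (Reg rlen) ;;
     Assign rppw (Reg rpw) ;;
     Assign rc (Add (Add (Mul (Reg rk) (Mul (Const 2) (Reg rH))) (Reg rc)) (Reg rH)) ;;
     Assign rlen (Add (Reg rlen) (Const 1)) ;;
     If (Less (Mod (Reg rpos) (Const 32)) (Const 1)) (Store (Div (Reg rpos) (Const 32)) (Const 0)) Skip"

definition accumulate :: com where
  "accumulate = decode ;; search ;; If (Less (Reg rpos) (Const 0)) new_entry Skip ;; add_field"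

context params
begin

text \<open>The exponent is split into the start of its group, which becomes the key, and the offset
  within the group, which \<open>coeff\<close> absorbs as a shift.\<close>

definition key :: "fl \<Rightarrow> nat" where "key x = expo x - expo x mod r"

definition coeff :: "fl \<Rightarrow> int" where
  "coeff x = (1 - 2 * int (sign_bit x)) * (int (lead_bit x) * T + int (mant x)) * 2 ^ (expo x mod r)"

text \<open>The last bound is the form in which \<open>times_pow2\<close> needs it: signed
  significand and shift still separate.\<close>

lemma coeff_key:
  assumes "is_fl t l x"
  shows "coeff x * 2 ^ key x = fl_int t x" "\<bar>coeff x\<bar> < 2 * T * R" "int (key x) < L" "r dvd key x"
    "\<bar>(1 - 2 * int (sign_bit x)) * (int (lead_bit x) * T + int (mant x))\<bar> * 2 ^ (expo x mod r) < 2 * T * R"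
proof -
  have s: "sign_bit x = 0 \<or> sign_bit x = 1" using assms unfolding is_fl_def by linarith
  then have sg: "1 - 2 * int (sign_bit x) = (- 1) ^ sign_bit x" by auto
  have "(2::int) ^ (expo x mod r) * 2 ^ key x = 2 ^ expo x"
    unfolding key_def by (simp flip: power_add)
  moreover have "fl_int t x = (- 1) ^ sign_bit x * (int (lead_bit x) * T + int (mant x)) * 2 ^ expo x"
    by (simp add: fl_int_def T_def)
  ultimately show "coeff x * 2 ^ key x = fl_int t x" unfolding coeff_def sg by (simp add: mult.assoc)
  have "lead_bit x \<le> 1" "int (mant x) < T" using assms unfolding is_fl_def T_def by simp_all
  then have "int (lead_bit x) * T \<le> 1 * T" using T by (intro mult_right_mono) auto
  moreover have "0 \<le> int (lead_bit x) * T" using T by simp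
  ultimately have "\<bar>int (lead_bit x) * T + int (mant x)\<bar> < 2 * T" using \<open>int (mant x) < T\<close> by linarith
  then have 1: "\<bar>(1 - 2 * int (sign_bit x)) * (int (lead_bit x) * T + int (mant x))\<bar> < 2 * T"
    unfolding sg abs_mult by (simp add: power_abs)
  have "expo x mod r < r" using r by simp
  then have "(2::int) ^ (expo x mod r) \<le> R" unfolding R_def by (intro power_increasing) auto
  then show 2: "\<bar>(1 - 2 * int (sign_bit x)) * (int (lead_bit x) * T + int (mant x))\<bar> * 2 ^ (expo x mod r) < 2 * T * R"
    using 1 T by (intro mult_less_le_imp_less) auto
  then show "\<bar>coeff x\<bar> < 2 * T * R" unfolding coeff_def by (simp add: abs_mult)
  have "int (expo x) < L" using assms by (simp add: is_fl_def L_def)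
  then show "int (key x) < L" unfolding key_def by linarith
  show "r dvd key x" unfolding key_def by (rule dvd_minus_mod)
qed

lemma wp_decode:
  assumes x: "is_fl t l x" and s: "const_regs s" "s rw = fl_word t l x"
    and Q: "\<And>s'. s' rc = coeff x \<Longrightarrow> s' rk = int (key x) \<Longrightarrow> (\<And>z. z \<notin> {rc, re, rk, rs, rj} \<Longrightarrow> s' z = s z) \<Longrightarrow> Q s' m"
  shows "wp W A decode Q s m"
proof -
  note dec = fl_word_decode[OF x, folded T_def L_def]
  let ?c = "(1 - 2 * int (sign_bit x)) * (int (lead_bit x) * T + int (mant x))"
  have regs: "s rT = T" "s rL = L" "s rr = int r" using s(1) by (simp_all add: const_regs_def)
  have c1: "\<bar>?c\<bar> * 2 ^ (expo x mod r) < W" using coeff_key(5)[OF x] bounds by linarith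
  have "\<bar>?c\<bar> * 1 \<le> \<bar>?c\<bar> * 2 ^ (expo x mod r)" by (intro mult_left_mono) auto
  then have c0: "\<bar>?c\<bar> < W" using c1 by linarith
  have "int (expo x) < L" using x by (simp add: is_fl_def L_def)
  then have eW: "int (expo x) < W" using bounds L by linarith
  then have mW: "int (expo x mod r) < W" by (meson mod_less_eq_dividend of_nat_le_iff order_le_less_trans)
  have kW: "int (key x) < W" using eW by (simp add: key_def)
  have k: "int (expo x) - int (expo x mod r) = int (key x)" by (simp add: key_def of_nat_diff)
  let ?s1 = "s(rc := ?c)"
  let ?s2 = "?s1(re := int (expo x))"
  let ?s3 = "?s2(rs := int (expo x mod r))"
  let ?s4 = "?s3(rk := int (key x))"
  have a1: "aval (Mul (Sub (Const 1) (Mul (Const 2) (Div (Reg rw) (Mul (Mul (Reg rT) (Reg rL)) (Const 2)))))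
       (Add (Mul (Mod (Div (Reg rw) (Mul (Reg rT) (Reg rL))) (Const 2)) (Reg rT)) (Mod (Reg rw) (Reg rT)))) s = ?c"
    using s(2) regs dec by (simp add: mult.commute)
  have a2: "aval (Mod (Div (Reg rw) (Reg rT)) (Reg rL)) ?s1 = int (expo x)" using s(2) regs dec by simp
  have a3: "aval (Mod (Reg re) (Reg rr)) ?s2 = int (expo x mod r)" using regs by (simp add: zmod_int)
  have a4: "aval (Sub (Reg re) (Reg rs)) ?s3 = int (key x)" using k by simp
  have fin: "wp W A (times_pow2 rc rs) Q ?s4 m"
  proof (rule wp_times_pow2[where e = "expo x mod r"])
    show "\<bar>?s4 rc\<bar> * 2 ^ (expo x mod r) < W" using c1 by simp
    fix s' assume s': "s' rc = ?s4 rc * 2 ^ (expo x mod r)" "\<And>z. z \<noteq> rc \<Longrightarrow> z \<noteq> rj \<Longrightarrow> s' z = ?s4 z"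
    show "Q s' m"
    proof (rule Q)
      show "s' rc = coeff x" using s'(1) by (simp add: coeff_def)
      show "s' rk = int (key x)" using s'(2)[of rk] by simp
      show "s' z = s z" if "z \<notin> {rc, re, rk, rs, rj}" for z using s'(2)[of z] that by simp
    qed
  qed (use mW in simp_all)
  show ?thesis
    unfolding decode_def
    apply (rule wp_Seq, rule wp_Assign, unfold a1, rule c0)
    apply (rule wp_Seq, rule wp_Assign, unfold a2, use eW in simp)
    apply (rule wp_Seq, rule wp_Assign, unfold a3, use mW in simp)
    apply (rule wp_Seq, rule wp_Assign, unfold a4, use kW in simp)
    apply (rule fin)
    done
qed

lemma Z_power_less: "j < 32 \<Longrightarrow> \<bar>Z ^ j\<bar> < W"
proof -
  assume "j < 32"
  then have "Z ^ j < Z ^ 32" using bounds(8) by (intro power_strict_increasing) auto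
  moreover have "0 < Z ^ j" using bounds(8) by simp
  ultimately show ?thesis using bounds(11) by linarith
qed

lemma wp_search:
  assumes ok: "entries_ok A al s m" and k: "s rk = int k"
    and Q: "\<And>s'. (\<And>z. z \<notin> {rpos, rppw, ridx, rpw, rcell, rent} \<Longrightarrow> s' z = s z) \<Longrightarrow>
      s' rpw = Z ^ (length al mod 32) \<Longrightarrow>
      s' rpos = - 1 \<and> k \<notin> fst ` set al \<or>
      (\<exists>i<length al. s' rpos = int i \<and> s' rppw = Z ^ (i mod 32) \<and> fst (al ! i) = k) \<Longrightarrow> Q s' m"
  shows "wp W A search Q s m"
proof -
  define J where "J i s' \<longleftrightarrow> (\<forall>z. z \<notin> {rpos, rppw, ridx, rpw, rcell, rent} \<longrightarrow> s' z = s z) \<and>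
    (s' rpos = - 1 \<and> (\<forall>j<i. fst (al ! j) \<noteq> k) \<or>
     (\<exists>j<i. s' rpos = int j \<and> s' rppw = Z ^ (j mod 32) \<and> fst (al ! j) = k))" for i and s' :: regs
  have H: "s rH = H" using ok by (simp add: entries_ok_def const_regs_def)
  have W1: "1 < W" using bounds by linarith
  show ?thesis
    unfolding search_def
  proof (rule wp_Seq, rule wp_Assign, use W1 in simp, rule wp_entries[where J = J and al = al])
    show "entries_ok A al (s(rpos := aval (Const (- 1)) s)) m" by (rule entries_ok_cong[OF ok]) auto
    show "J 0 (s(rpos := aval (Const (- 1)) s))" by (simp add: J_def)
  next
    fix i s' y v assume "J i s'" "y \<in> {ridx, rpw, rcell, rent}"
    then show "J i (s'(y := v))" by (auto simp: J_def)
  next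
    fix i s' assume i: "i < length al" "J i s'" "s' ridx = int i" "s' rent div (2 * H) = int (fst (al ! i))"
      "s' rpw = Z ^ (i mod 32)"
    have kH: "s' rk = int k" "s' rH = H" using i(2) k H by (simp_all add: J_def)
    have iW: "int i < W" using i(1) ok bounds by (simp add: entries_ok_def)
    have pW: "\<bar>Z ^ (i mod 32)\<bar> < W" by (rule Z_power_less) simp
    show "wp W A (If (key_is rk) (Assign rpos (Reg ridx) ;; Assign rppw (Reg rpw)) Skip)
      (\<lambda>s'' m''. m'' = m \<and> J (Suc i) s'' \<and> (\<forall>x\<in>{ridx, rpw, rlen, rZ}. s'' x = s' x)) s' m"
    proof (rule wp_If)
      assume "bval (key_is rk) s'"
      then have "fst (al ! i) = k" using i kH by (simp add: key_is_def)
      then have "J (Suc i) (s'(rpos := int i, rppw := Z ^ (i mod 32)))" using i(2) by (auto simp: J_def)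
      then show "wp W A (Assign rpos (Reg ridx) ;; Assign rppw (Reg rpw))
        (\<lambda>s'' m''. m'' = m \<and> J (Suc i) s'' \<and> (\<forall>x\<in>{ridx, rpw, rlen, rZ}. s'' x = s' x)) s' m"
        using i iW pW by (intro wp_Seq wp_Assign) auto
    next
      assume "\<not> bval (key_is rk) s'"
      then have "fst (al ! i) \<noteq> k" using i kH by (simp add: key_is_def)
      then have "J (Suc i) s'" using i(2) by (auto simp: J_def less_Suc_eq)
      then show "wp W A Skip (\<lambda>s'' m''. m'' = m \<and> J (Suc i) s'' \<and> (\<forall>x\<in>{ridx, rpw, rlen, rZ}. s'' x = s' x)) s' m"
        by (intro wp_Skip) simp
    qed
  next
    fix s' assume J: "J (length al) s'" "s' rpw = Z ^ (length al mod 32)"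
    show "Q s' m"
    proof (rule Q)
      show "s' z = s z" if "z \<notin> {rpos, rppw, ridx, rpw, rcell, rent}" for z using J that by (simp add: J_def)
      show "s' rpw = Z ^ (length al mod 32)" by (rule J(2))
      have "k \<notin> fst ` set al" if "\<forall>j<length al. fst (al ! j) \<noteq> k" using that by (metis imageE in_set_conv_nth)
      then show "s' rpos = - 1 \<and> k \<notin> fst ` set al \<or>
        (\<exists>i<length al. s' rpos = int i \<and> s' rppw = Z ^ (i mod 32) \<and> fst (al ! i) = k)"
        using J(1) unfolding J_def by blast
    qed
  qed
qed

text \<open>A negative \<open>s rc\<close> needs no special treatment: adding it times the weight of
  field \<open>p\<close> is exact on the packed integer, and the bounds on the resulting digits keep
  the cell within a word.\<close>

lemma wp_add_field:
  assumes s: "s rpos = int p" "s rppw = Z ^ (p mod 32)" and p: "p < 32 * A" "p \<le> n"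
    and m: "m (p div 32) = fields Z d (p div 32)"
    and d: "\<And>i. 0 \<le> d i \<and> d i < Z" "\<And>i. 0 \<le> (d(p := d p + s rc)) i \<and> (d(p := d p + s rc)) i < Z"
    and Q: "Q (s(rcell := m (p div 32))) (m(p div 32 := m (p div 32) + s rc * Z ^ (p mod 32)))"
  shows "wp W A add_field Q s m"
proof -
  have pW: "int (p div 32) < W" using p(2) bounds by linarith
  have pA: "p div 32 < A" using p(1) by linarith
  have a: "aval (Div (Reg rpos) (Const 32)) s' = int (p div 32)" if "s' rpos = s rpos" for s'
    using s(1) that by (simp add: zdiv_int)
  have "\<bar>m (p div 32)\<bar> < W" unfolding m using fields_bounds[of d Z "p div 32", OF d(1)] bounds by linarith
  moreover have "m (p div 32) + s rc * Z ^ (p mod 32) = fields Z (d(p := d p + s rc)) (p div 32)"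
    unfolding m fields_upd by simp
  then have "\<bar>m (p div 32) + s rc * Z ^ (p mod 32)\<bar> < W"
    using fields_bounds[of "d(p := d p + s rc)" Z "p div 32", OF d(2)] bounds by linarith
  ultimately show ?thesis
    unfolding add_field_def using Q s(2)
    by (intro wp_Seq wp_Load[where b = "p div 32"] wp_Store[where b = "p div 32"] a pA pW) simp_all
qed

lemma digits_range:
  assumes "asum al < H" "\<And>k c. (k, c) \<in> set al \<Longrightarrow> int k < L"
  shows "0 \<le> digits H al i \<and> digits H al i < Z"
  unfolding Z_def using digit_bounds(1)[OF assms] L by simp

text \<open>Merging and appending end in the same addition to one field. That cells beyond
  \<open>length al div 32\<close> are unchanged is what protects the unread input.\<close>

lemma wp_add_entry:
  assumes ok: "entries_ok A al s m" and k: "s rk = int k" "int k < L" and c: "asum al + \<bar>s rc\<bar> < H"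
    and pw: "s rpw = Z ^ (length al mod 32)"
    and pos: "s rpos = - 1 \<and> length al < 32 * A \<and> length al < n \<and> al' = al @ [(k, s rc)] \<or>
      (\<exists>i<length al. s rpos = int i \<and> s rppw = Z ^ (i mod 32) \<and> fst (al ! i) = k \<and> al' = al[i := (k, snd (al ! i) + s rc)])"
    and Q: "\<And>s' m'. (\<And>z. z \<notin> {rpos, rppw, rc, rlen, rcell} \<Longrightarrow> s' z = s z) \<Longrightarrow> s' rlen = int (length al') \<Longrightarrow>
      stored Z (digits H al') (length al') m' \<Longrightarrow> (\<And>j. length al div 32 < j \<Longrightarrow> m' j = m j) \<Longrightarrow> Q s' m'"
  shows "wp W A (If (Less (Reg rpos) (Const 0)) new_entry Skip ;; add_field) Q s m"
proof (rule wp_Seq, rule wp_If)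
  have dig: "0 \<le> digits H al i \<and> digits H al i < Z" for i
    using ok by (intro digits_range) (auto simp: entries_ok_def)
  have st: "stored Z (digits H al) (length al) m" "s rlen = int (length al)" "s rH = H"
    using ok by (auto simp: entries_ok_def const_regs_def)
  have al': "asum al' \<le> asum al + \<bar>s rc\<bar>"
    using pos asum_update[of _ al k "s rc"] by (auto simp: asum_append)
  have "\<And>k c. (k, c) \<in> set al' \<Longrightarrow> int k < L"
    using pos ok k(2) set_update_subset_insert by (fastforce simp: entries_ok_def)
  then have dig': "0 \<le> digits H al' i \<and> digits H al' i < Z" for i
    using al' c by (intro digits_range) auto
  {
    assume "\<not> bval (Less (Reg rpos) (Const 0)) s"
    then obtain i where i: "i < length al" "s rpos = int i" "s rppw = Z ^ (i mod 32)" "fst (al ! i) = k"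
      and al'_eq: "al' = al[i := (k, snd (al ! i) + s rc)]" using pos by auto
    have d': "digits H al' = (digits H al)(i := digits H al i + s rc)"
      unfolding al'_eq by (rule digits_update[OF i(1,4)])
    have mi: "m (i div 32) = fields Z (digits H al) (i div 32)"
      using st(1) i(1) by (auto simp: stored_def)
    show "wp W A Skip (\<lambda>s m. wp W A add_field Q s m) s m"
    proof (rule wp_Skip, rule wp_add_field[where p = i and d = "digits H al"])
      show "s rpos = int i" "s rppw = Z ^ (i mod 32)" "m (i div 32) = fields Z (digits H al) (i div 32)"
        by (fact i(2), fact i(3), fact mi)
      show "0 \<le> digits H al j \<and> digits H al j < Z" for j by (rule dig)
      show "i < 32 * A" "i \<le> n" using ok i(1) by (auto simp: entries_ok_def)
      show "0 \<le> ((digits H al)(i := digits H al i + s rc)) j \<and> ((digits H al)(i := digits H al i + s rc)) j < Z" for j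
        using dig'[of j] unfolding d' .
      show "Q (s(rcell := m (i div 32))) (m(i div 32 := m (i div 32) + s rc * Z ^ (i mod 32)))"
      proof (rule Q)
        show "stored Z (digits H al') (length al') (m(i div 32 := m (i div 32) + s rc * Z ^ (i mod 32)))"
          unfolding d' by (rule stored_upd[OF st(1) _ mi]) (use i(1) al'_eq in auto)
        fix j assume "length al div 32 < j"
        moreover have "i div 32 \<le> length al div 32" using i(1) by (intro div_le_mono) simp
        ultimately show "(m(i div 32 := m (i div 32) + s rc * Z ^ (i mod 32))) j = m j" by auto
      qed (use st al'_eq in auto)
    qed
  }
  {
    assume "bval (Less (Reg rpos) (Const 0)) s"
    then have new: "length al < 32 * A" "length al < n" "al' = al @ [(k, s rc)]" using pos by auto
    define p where "p = length al"
    define v where "v = int k * (2 * H) + s rc + H"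
    have d': "digits H al' = (digits H al)(p := digits H al p + v)"
      unfolding new(3) p_def v_def by (rule digits_append)
    have "v = digits H al' p" unfolding d' by (simp add: digits_def p_def)
    then have vW: "\<bar>v\<bar> < W" using dig'[of p] bounds by linarith
    have pW: "\<bar>Z ^ (p mod 32)\<bar> < W" by (rule Z_power_less) simp
    have lW: "int (Suc p) < W" using new(2) bounds by (simp add: p_def)
    have pA: "p div 32 < A" using new(1) by (simp add: p_def)
    \<comment> \<open>A cell opened by this entry is cleared; in a cell already in use, the
      remaining fields are zero by \<open>stored\<close>.\<close>
    define m1 where "m1 = (if p mod 32 < 1 then m(p div 32 := 0) else m)"
    have m1: "m1 (p div 32) = fields Z (digits H al) (p div 32)"
    proof (cases "p mod 32 < 1")
      case True
      then have "p = 32 * (p div 32)" by presburger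
      then have "digits H al (32 * (p div 32) + j) = 0" for j by (simp add: digits_def p_def)
      then show ?thesis using True by (simp add: m1_def fields_def)
    next
      case False
      then have "32 * (p div 32) < p" by presburger
      then show ?thesis using False st(1) by (simp add: m1_def stored_def p_def)
    qed
    have st1: "stored Z (digits H al) (length al) m1"
      using st(1) m1 unfolding stored_def m1_def by (auto split: if_splits)
    let ?s = "s(rpos := int p, rppw := Z ^ (p mod 32), rc := v, rlen := int (Suc p))"
    have fin: "wp W A add_field Q ?s m1"
    proof (rule wp_add_field[where p = p and d = "digits H al"])
      show "m1 (p div 32) = fields Z (digits H al) (p div 32)" by (rule m1)
      show "0 \<le> digits H al j \<and> digits H al j < Z" for j by (rule dig)
      show "?s rpos = int p" "?s rppw = Z ^ (p mod 32)" "p < 32 * A" "p \<le> n" using new by (auto simp: p_def)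
      show "0 \<le> ((digits H al)(p := digits H al p + ?s rc)) j \<and> ((digits H al)(p := digits H al p + ?s rc)) j < Z" for j
        using dig'[of j] unfolding d' by simp
      show "Q (?s(rcell := m1 (p div 32))) (m1(p div 32 := m1 (p div 32) + ?s rc * Z ^ (p mod 32)))"
      proof (rule Q)
        have "stored Z (digits H al') (length al') (m1(p div 32 := m1 (p div 32) + v * Z ^ (p mod 32)))"
          unfolding d' by (rule stored_upd[OF st1 _ m1]) (use new in \<open>auto simp: p_def\<close>)
        then show "stored Z (digits H al') (length al') (m1(p div 32 := m1 (p div 32) + ?s rc * Z ^ (p mod 32)))" by simp
        fix j assume "length al div 32 < j"
        then show "(m1(p div 32 := m1 (p div 32) + ?s rc * Z ^ (p mod 32))) j = m j" by (auto simp: m1_def p_def)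
      qed (use new in \<open>auto simp: p_def\<close>)
    qed
    have r1: "aval (Reg rlen) s = int p" using st(2) by (simp add: p_def)
    have r2: "aval (Reg rpw) (s(rpos := int p)) = Z ^ (p mod 32)" using pw by (simp add: p_def)
    have r3: "aval (Add (Add (Mul (Reg rk) (Mul (Const 2) (Reg rH))) (Reg rc)) (Reg rH))
        (s(rpos := int p, rppw := Z ^ (p mod 32))) = v"
      using k(1) st(3) by (simp add: v_def)
    have r4: "aval (Add (Reg rlen) (Const 1)) (s(rpos := int p, rppw := Z ^ (p mod 32), rc := v)) = int (Suc p)"
      using r1 by simp
    have r5: "aval (Div (Reg rpos) (Const 32)) ?s = int (p div 32)" by (simp add: zdiv_int)
    have md: "int p mod 32 < 1 \<longleftrightarrow> p mod 32 < 1"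
    proof -
      have "int p mod 32 = int (p mod 32)" by (simp add: zmod_int)
      then show ?thesis by simp
    qed
    have cnd: "bval (Less (Mod (Reg rpos) (Const 32)) (Const 1)) ?s \<longleftrightarrow> p mod 32 < 1"
      using md by simp
    show "wp W A new_entry (\<lambda>s m. wp W A add_field Q s m) s m"
      unfolding new_entry_def
      apply (rule wp_Seq, rule wp_Assign, unfold r1, use lW in simp)
      apply (rule wp_Seq, rule wp_Assign, unfold r2, rule pW)
      apply (rule wp_Seq, rule wp_Assign, unfold r3, rule vW)
      apply (rule wp_Seq, rule wp_Assign, unfold r4, use lW in simp)
      apply (rule wp_If, unfold cnd)
       apply (rule wp_Store[OF r5 pA])
         apply (use lW in linarith)
        apply (use lW in simp)
       apply (use fin in \<open>simp add: m1_def\<close>)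
      apply (rule wp_Skip)
      apply (use fin in \<open>simp add: m1_def\<close>)
      done
  }
qed

end

section \<open>One pass over the input\<close>

definition accumulate_all :: com where
  "accumulate_all =
     While (Less (Reg ri) (Reg rn))
       (Load rw (Reg ri) ;; accumulate ;; Assign ri (Add (Reg ri) (Const 1)))"

text \<open>Counts the groups: keys are distinct multiples of \<open>r\<close>, and there are
  \<open>(N - 1) div r + 1\<close> of these below a positive \<open>N\<close>.\<close>

lemma length_distinct_multiples:
  assumes "distinct (map fst al)" "\<And>k c. (k, c) \<in> set al \<Longrightarrow> k < N \<and> r dvd k"
  shows "length (al :: entries) \<le> (N - 1) div r + 1"
proof -
  have "k \<in> (*) r ` {..(N - 1) div r}" if "k \<in> fst ` set al" for k
  proof -
    from that obtain c where "(k, c) \<in> set al" by auto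
    then have k: "k \<le> N - 1" "r dvd k" using assms(2) by fastforce+
    then have "k = r * (k div r)" "k div r \<le> (N - 1) div r" by (auto intro: div_le_mono)
    then show ?thesis by blast
  qed
  then have "card (fst ` set al) \<le> card ((*) r ` {..(N - 1) div r})" by (intro card_mono) auto
  also have "\<dots> \<le> (N - 1) div r + 1" using card_image_le[of "{..(N - 1) div r}" "(*) r"] by simp
  also have "card (fst ` set al) = length al" using distinct_card[OF assms(1)] by simp
  finally show ?thesis .
qed

locale input = params +
  fixes xs :: "fl list" and A :: nat
  assumes length_xs: "length xs = n" and is_fl_xs: "\<forall>x\<in>set xs. is_fl t l x"
    and A: "min n ((2 ^ l - 1) div r + 1) \<le> 32 * A"
begin

text \<open>\<open>length al \<le> i\<close> ensures that packing never overtakes reading, so only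
  cells already read are overwritten. The bound on \<open>asum\<close> grows by one coefficient per
  input and keeps it below \<open>H\<close>.\<close>

definition acc_inv :: "nat \<Rightarrow> entries \<Rightarrow> regs \<Rightarrow> memory \<Rightarrow> bool" where
  "acc_inv i al s m \<longleftrightarrow> entries_ok A al s m \<and> s ri = int i \<and> distinct (map fst al) \<and> (\<forall>(k, c)\<in>set al. r dvd k) \<and>
     length al \<le> i \<and> asum al \<le> int i * (2 * T * R) \<and> vsum al = (\<Sum>x\<leftarrow>take i xs. fl_int t x) \<and>
     (\<forall>j. i \<le> j \<and> j < n \<longrightarrow> m j = fl_word t l (xs ! j))"

lemma wp_accumulate:
  assumes acc_inv: "acc_inv i al s m" and i: "i < n" and w: "s rw = fl_word t l (xs ! i)"
  shows "wp W A (accumulate ;; Assign ri (Add (Reg ri) (Const 1))) (\<lambda>s' m'. \<exists>al'. acc_inv (Suc i) al' s' m') s m"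
proof -
  let ?x = "xs ! i"
  have x: "is_fl t l ?x" using is_fl_xs i length_xs by simp
  note ck = coeff_key[OF x]
  have ok: "entries_ok A al s m" using acc_inv by (simp add: acc_inv_def)
  have "int i * (2 * T * R) + 2 * T * R \<le> int n * (2 * T * R)"
  proof -
    have "(int i + 1) * (2 * T * R) \<le> int n * (2 * T * R)" using i T R by (intro mult_right_mono) auto
    then show ?thesis by (simp add: distrib_right)
  qed
  \<comment> \<open>The factor \<open>n + 1\<close> instead of \<open>n\<close> in \<open>H\<close>
    makes the bound strict, as the biased digits require.\<close>
  moreover have "int n * (2 * T * R) < H"
  proof -
    have "0 < T * R" using T R by simp
    then show ?thesis unfolding H_def by (simp add: algebra_simps)
  qed
  ultimately have asumH: "asum al + \<bar>coeff ?x\<bar> < H" "asum al + \<bar>coeff ?x\<bar> \<le> int (Suc i) * (2 * T * R)"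
    using acc_inv ck(2) unfolding acc_inv_def by (simp_all add: distrib_right)
  define Post where "Post s' m' \<longleftrightarrow> (\<exists>al'. acc_inv (Suc i) al' s' m')" for s' m'
  have acc_inv': "Post (s'(ri := int (Suc i))) m'"
    if al': "key ?x \<notin> fst ` set al \<and> al' = al @ [(key ?x, coeff ?x)] \<or>
        (\<exists>j<length al. fst (al ! j) = key ?x \<and> al' = al[j := (key ?x, snd (al ! j) + coeff ?x)])"
      and len: "length al' \<le> 32 * A"
      and s': "\<And>z. z \<in> {rn, rR, rT, rL, rr, rH, rZ} \<Longrightarrow> s' z = s z" "s' rlen = int (length al')"
      and m': "stored Z (digits H al') (length al') m'" "\<And>j. length al div 32 < j \<Longrightarrow> m' j = m j"
    for al' s' m'
  proof -
    have sub: "set al' \<subseteq> insert (key ?x, coeff ?x) (set al) \<or> (\<exists>c. set al' \<subseteq> insert (key ?x, c) (set al))"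
      using al' set_update_subset_insert by fastforce
    have "\<forall>(k, c)\<in>set al'. r dvd k \<and> int k < L"
      using sub acc_inv ck(3,4) unfolding acc_inv_def entries_ok_def by fastforce
    then have kd: "\<forall>(k, c)\<in>set al'. r dvd k" "\<forall>(k, c)\<in>set al'. int k < L" by auto
    have dist: "distinct (map fst al')"
    proof -
      have "map fst (al[j := (k, c)]) = map fst al" if "j < length al" "fst (al ! j) = k" for j k c
        using that by (metis fst_conv list_update_id map_update nth_map)
      then have "map fst al' = map fst al \<or> key ?x \<notin> fst ` set al \<and> al' = al @ [(key ?x, coeff ?x)]"
        using al' by blast
      then show ?thesis using acc_inv by (auto simp: acc_inv_def)
    qed
    have "length al' \<le> Suc i" using al' acc_inv by (auto simp: acc_inv_def)
    have as: "asum al' \<le> asum al + \<bar>coeff ?x\<bar>"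
      using al' asum_update[of _ al "key ?x" "coeff ?x"] by (auto simp: asum_append)
    have "vsum al' = vsum al + fl_int t ?x"
      using al' vsum_update[of _ al "key ?x" "coeff ?x"] ck(1) by (auto simp: vsum_append)
    also have "\<dots> = (\<Sum>x\<leftarrow>take (Suc i) xs. fl_int t x)"
      using acc_inv i length_xs by (simp add: acc_inv_def take_Suc_conv_app_nth)
    finally have vs: "vsum al' = (\<Sum>x\<leftarrow>take (Suc i) xs. fl_int t x)" .
    have mem: "\<forall>j. Suc i \<le> j \<and> j < n \<longrightarrow> m' j = fl_word t l (xs ! j)"
    proof (intro allI impI)
      fix j assume j: "Suc i \<le> j \<and> j < n"
      have "length al \<le> i" using acc_inv by (simp add: acc_inv_def)
      then have "length al div 32 < j" using j by linarith
      then have "m' j = m j" by (rule m'(2))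
      then show "m' j = fl_word t l (xs ! j)" using acc_inv j by (simp add: acc_inv_def)
    qed
    have cr: "const_regs (s'(ri := int (Suc i)))"
      using ok s'(1) by (simp add: entries_ok_def const_regs_def)
    have "acc_inv (Suc i) al' (s'(ri := int (Suc i))) m'"
      unfolding acc_inv_def entries_ok_def
      using kd dist \<open>length al' \<le> Suc i\<close> as asumH vs mem cr s'(2) m'(1) len i by auto
    then show ?thesis unfolding Post_def by blast
  qed
  have lenA: "length al < 32 * A" "length al < n" if "key ?x \<notin> fst ` set al"
  proof -
    have "distinct (map fst (al @ [(key ?x, coeff ?x)]))" using that acc_inv by (auto simp: acc_inv_def)
    moreover have "k < 2 ^ l \<and> r dvd k" if "(k, c) \<in> set (al @ [(key ?x, coeff ?x)])" for k c
    proof -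
      have "int k < L \<and> r dvd k" using that acc_inv ck(3,4) by (auto simp: acc_inv_def entries_ok_def)
      then show ?thesis by (simp add: L_def)
    qed
    ultimately have "length (al @ [(key ?x, coeff ?x)]) \<le> (2 ^ l - 1) div r + 1"
      by (rule length_distinct_multiples)
    moreover show "length al < n" using acc_inv i by (simp add: acc_inv_def)
    ultimately show "length al < 32 * A" using A by simp
  qed
  have fin: "wp W A (Assign ri (Add (Reg ri) (Const 1))) Post s' m'" if "Post (s'(ri := int (Suc i))) m'" "s' ri = int i" for s' m'
  proof (rule wp_Assign)
    have a: "aval (Add (Reg ri) (Const 1)) s' = int (Suc i)" using that by simp
    show "\<bar>aval (Add (Reg ri) (Const 1)) s'\<bar> < W" unfolding a using i bounds by linarith
    show "Post (s'(ri := aval (Add (Reg ri) (Const 1)) s')) m'" unfolding a by (rule that)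
  qed
  have "wp W A accumulate (\<lambda>s m. wp W A (Assign ri (Add (Reg ri) (Const 1))) Post s m) s m"
    unfolding accumulate_def
  proof (rule wp_Seq, rule wp_decode[where x = ?x])
    show "is_fl t l ?x" "s rw = fl_word t l ?x" by (fact x, fact w)
    show "const_regs s" using ok by (simp add: entries_ok_def)
    fix s1 assume s1: "s1 rc = coeff ?x" "s1 rk = int (key ?x)" "\<And>z. z \<notin> {rc, re, rk, rs, rj} \<Longrightarrow> s1 z = s z"
    have ok1: "entries_ok A al s1 m" by (rule entries_ok_cong[OF ok]) (use s1(3) in auto)
    show "wp W A (search ;; If (Less (Reg rpos) (Const 0)) new_entry Skip ;; add_field)
        (\<lambda>s m. wp W A (Assign ri (Add (Reg ri) (Const 1))) Post s m) s1 m"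
    proof (rule wp_Seq, rule wp_search[OF ok1 s1(2)])
      fix s2 assume s2: "\<And>z. z \<notin> {rpos, rppw, ridx, rpw, rcell, rent} \<Longrightarrow> s2 z = s1 z"
        "s2 rpw = Z ^ (length al mod 32)"
        and pos: "s2 rpos = - 1 \<and> key ?x \<notin> fst ` set al \<or>
          (\<exists>i<length al. s2 rpos = int i \<and> s2 rppw = Z ^ (i mod 32) \<and> fst (al ! i) = key ?x)"
      have ok2: "entries_ok A al s2 m" by (rule entries_ok_cong[OF ok1]) (use s2(1) in auto)
      have c2: "s2 rc = coeff ?x" "s2 rk = int (key ?x)" using s1 s2(1) by simp_all
      define al' where "al' = (if key ?x \<notin> fst ` set al then al @ [(key ?x, coeff ?x)]
        else al[nat (s2 rpos) := (key ?x, snd (al ! nat (s2 rpos)) + coeff ?x)])"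
      have new: "key ?x \<notin> fst ` set al \<longleftrightarrow> s2 rpos = - 1"
      proof -
        have "key ?x \<in> fst ` set al" if "j < length al" "fst (al ! j) = key ?x" for j
          using that by (metis imageI nth_mem)
        then show ?thesis using pos by auto
      qed
      have al': "key ?x \<notin> fst ` set al \<and> al' = al @ [(key ?x, coeff ?x)] \<or>
        (\<exists>j<length al. fst (al ! j) = key ?x \<and> al' = al[j := (key ?x, snd (al ! j) + coeff ?x)])"
        using pos new unfolding al'_def by auto
      show "wp W A (If (Less (Reg rpos) (Const 0)) new_entry Skip ;; add_field)
        (\<lambda>s m. wp W A (Assign ri (Add (Reg ri) (Const 1))) Post s m) s2 m"
      proof (rule wp_add_entry[OF ok2 c2(2) ck(3), where al' = al'])
        show "asum al + \<bar>s2 rc\<bar> < H" using asumH c2 by simp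
        show "s2 rpw = Z ^ (length al mod 32)" by (rule s2(2))
        show "s2 rpos = - 1 \<and> length al < 32 * A \<and> length al < n \<and> al' = al @ [(key ?x, s2 rc)] \<or>
          (\<exists>i<length al. s2 rpos = int i \<and> s2 rppw = Z ^ (i mod 32) \<and> fst (al ! i) = key ?x \<and>
             al' = al[i := (key ?x, snd (al ! i) + s2 rc)])"
          using pos new lenA unfolding al'_def c2 by auto
      next
        fix s3 m3 assume s3: "\<And>z. z \<notin> {rpos, rppw, rc, rlen, rcell} \<Longrightarrow> s3 z = s2 z" "s3 rlen = int (length al')"
          and m3: "stored Z (digits H al') (length al') m3" "\<And>j. length al div 32 < j \<Longrightarrow> m3 j = m j"
        show "wp W A (Assign ri (Add (Reg ri) (Const 1))) Post s3 m3"
        proof (rule fin, rule acc_inv'[OF al'])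
          show "length al' \<le> 32 * A" using al' lenA ok by (auto simp: entries_ok_def)
          show "s3 z = s z" if "z \<in> {rn, rR, rT, rL, rr, rH, rZ}" for z
            using that s3(1) s2(1) s1(3) by auto
          show "s3 ri = int i" using s3(1) s2(1) s1(3) acc_inv by (simp add: acc_inv_def)
        qed (use s3(2) m3 in auto)
      qed
    qed
  qed
  then show ?thesis unfolding Post_def by (rule wp_Seq)
qed

text \<open>Each round reads the input cell \<open>i\<close> once and otherwise stays below
  \<open>A\<close>, so the traces of the rounds concatenate to a stream.\<close>

lemma run_accumulate_all:
  assumes "acc_inv i al s m" "i \<le> n"
  shows "\<exists>tr s' m' al'. run W accumulate_all (s, m) tr (s', m') \<and> streams A i n tr \<and> acc_inv n al' s' m'"
  using assms
proof (induction "n - i" arbitrary: i al s m)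
  case 0
  then have "i = n" by simp
  have "s ri = int n" "s rn = int n" using 0 \<open>i = n\<close> by (simp_all add: acc_inv_def entries_ok_def const_regs_def)
  then have "run W accumulate_all (s, m) [] (s, m)"
    unfolding accumulate_all_def by (intro run.WhileFalse) simp
  moreover have "streams A i n []" by (simp add: streams_def)
  ultimately show ?case using 0 \<open>i = n\<close> by blast
next
  case (Suc d)
  then have i: "i < n" by simp
  have regs: "s ri = int i" "s rn = int n" using Suc.prems by (simp_all add: acc_inv_def entries_ok_def const_regs_def)
  have mi: "m i = fl_word t l (xs ! i)" using Suc.prems i by (simp add: acc_inv_def)
  have x: "is_fl t l (xs ! i)" using is_fl_xs i length_xs by simp
  have "L * T = T * L" by simp
  then have mW: "\<bar>m i\<bar> < W" unfolding mi
    using fl_word_bounds[OF x, folded T_def L_def] bounds L T by (simp add: mult.commute)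
  have iW: "int i < W" using i bounds by linarith
  have load: "run W (Load rw (Reg ri)) (s, m) [Rd i] (s(rw := m i), m)"
    using run.Load[of "Reg ri" s W m rw] regs mW iW by simp
  have "acc_inv i al (s(rw := m i)) m" using Suc.prems unfolding acc_inv_def
    by (auto intro: entries_ok_cong)
  from wp_accumulate[OF this i] mi obtain tr1 s1 m1 al1 where
    1: "run W (accumulate ;; Assign ri (Add (Reg ri) (Const 1))) (s(rw := m i), m) tr1 (s1, m1)"
    "\<forall>a\<in>set tr1. addr a < A" "acc_inv (Suc i) al1 s1 m1" unfolding wp_def by auto
  have "d = n - Suc i" using Suc.hyps(2) by simp
  from Suc.hyps(1)[OF this 1(3)] i obtain tr2 s2 m2 al2 where
    2: "run W accumulate_all (s1, m1) tr2 (s2, m2)" "streams A (Suc i) n tr2" "acc_inv n al2 s2 m2" by auto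
  have "run W accumulate_all (s, m) (([Rd i] @ tr1) @ tr2) (s2, m2)"
    unfolding accumulate_all_def
  proof (rule run.WhileTrue)
    show "bval (Less (Reg ri) (Reg rn)) (fst (s, m))" using regs i by simp
    show "run W (Load rw (Reg ri) ;; accumulate ;; Assign ri (Add (Reg ri) (Const 1))) (s, m) ([Rd i] @ tr1) (s1, m1)"
      by (rule run.Seq[OF load 1(1)])
    show "run W (While (Less (Reg ri) (Reg rn)) (Load rw (Reg ri) ;; accumulate ;; Assign ri (Add (Reg ri) (Const 1))))
        (s1, m1) tr2 (s2, m2)" using 2(1) unfolding accumulate_all_def .
  qed
  moreover have "streams A i (Suc i) ([Rd i] @ tr1)"
    using streams_append[OF streams_single[of A "Rd i", unfolded addr.simps] streams_below] 1(2) by simp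
  then have "streams A i n (([Rd i] @ tr1) @ tr2)" by (rule streams_append[OF _ 2(2)]) (use i in auto)
  ultimately show ?case using 2(3) by blast
qed

end

section \<open>Constants, rounding and encoding\<close>

definition setup_regs :: com where
  "setup_regs =
     Assign rT (Const 1) ;; times_pow2 rT rt ;;
     Assign rL (Const 1) ;; times_pow2 rL rl ;;
     Assign rx (Const 1) ;;
     While (Less (Reg rx) (Reg rR))
       (Assign rx (Mul (Reg rx) (Const 2)) ;; Assign rr (Add (Reg rr) (Const 1))) ;;
     Assign rH (Mul (Mul (Mul (Const 2) (Reg rT)) (Reg rR)) (Add (Reg rn) (Const 1))) ;;
     Assign rZ (Mul (Reg rL) (Mul (Const 2) (Reg rH)))"

text \<open>The lower end is included because quotients are floors. A quotient of
  \<open>- (2 * T)\<close> does not yet force \<open>S\<close> to be at or below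
  \<open>- (2 * T)\<close> units, so a finer candidate might be closer; only a smaller quotient
  rules that out. The value \<open>- (2 * T)\<close> itself is removed by
  \<open>carry_out\<close>.\<close>

definition in_range :: "nat \<Rightarrow> bexp" where
  "in_range x = Conj (Neg (Less (Reg x) (Sub (Const 0) (Mul (Const 2) (Reg rT))))) (Less (Reg x) (Mul (Const 2) (Reg rT)))"

text \<open>From \<open>rF = S div 2 ^ E\<close> the next quotient is \<open>2 * rF + b\<close>, where the bit \<open>b\<close> of the sum \<open>S\<close> is the
  parity of the prefix sum at \<open>E - 1\<close>. The loop stops at the smallest \<open>E\<close> whose quotient fits into a
  significand; \<open>rQ\<close> then holds the first quotient that does not.\<close>

definition descend :: com where
  "descend =
     While (Conj (Less (Const 0) (Reg rE)) (Less (Const 0) (Reg rflag)))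
       (Assign re (Sub (Reg rE) (Const 1)) ;;
        prefix_sum ;;
        Assign rQ (Add (Mul (Const 2) (Reg rF)) (Mod (Reg rv) (Const 2))) ;;
        If (in_range rQ) (Assign rE (Reg re) ;; Assign rF (Reg rQ)) (Assign rflag (Const 0)))"

text \<open>The descent starts at the largest exponent \<open>L - 1\<close>. If the quotient there
  is already out of range, setting \<open>rE\<close> to \<open>L\<close> signals overflow to
  \<open>encode_result\<close>. If \<open>rflag\<close> survives the descent, exponent 0 was reached
  and the sum is exact; otherwise \<open>rQ\<close> is rounded.\<close>

definition round_sum :: com where
  "round_sum =
     Assign rE (Sub (Reg rL) (Const 1)) ;;
     Assign re (Reg rE) ;;
     prefix_sum ;;
     Assign rF (Reg rv) ;;
     If (in_range rF)
       (Assign rflag (Const 1) ;;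
        descend ;;
        If (Less (Const 0) (Reg rflag)) Skip (Assign rF (Div (Add (Reg rQ) (Const 1)) (Const 2))))
       (Assign rE (Reg rL))"

definition encode_result :: com where
  "encode_result =
     If (Conj (Neg (Eq (Reg rF) (Mul (Const 2) (Reg rT)))) (Neg (Eq (Sub (Const 0) (Reg rF)) (Mul (Const 2) (Reg rT)))))
       Skip
       (Assign rF (Div (Reg rF) (Const 2)) ;; Assign rE (Add (Reg rE) (Const 1))) ;;
     If (Less (Reg rE) (Reg rL))
       Skip
       (Assign rE (Sub (Reg rL) (Const 1)) ;;
        If (Less (Reg rF) (Const 0))
          (Assign rF (Sub (Const 1) (Mul (Const 2) (Reg rT))))
          (Assign rF (Sub (Mul (Const 2) (Reg rT)) (Const 1)))) ;;
     If (Less (Reg rF) (Const 0))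
       (Assign rs (Const 1) ;; Assign rF (Sub (Const 0) (Reg rF)))
       (Assign rs (Const 0)) ;;
     Assign rout (Add (Mul (Add (Mul (Add (Mul (Reg rs) (Const 2)) (Div (Reg rF) (Reg rT))) (Reg rL)) (Reg rE)) (Reg rT))
        (Mod (Reg rF) (Reg rT)))"

definition sum_program :: com where
  "sum_program = setup_regs ;; accumulate_all ;; (round_sum ;; encode_result) ;; Store (Reg rn) (Reg rout)"

context params
begin

lemma wp_setup_regs:
  assumes Q: "\<And>s. const_regs s \<Longrightarrow> s ri = 0 \<Longrightarrow> s rlen = 0 \<Longrightarrow> Q s m"
  shows "wp W A setup_regs Q (init_regs n t l (2 ^ r)) m"
proof -
  let ?s = "init_regs n t l (2 ^ r)"
  have s: "?s rn = int n" "?s rt = int t" "?s rl = int l" "?s rR = R" "?s ri = 0" "?s rlen = 0" "?s rr = 0"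
    by (simp_all add: init_regs_def R_def)
  have W1: "1 < W" using bounds by linarith
  have tl: "int t < W" "int l < W" "T < W" "L < W" using lengths bounds L T by linarith+
  define I where "I s' m' \<longleftrightarrow> m' = m \<and> s' rn = int n \<and> s' rR = R \<and> s' rT = T \<and> s' rL = L \<and> s' ri = 0 \<and> s' rlen = 0 \<and>
    (\<exists>i\<le>r. s' rx = 2 ^ i \<and> s' rr = int i)" for s' m'
  show ?thesis
    unfolding setup_regs_def
  proof (rule wp_Seq, rule wp_Assign, use W1 in simp, rule wp_Seq, rule wp_times_pow2[where e = t])
    fix s1 assume 1: "s1 rT = (?s(rT := aval (Const 1) ?s)) rT * 2 ^ t"
      "\<And>z. z \<noteq> rT \<Longrightarrow> z \<noteq> rj \<Longrightarrow> s1 z = (?s(rT := aval (Const 1) ?s)) z"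
    then have s1: "s1 rn = int n" "s1 rl = int l" "s1 rR = R" "s1 ri = 0" "s1 rlen = 0" "s1 rr = 0" "s1 rT = T"
      using s by (simp_all add: T_def)
    show "wp W A (Assign rL (Const 1) ;; times_pow2 rL rl ;; Assign rx (Const 1) ;;
       While (Less (Reg rx) (Reg rR))
       (Assign rx (Mul (Reg rx) (Const 2)) ;; Assign rr (Add (Reg rr) (Const 1))) ;;
       Assign rH (Mul (Mul (Mul (Const 2) (Reg rT)) (Reg rR)) (Add (Reg rn) (Const 1))) ;;
       Assign rZ (Mul (Reg rL) (Mul (Const 2) (Reg rH)))) Q s1 m"
    proof (rule wp_Seq, rule wp_Assign, use W1 in simp, rule wp_Seq, rule wp_times_pow2[where e = l])
      fix s2 assume 2: "s2 rL = (s1(rL := aval (Const 1) s1)) rL * 2 ^ l"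
        "\<And>z. z \<noteq> rL \<Longrightarrow> z \<noteq> rj \<Longrightarrow> s2 z = (s1(rL := aval (Const 1) s1)) z"
      then have s2: "s2 rn = int n" "s2 rR = R" "s2 ri = 0" "s2 rlen = 0" "s2 rr = 0" "s2 rT = T" "s2 rL = L"
        using s1 by (simp_all add: L_def)
      show "wp W A (Assign rx (Const 1) ;;
         While (Less (Reg rx) (Reg rR))
         (Assign rx (Mul (Reg rx) (Const 2)) ;; Assign rr (Add (Reg rr) (Const 1))) ;;
         Assign rH (Mul (Mul (Mul (Const 2) (Reg rT)) (Reg rR)) (Add (Reg rn) (Const 1))) ;;
         Assign rZ (Mul (Reg rL) (Mul (Const 2) (Reg rH)))) Q s2 m"
      proof (rule wp_Seq, rule wp_Assign, use W1 in simp, rule wp_Seq,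
          rule wp_While[where I = I and \<mu> = "\<lambda>s'. r - nat (s' rr)"])
        show "I (s2(rx := aval (Const 1) s2)) m" using s2 by (auto simp: I_def intro!: exI[of _ 0])
      next
        fix s' m' assume I: "I s' m'" and b: "bval (Less (Reg rx) (Reg rR)) s'"
        then obtain i where i: "i \<le> r" "s' rx = 2 ^ i" "s' rr = int i" by (auto simp: I_def)
        have "s' rR = R" using I by (simp add: I_def)
        then have "i < r" using i b by (cases "i = r") (auto simp: R_def)
        then have "(2::int) ^ Suc i \<le> R" unfolding R_def by (intro power_increasing) auto
        then have "2 * 2 ^ i < W" "int i + 1 < W" using \<open>i < r\<close> lengths(3) bounds by auto
        then show "wp W A (Assign rx (Mul (Reg rx) (Const 2)) ;; Assign rr (Add (Reg rr) (Const 1)))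
          (\<lambda>s'' m''. I s'' m'' \<and> r - nat (s'' rr) < r - nat (s' rr)) s' m'"
          using I i \<open>i < r\<close> by (intro wp_Seq wp_Assign) (auto simp: I_def intro!: exI[of _ "Suc i"])
      next
        fix s' m' assume I: "I s' m'" and b: "\<not> bval (Less (Reg rx) (Reg rR)) s'"
        then obtain i where i: "i \<le> r" "s' rx = 2 ^ i" "s' rr = int i" by (auto simp: I_def)
        have "(2::int) ^ r \<le> 2 ^ i" using I b i by (simp add: I_def R_def)
        then have "s' rr = int r" using i by simp
        have HW: "\<bar>H\<bar> < W" "\<bar>Z\<bar> < W" using bounds by linarith+
        have regs: "s' rn = int n" "s' rR = R" "s' rT = T" "s' rL = L" "s' ri = 0" "s' rlen = 0" "m' = m"
          using I by (simp_all add: I_def)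
        have a1: "aval (Mul (Mul (Mul (Const 2) (Reg rT)) (Reg rR)) (Add (Reg rn) (Const 1))) s' = H"
          using regs by (simp add: H_def)
        have a2: "aval (Mul (Reg rL) (Mul (Const 2) (Reg rH))) (s'(rH := H)) = Z"
          using regs by (simp add: Z_def)
        show "wp W A (Assign rH (Mul (Mul (Mul (Const 2) (Reg rT)) (Reg rR)) (Add (Reg rn) (Const 1))) ;;
           Assign rZ (Mul (Reg rL) (Mul (Const 2) (Reg rH)))) Q s' m'"
          unfolding \<open>m' = m\<close>
        proof (rule wp_Seq, rule wp_Assign, unfold a1, rule HW, rule wp_Assign, unfold a2, rule HW, rule Q)
          show "const_regs (s'(rH := H, rZ := Z))"
            unfolding const_regs_def using regs \<open>s' rr = int r\<close> by simp
        qed (use regs in simp_all)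
      qed
    qed (use s1 tl in \<open>auto simp: L_def\<close>)
  qed (use s tl in \<open>auto simp: T_def\<close>)
qed

lemma bval_in_range: "s rT = T \<Longrightarrow> bval (in_range x) s \<longleftrightarrow> - (2 * T) \<le> s x \<and> s x < 2 * T"
  by (auto simp: in_range_def)

lemma wp_descend:
  assumes ok: "entries_ok A al s m" and E: "s rE = int d" "int d < L" "s rflag = 1" "s rF = vsum al div 2 ^ d"
    and rng: "- (2 * T) \<le> vsum al div 2 ^ d" "vsum al div 2 ^ d < 2 * T"
    and Q: "\<And>s' E. entries_ok A al s' m \<Longrightarrow> s' rE = int E \<Longrightarrow> int E < L \<Longrightarrow>
        - (2 * T) \<le> vsum al div 2 ^ E \<Longrightarrow> vsum al div 2 ^ E < 2 * T \<Longrightarrow>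
        s' rflag = 1 \<and> E = 0 \<and> s' rF = vsum al \<or>
        s' rflag = 0 \<and> 0 < E \<and> s' rQ = vsum al div 2 ^ (E - 1) \<and>
          (2 * T \<le> vsum al div 2 ^ (E - 1) \<or> vsum al div 2 ^ (E - 1) < - (2 * T)) \<Longrightarrow> Q s' m"
  shows "wp W A descend Q s m"
proof -
  let ?V = "\<lambda>e. vsum al div 2 ^ e"
  define I where "I s' m' \<longleftrightarrow> m' = m \<and> entries_ok A al s' m \<and> (\<exists>E. s' rE = int E \<and> int E < L \<and>
      - (2 * T) \<le> ?V E \<and> ?V E < 2 * T \<and> s' rF = ?V E \<and>
      (s' rflag = 1 \<or> s' rflag = 0 \<and> 0 < E \<and> s' rQ = ?V (E - 1) \<and> (2 * T \<le> ?V (E - 1) \<or> ?V (E - 1) < - (2 * T))))" for s' m'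
  show ?thesis
    unfolding descend_def
  \<comment> \<open>Each round either lowers \<open>rE\<close> or clears the flag, so their sum
    decreases.\<close>
  proof (rule wp_While[where I = I and \<mu> = "\<lambda>s'. nat (s' rE) + nat (s' rflag)"])
    show "I s m" using ok E rng by (auto simp: I_def)
  next
    fix s' m' assume I: "I s' m'" and b: "bval (Conj (Less (Const 0) (Reg rE)) (Less (Const 0) (Reg rflag))) s'"
    then obtain e where e: "s' rE = int (Suc e)" "int (Suc e) < L" "- (2 * T) \<le> ?V (Suc e)" "?V (Suc e) < 2 * T"
        "s' rF = ?V (Suc e)" "s' rflag = 1" and ok': "entries_ok A al s' m" and m': "m' = m"
      unfolding I_def by (auto simp: gr0_conv_Suc)
    have V: "2 * ?V (Suc e) + ?V e mod 2 = ?V e"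
    proof -
      have "?V (Suc e) = ?V e div 2" unfolding power_Suc2 by (simp add: zdiv_zmult2_eq)
      then show ?thesis by simp
    qed
    have eW: "int (Suc e) < W" "L < W" using e bounds L by linarith+
    show "wp W A (Assign re (Sub (Reg rE) (Const 1)) ;;
        prefix_sum ;;
        Assign rQ (Add (Mul (Const 2) (Reg rF)) (Mod (Reg rv) (Const 2))) ;;
        If (in_range rQ) (Assign rE (Reg re) ;; Assign rF (Reg rQ)) (Assign rflag (Const 0)))
       (\<lambda>s'' m''. I s'' m'' \<and> nat (s'' rE) + nat (s'' rflag) < nat (s' rE) + nat (s' rflag)) s' m'"
      unfolding m'
    proof (rule wp_Seq, rule wp_Assign, use e eW in simp, rule wp_Seq, rule wp_prefix_sum[where e = e])
      show "entries_ok A al (s'(re := aval (Sub (Reg rE) (Const 1)) s')) m" by (rule entries_ok_cong[OF ok']) auto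
      show "(s'(re := aval (Sub (Reg rE) (Const 1)) s')) re = int e" "int e < L" using e by simp_all
      fix s2 assume 2: "\<And>z. z \<notin> {rx, rv, ridx, rpw, rcell, rent} \<Longrightarrow> s2 z = (s'(re := aval (Sub (Reg rE) (Const 1)) s')) z"
        "s2 rv = low al e div 2 ^ e"
      have ok2: "entries_ok A al s2 m" by (rule entries_ok_cong[OF ok']) (use 2(1) in auto)
      have s2: "s2 re = int e" "s2 rE = int (Suc e)" "s2 rF = ?V (Suc e)" "s2 rflag = 1" using 2(1) e by simp_all
      have a: "aval (Add (Mul (Const 2) (Reg rF)) (Mod (Reg rv) (Const 2))) s2 = ?V e"
        using s2 2(2) low_div_mod_2[of al e] V by simp
      have VW: "\<bar>?V e\<bar> < W"
      proof -
        have "0 \<le> ?V e mod 2" "?V e mod 2 < 2" by simp_all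
        then show ?thesis using V e(3,4) bounds T by linarith
      qed
      let ?s3 = "s2(rQ := ?V e)"
      have rT: "?s3 rT = T" using ok2 by (simp add: entries_ok_def const_regs_def)
      show "wp W A (Assign rQ (Add (Mul (Const 2) (Reg rF)) (Mod (Reg rv) (Const 2))) ;;
        If (in_range rQ) (Assign rE (Reg re) ;; Assign rF (Reg rQ)) (Assign rflag (Const 0)))
       (\<lambda>s'' m''. I s'' m'' \<and> nat (s'' rE) + nat (s'' rflag) < nat (s' rE) + nat (s' rflag)) s2 m"
      proof (rule wp_Seq, rule wp_Assign, unfold a, rule VW, rule wp_If)
        assume "bval (in_range rQ) ?s3"
        then have rng': "- (2 * T) \<le> ?V e" "?V e < 2 * T" using bval_in_range[of ?s3 rQ, OF rT] by simp_all
        have "entries_ok A al (?s3(rE := int e, rF := ?V e)) m" by (rule entries_ok_cong[OF ok2]) auto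
        then have "I (?s3(rE := int e, rF := ?V e)) m" using rng' s2 e(2) unfolding I_def by auto
        then show "wp W A (Assign rE (Reg re) ;; Assign rF (Reg rQ))
          (\<lambda>s'' m''. I s'' m'' \<and> nat (s'' rE) + nat (s'' rflag) < nat (s' rE) + nat (s' rflag)) ?s3 m"
          using s2 e eW VW by (intro wp_Seq wp_Assign) auto
      next
        assume "\<not> bval (in_range rQ) ?s3"
        then have rng': "2 * T \<le> ?V e \<or> ?V e < - (2 * T)" using bval_in_range[of ?s3 rQ, OF rT] by auto
        have "entries_ok A al (?s3(rflag := 0)) m" by (rule entries_ok_cong[OF ok2]) auto
        then have "I (?s3(rflag := 0)) m" using rng' s2 e unfolding I_def
          by (auto intro!: exI[of _ "Suc e"])
        then show "wp W A (Assign rflag (Const 0))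
          (\<lambda>s'' m''. I s'' m'' \<and> nat (s'' rE) + nat (s'' rflag) < nat (s' rE) + nat (s' rflag)) ?s3 m"
          using s2 e eW by (intro wp_Assign) auto
      qed
    qed
  next
    fix s' m' assume I: "I s' m'" and b: "\<not> bval (Conj (Less (Const 0) (Reg rE)) (Less (Const 0) (Reg rflag))) s'"
    then obtain E where "s' rE = int E" "int E < L" "- (2 * T) \<le> ?V E" "?V E < 2 * T" "s' rF = ?V E"
      "s' rflag = 1 \<or> s' rflag = 0 \<and> 0 < E \<and> s' rQ = ?V (E - 1) \<and> (2 * T \<le> ?V (E - 1) \<or> ?V (E - 1) < - (2 * T))"
      and m': "m' = m" and ok': "entries_ok A al s' m" unfolding I_def by auto
    then show "Q s' m'" unfolding m' using b by (intro Q[where E = E]) auto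
  qed
qed

lemma wp_round_sum:
  assumes ok: "entries_ok A al s m"
    and Q: "\<And>s' X E. const_regs s' \<Longrightarrow> s' rF = X \<Longrightarrow> s' rE = int E \<Longrightarrow> \<bar>X\<bar> \<le> H \<Longrightarrow>
        int E = L \<and> X = vsum al div 2 ^ (2 ^ l - 1) \<and>
          (2 * T \<le> vsum al div 2 ^ (2 ^ l - 1) \<or> vsum al div 2 ^ (2 ^ l - 1) < - (2 * T)) \<or>
        int E < L \<and> X = round_half (vsum al) E \<and> - (2 * T) \<le> vsum al div 2 ^ E \<and> vsum al div 2 ^ E < 2 * T \<and>
          (0 < E \<longrightarrow> 2 * T \<le> vsum al div 2 ^ (E - 1) \<or> vsum al div 2 ^ (E - 1) < - (2 * T)) \<Longrightarrow> Q s' m"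
  shows "wp W A round_sum Q s m"
proof -
  let ?V = "\<lambda>e. vsum al div 2 ^ e"
  define e :: nat where "e = 2 ^ l - 1"
  have e: "int e = L - 1" unfolding e_def L_def by (simp add: of_nat_diff)
  have LW: "\<bar>L - 1\<bar> < W" "\<bar>L\<bar> < W" "1 < W" using L bounds by linarith+
  have rL: "s rL = L" using ok by (simp add: entries_ok_def const_regs_def)
  \<comment> \<open>No key exceeds \<open>L - 1\<close>, so the prefix quotient at
    \<open>L - 1\<close> is that of the complete sum. As it is below \<open>H\<close>, it fits into
    \<open>rF\<close> even when it is out of range.\<close>
  have "k \<le> e" if "(k, c) \<in> set al" for k c
    using ok that e by (fastforce simp: entries_ok_def)
  then have low: "low al e = vsum al" by (rule low_eq_vsum)
  have VH: "\<bar>?V e\<bar> < H" using abs_low_div_le[of al e] ok unfolding low by (simp add: entries_ok_def)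
  have HW: "H < W" "2 * T \<le> H" using bounds T by linarith+
  let ?s1 = "s(rE := L - 1)"
  let ?s2 = "?s1(re := L - 1)"
  have a1: "aval (Sub (Reg rL) (Const 1)) s = L - 1" using rL by simp
  have a2: "aval (Reg rE) ?s1 = L - 1" by simp
  show ?thesis
    unfolding round_sum_def
  proof (rule wp_Seq, rule wp_Assign, unfold a1, rule LW, rule wp_Seq, rule wp_Assign, unfold a2, rule LW,
      rule wp_Seq, rule wp_prefix_sum[where e = e])
    show "entries_ok A al ?s2 m" by (rule entries_ok_cong[OF ok]) auto
    show "?s2 re = int e" "int e < L" using e by simp_all
    fix s3 assume 3: "\<And>z. z \<notin> {rx, rv, ridx, rpw, rcell, rent} \<Longrightarrow> s3 z = ?s2 z" "s3 rv = low al e div 2 ^ e"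
    have ok3: "entries_ok A al s3 m" by (rule entries_ok_cong[OF ok]) (use 3(1) in auto)
    have E3: "s3 rE = int e" "s3 rL = L" using 3(1) e rL by simp_all
    have a3: "aval (Reg rv) s3 = ?V e" using 3(2) low by simp
    let ?s4 = "s3(rF := ?V e)"
    have ok4: "entries_ok A al ?s4 m" by (rule entries_ok_cong[OF ok3]) auto
    have rT: "?s4 rT = T" using ok4 by (simp add: entries_ok_def const_regs_def)
    show "wp W A (Assign rF (Reg rv) ;;
     If (in_range rF)
       (Assign rflag (Const 1) ;;
        descend ;;
        If (Less (Const 0) (Reg rflag)) Skip (Assign rF (Div (Add (Reg rQ) (Const 1)) (Const 2))))
       (Assign rE (Reg rL))) Q s3 m"
    proof (rule wp_Seq, rule wp_Assign, unfold a3, use VH HW in simp, rule wp_If)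
      assume "\<not> bval (in_range rF) ?s4"
      then have "2 * T \<le> ?V e \<or> ?V e < - (2 * T)" using bval_in_range[of ?s4 rF, OF rT] by auto
      moreover have "const_regs (?s4(rE := L))" using ok4 by (simp add: entries_ok_def const_regs_def)
      ultimately have "Q (?s4(rE := L)) m"
        using VH by (intro Q[where X = "?V e" and E = "2 ^ l"]) (auto simp: e_def L_def)
      then show "wp W A (Assign rE (Reg rL)) Q ?s4 m" using E3 LW by (intro wp_Assign) auto
    next
      assume "bval (in_range rF) ?s4"
      then have rng: "- (2 * T) \<le> ?V e" "?V e < 2 * T" using bval_in_range[of ?s4 rF, OF rT] by simp_all
      let ?s5 = "?s4(rflag := 1)"
      have "wp W A descend (\<lambda>s m. wp W A (If (Less (Const 0) (Reg rflag)) Skip (Assign rF (Div (Add (Reg rQ) (Const 1)) (Const 2)))) Q s m) ?s5 m"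
      proof (rule wp_descend[where d = e, OF _ _ _ _ _ rng])
        show "entries_ok A al ?s5 m" by (rule entries_ok_cong[OF ok4]) auto
        show "?s5 rE = int e" "int e < L" "?s5 rflag = 1" "?s5 rF = ?V e" using E3 e by simp_all
        fix s6 E assume ok6: "entries_ok A al s6 m" and E: "s6 rE = int E" "int E < L"
          and r6: "- (2 * T) \<le> ?V E" "?V E < 2 * T"
          and fl: "s6 rflag = 1 \<and> E = 0 \<and> s6 rF = vsum al \<or>
            s6 rflag = 0 \<and> 0 < E \<and> s6 rQ = ?V (E - 1) \<and> (2 * T \<le> ?V (E - 1) \<or> ?V (E - 1) < - (2 * T))"
        let ?X = "round_half (vsum al) E"
        have XH: "\<bar>?X\<bar> \<le> H" using round_half_range[OF r6] HW by linarith
        have cr: "const_regs s6" "const_regs (s6(rF := ?X))" using ok6 by (simp_all add: entries_ok_def const_regs_def)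
        have c: "0 < E \<longrightarrow> 2 * T \<le> ?V (E - 1) \<or> ?V (E - 1) < - (2 * T)" using fl by auto
        show "wp W A (If (Less (Const 0) (Reg rflag)) Skip (Assign rF (Div (Add (Reg rQ) (Const 1)) (Const 2)))) Q s6 m"
        proof (rule wp_If)
          assume "bval (Less (Const 0) (Reg rflag)) s6"
          then have "E = 0" "s6 rF = ?X" using fl by (auto simp: round_half_def)
          then show "wp W A Skip Q s6 m"
            using cr E r6 c XH by (intro wp_Skip Q[where X = ?X and E = E]) auto
        next
          assume "\<not> bval (Less (Const 0) (Reg rflag)) s6"
          then have "aval (Div (Add (Reg rQ) (Const 1)) (Const 2)) s6 = ?X" using fl by (auto simp: round_half_def)
          moreover have "Q (s6(rF := ?X)) m"
            using cr E r6 c XH by (intro Q[where X = ?X and E = E]) auto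
          ultimately show "wp W A (Assign rF (Div (Add (Reg rQ) (Const 1)) (Const 2))) Q s6 m"
            using XH HW by (intro wp_Assign) auto
        qed
      qed
      then show "wp W A (Assign rflag (Const 1) ;;
        descend ;;
        If (Less (Const 0) (Reg rflag)) Skip (Assign rF (Div (Add (Reg rQ) (Const 1)) (Const 2)))) Q ?s4 m"
        using LW by (intro wp_Seq wp_Assign) auto
    qed
  qed
qed

lemma wp_encode_result:
  assumes s: "const_regs s" "s rF = X" "s rE = int E" and b: "\<bar>X\<bar> \<le> H" "int E \<le> L"
    and XE: "saturate T (2 ^ l) (carry_out T (X, E)) = (X', E')"
    and out: "\<bar>encode T L X' (int E')\<bar> < W" "\<bar>X'\<bar> < 2 * T"
    and Q: "\<And>s'. const_regs s' \<Longrightarrow> s' rout = encode T L X' (int E') \<Longrightarrow> Q s' m"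
  shows "wp W A encode_result Q s m"
proof -
  have bW: "\<bar>X\<bar> < W" "int E + 1 < W" "H < W" "2 * T < W" "1 < W" "L < W" using b bounds L T by linarith+
  have cr: "const_regs (s'(x := v))" if "const_regs s'" "x \<in> {rE, rF, rs, rout}" for s' x v
    using that by (auto simp: const_regs_def)
  obtain X1 E1 where 1: "carry_out T (X, E) = (X1, E1)" by fastforce
  have E1: "E1 \<le> E + 1" using 1 by (auto simp: carry_out_def split: if_splits)
  have X1: "\<bar>X1\<bar> \<le> H"
  proof -
    have "\<bar>X div 2\<bar> \<le> H" using b(1) bounds by linarith
    then show ?thesis using 1 b(1) by (auto simp: carry_out_def split: if_splits)
  qed
  have 2: "X' = (if int E1 < L then X1 else if X1 < 0 then 1 - 2 * T else 2 * T - 1)"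
    "int E' = (if int E1 < L then int E1 else L - 1)"
    using XE unfolding 1 by (auto simp: saturate_def L_def of_nat_diff split: if_splits)
  have last: "wp W A (If (Less (Reg rF) (Const 0))
       (Assign rs (Const 1) ;; Assign rF (Sub (Const 0) (Reg rF)))
       (Assign rs (Const 0)) ;;
     Assign rout (Add (Mul (Add (Mul (Add (Mul (Reg rs) (Const 2)) (Div (Reg rF) (Reg rT))) (Reg rL)) (Reg rE)) (Reg rT))
        (Mod (Reg rF) (Reg rT)))) Q s3 m"
    if 3: "const_regs s3" "s3 rF = X'" "s3 rE = int E'" for s3
  proof -
    let ?e = "Add (Mul (Add (Mul (Add (Mul (Reg rs) (Const 2)) (Div (Reg rF) (Reg rT))) (Reg rL)) (Reg rE)) (Reg rT))
        (Mod (Reg rF) (Reg rT))"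
    have fin: "wp W A (Assign rout ?e) Q s4 m"
      if 4: "const_regs s4" "s4 rF = \<bar>X'\<bar>" "s4 rE = int E'" "s4 rs = (if X' < 0 then 1 else 0)" for s4
    proof (rule wp_Assign)
      have a: "aval ?e s4 = encode T L X' (int E')"
        using 4 by (simp add: encode_def const_regs_def)
      show "\<bar>aval ?e s4\<bar> < W" unfolding a by (rule out)
      show "Q (s4(rout := aval ?e s4)) m" unfolding a by (rule Q) (use 4 cr in auto)
    qed
    show ?thesis
    proof (rule wp_Seq, rule wp_If)
      assume "bval (Less (Reg rF) (Const 0)) s3"
      then show "wp W A (Assign rs (Const 1) ;; Assign rF (Sub (Const 0) (Reg rF))) (\<lambda>s m. wp W A (Assign rout ?e) Q s m) s3 m"
        using 3 out(2) bW by (intro wp_Seq wp_Assign fin) (auto intro: cr)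
    next
      assume "\<not> bval (Less (Reg rF) (Const 0)) s3"
      then show "wp W A (Assign rs (Const 0)) (\<lambda>s m. wp W A (Assign rout ?e) Q s m) s3 m"
        using 3 bW by (intro wp_Assign fin) (auto intro: cr)
    qed
  qed
  let ?last = "If (Less (Reg rF) (Const 0))
       (Assign rs (Const 1) ;; Assign rF (Sub (Const 0) (Reg rF)))
       (Assign rs (Const 0)) ;;
     Assign rout (Add (Mul (Add (Mul (Add (Mul (Reg rs) (Const 2)) (Div (Reg rF) (Reg rT))) (Reg rL)) (Reg rE)) (Reg rT))
        (Mod (Reg rF) (Reg rT)))"
  let ?mid = "If (Less (Reg rE) (Reg rL))
       Skip
       (Assign rE (Sub (Reg rL) (Const 1)) ;;
        If (Less (Reg rF) (Const 0))
          (Assign rF (Sub (Const 1) (Mul (Const 2) (Reg rT))))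
          (Assign rF (Sub (Mul (Const 2) (Reg rT)) (Const 1)))) ;; ?last"
  have mid: "wp W A ?mid Q s2 m" if 3: "const_regs s2" "s2 rF = X1" "s2 rE = int E1" for s2
  proof (rule wp_Seq, rule wp_If)
    have regs: "s2 rL = L" "s2 rT = T" using 3(1) by (simp_all add: const_regs_def)
    {
      assume "bval (Less (Reg rE) (Reg rL)) s2"
      then show "wp W A Skip (\<lambda>s m. wp W A ?last Q s m) s2 m"
        using 3 2 regs by (intro wp_Skip last) auto
    }
    {
      assume "\<not> bval (Less (Reg rE) (Reg rL)) s2"
      then have X': "X' = (if X1 < 0 then 1 - 2 * T else 2 * T - 1)" "int E' = L - 1" using 2 3 regs by auto
      have LW: "\<bar>L - 1\<bar> < W" "\<bar>1 - 2 * T\<bar> < W" "\<bar>2 * T - 1\<bar> < W" using bW L T by linarith+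
      let ?s = "s2(rE := L - 1)"
      have a: "aval (Sub (Reg rL) (Const 1)) s2 = L - 1" using regs by simp
      have b1: "aval (Sub (Const 1) (Mul (Const 2) (Reg rT))) ?s = 1 - 2 * T"
        and b2: "aval (Sub (Mul (Const 2) (Reg rT)) (Const 1)) ?s = 2 * T - 1" using regs by simp_all
      show "wp W A (Assign rE (Sub (Reg rL) (Const 1)) ;;
        If (Less (Reg rF) (Const 0))
          (Assign rF (Sub (Const 1) (Mul (Const 2) (Reg rT))))
          (Assign rF (Sub (Mul (Const 2) (Reg rT)) (Const 1)))) (\<lambda>s m. wp W A ?last Q s m) s2 m"
      proof (rule wp_Seq, rule wp_Assign, unfold a, rule LW, rule wp_If)
        assume "bval (Less (Reg rF) (Const 0)) ?s"
        then have "X' = 1 - 2 * T" using X' 3 by simp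
        then show "wp W A (Assign rF (Sub (Const 1) (Mul (Const 2) (Reg rT)))) (\<lambda>s m. wp W A ?last Q s m) ?s m"
          by (intro wp_Assign, unfold b1, intro LW, intro last) (use cr 3(1) X' in auto)
      next
        assume "\<not> bval (Less (Reg rF) (Const 0)) ?s"
        then have "X' = 2 * T - 1" using X' 3 by simp
        then show "wp W A (Assign rF (Sub (Mul (Const 2) (Reg rT)) (Const 1))) (\<lambda>s m. wp W A ?last Q s m) ?s m"
          by (intro wp_Assign, unfold b2, intro LW, intro last) (use cr 3(1) X' in auto)
      qed
    }
  qed
  show ?thesis
    unfolding encode_result_def
  proof (rule wp_Seq, rule wp_If)
    have regs: "s rL = L" "s rT = T" using s(1) by (simp_all add: const_regs_def)
    let ?b = "Conj (Neg (Eq (Reg rF) (Mul (Const 2) (Reg rT)))) (Neg (Eq (Sub (Const 0) (Reg rF)) (Mul (Const 2) (Reg rT))))"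
    have bv: "bval ?b s \<longleftrightarrow> \<bar>X\<bar> \<noteq> 2 * T" using s(2) regs T by auto
    {
      assume "bval ?b s"
      then have "X1 = X" "E1 = E" using 1 bv by (auto simp: carry_out_def)
      then show "wp W A Skip (\<lambda>s m. wp W A ?mid Q s m) s m" using s by (intro wp_Skip mid) auto
    }
    {
      assume "\<not> bval ?b s"
      then have X1: "X1 = X div 2" "E1 = E + 1" using 1 bv by (auto simp: carry_out_def)
      have "\<bar>X div 2\<bar> < W" using bW by linarith
      then show "wp W A (Assign rF (Div (Reg rF) (Const 2)) ;; Assign rE (Add (Reg rE) (Const 1))) (\<lambda>s m. wp W A ?mid Q s m) s m"
        using s X1 bW by (intro wp_Seq wp_Assign mid) (auto intro: cr)
    }
  qed
qed

end

section \<open>The complete program and its memory requirement\<close>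

context input
begin

text \<open>Set-up and rounding stay below \<open>A\<close>, which is compatible with any stream
  bounds. So the trace is a single stream: the input from \<open>0\<close> to \<open>n\<close>, then
  the output cell \<open>n\<close> right behind it.\<close>

lemma run_sum_program:
  assumes m: "\<And>i. i < n \<Longrightarrow> m i = fl_word t l (xs ! i)"
  shows "\<exists>tr s' m' y. run W sum_program (init_regs n t l (2 ^ r), m) tr (s', m') \<and>
    correctly_rounded t l (fl_sum t l xs) y \<and> m' n = fl_word t l y \<and> streams A 0 (Suc n) tr"
proof -
  have "wp W A setup_regs (\<lambda>s' m'. acc_inv 0 [] s' m') (init_regs n t l (2 ^ r)) m"
  proof (rule wp_setup_regs)
    fix s assume "const_regs s" "s ri = 0" "s rlen = 0"
    then show "acc_inv 0 [] s m"
      using m bounds by (simp add: acc_inv_def entries_ok_def asum_def vsum_def stored_def)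
  qed
  then obtain tr1 s1 m1 where 1: "run W setup_regs (init_regs n t l (2 ^ r), m) tr1 (s1, m1)"
    "\<forall>a\<in>set tr1. addr a < A" "acc_inv 0 [] s1 m1" unfolding wp_def by blast
  from run_accumulate_all[OF 1(3)] obtain tr2 s2 m2 al where
    2: "run W accumulate_all (s1, m1) tr2 (s2, m2)" "streams A 0 n tr2" "acc_inv n al s2 m2" by auto
  have ok: "entries_ok A al s2 m2" using 2(3) by (simp add: acc_inv_def)
  have S: "vsum al = (\<Sum>x\<leftarrow>xs. fl_int t x)" using 2(3) length_xs by (simp add: acc_inv_def)
  define good where "good y \<longleftrightarrow> is_fl t l y \<and> correctly_rounded t l (fl_sum t l xs) y" for y
  have "wp W A (round_sum ;; encode_result) (\<lambda>s' m'. const_regs s' \<and> (\<exists>y. good y \<and> s' rout = fl_word t l y)) s2 m2"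
  proof (rule wp_Seq, rule wp_round_sum[OF ok])
    fix s3 X E
    assume 3: "const_regs s3" "s3 rF = X" "s3 rE = int E" "\<bar>X\<bar> \<le> H"
      and cases: "int E = L \<and> X = vsum al div 2 ^ (2 ^ l - 1) \<and>
          (2 * T \<le> vsum al div 2 ^ (2 ^ l - 1) \<or> vsum al div 2 ^ (2 ^ l - 1) < - (2 * T)) \<or>
        int E < L \<and> X = round_half (vsum al) E \<and> - (2 * T) \<le> vsum al div 2 ^ E \<and> vsum al div 2 ^ E < 2 * T \<and>
          (0 < E \<longrightarrow> 2 * T \<le> vsum al div 2 ^ (E - 1) \<or> vsum al div 2 ^ (E - 1) < - (2 * T))"
    obtain X' E' where XE: "saturate T (2 ^ l) (carry_out T (X, E)) = (X', E')" by fastforce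
    have T0: "0 < T" using T by linarith
    have best: "\<bar>X'\<bar> < 2 * T \<and> E' < 2 ^ l \<and> best_approx T (2 ^ l) (vsum al) (X' * 2 ^ E')"
      using cases
    proof (elim disjE)
      assume a: "int E = L \<and> X = vsum al div 2 ^ (2 ^ l - 1) \<and>
          (2 * T \<le> vsum al div 2 ^ (2 ^ l - 1) \<or> vsum al div 2 ^ (2 ^ l - 1) < - (2 * T))"
      then have "E = 2 ^ l" unfolding L_def by (metis of_nat_eq_iff of_nat_numeral of_nat_power)
      then show ?thesis using saturate_overflow_best[of T "vsum al" "2 ^ l" X' E'] a XE T0 by auto
    next
      assume a: "int E < L \<and> X = round_half (vsum al) E \<and> - (2 * T) \<le> vsum al div 2 ^ E \<and> vsum al div 2 ^ E < 2 * T \<and>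
          (0 < E \<longrightarrow> 2 * T \<le> vsum al div 2 ^ (E - 1) \<or> vsum al div 2 ^ (E - 1) < - (2 * T))"
      then have "E < 2 ^ l" by (simp add: L_def)
      then show ?thesis using saturate_round_best[of E T "vsum al" "2 ^ l" X' E'] a XE T0 by auto
    qed
    then obtain y where y: "is_fl t l y" "fl_int t y = X' * 2 ^ E'" "fl_word t l y = encode T L X' (int E')"
      using encode_fl_word[of X' t E' l] unfolding T_def L_def by metis
    have "good y" unfolding good_def using y best S T_def correctly_rounded_fl_int[OF y(1), of xs] by auto
    have yW: "\<bar>encode T L X' (int E')\<bar> < W"
      using fl_word_bounds[OF y(1), folded T_def L_def] bounds(9,10,8) unfolding y(3)[symmetric]
      by (simp add: mult.commute)
    show "wp W A encode_result (\<lambda>s' m'. const_regs s' \<and> (\<exists>y. good y \<and> s' rout = fl_word t l y)) s3 m2"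
    proof (rule wp_encode_result[OF 3 _ XE yW])
      show "int E \<le> L" using cases by auto
      show "\<bar>X'\<bar> < 2 * T" using best by simp
    qed (use \<open>good y\<close> y(3) in auto)
  qed
  then obtain tr3 s3 m3 y where 3: "run W (round_sum ;; encode_result) (s2, m2) tr3 (s3, m3)"
    "\<forall>a\<in>set tr3. addr a < A" "const_regs s3" "good y" "s3 rout = fl_word t l y" unfolding wp_def by blast
  have yW: "\<bar>fl_word t l y\<bar> < W"
    using fl_word_bounds[of t l y, folded T_def L_def] 3(4) bounds(9,10,8) unfolding good_def
    by (simp add: mult.commute)
  have "int n < W" using bounds by linarith
  then have 4: "run W (Store (Reg rn) (Reg rout)) (s3, m3) [Wr n] (s3, m3(n := fl_word t l y))"
    using run.Store[of "Reg rn" s3 W "Reg rout" m3] 3(3,5) yW by (simp add: const_regs_def)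
  have "run W sum_program (init_regs n t l (2 ^ r), m) (tr1 @ tr2 @ tr3 @ [Wr n]) (s3, m3(n := fl_word t l y))"
    unfolding sum_program_def by (intro run.Seq[OF 1(1)] run.Seq[OF 2(1)] run.Seq[OF 3(1)] 4)
  moreover have "streams A 0 (Suc n) (tr1 @ tr2 @ tr3 @ [Wr n])"
  proof (rule streams_append[where mid = 0])
    show "streams A 0 0 tr1" using 1(2) by (intro streams_below) auto
    show "streams A 0 (Suc n) (tr2 @ tr3 @ [Wr n])"
    proof (rule streams_append[OF 2(2)], rule streams_append[where mid = n])
      show "streams A n n tr3" using 3(2) by (intro streams_below) auto
      show "streams A n (Suc n) [Wr n]" using streams_single[of A "Wr n"] by simp
    qed simp_all
  qed simp_all
  ultimately show ?thesis using 3(4) unfolding good_def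
    by (intro exI[of _ "tr1 @ tr2 @ tr3 @ [Wr n]"] exI[of _ s3] exI[of _ "m3(n := fl_word t l y)"] exI[of _ y]) simp
qed

end

text \<open>The base on the left is \<open>4 * b\<close>, where \<open>b\<close> is the base of
  \<open>word_bound\<close>. Since \<open>4 \<le> b\<close>, it is at most \<open>b ^ 2\<close>,
  which doubles the exponent 40.\<close>

lemma word_bound_large:
  assumes "1 \<le> l" "2 < R"
  shows "(2 ^ l * (2 * (2 * 2 ^ t * int R * (int n + 1)))) ^ 40 \<le> word_bound 80 t l R n"
proof -
  define b where "b = 2 ^ (t + l) * int R * (int n + 1)"
  have "1 \<le> (2::int) ^ (t + l)" by simp
  then have "1 * 4 \<le> b" if "4 \<le> int R * (int n + 1)"
    unfolding b_def mult.assoc by (intro mult_mono that) auto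
  moreover have "1 * 4 \<le> b" if "n = 0"
  proof -
    have "(2::int) ^ 1 \<le> 2 ^ (t + l)" using assms by (intro power_increasing) auto
    then have "2 * 3 \<le> 2 ^ (t + l) * int R" using assms by (intro mult_mono) auto
    then show ?thesis using that by (simp add: b_def)
  qed
  moreover have "4 \<le> int R * (int n + 1)" if "n \<noteq> 0"
  proof -
    have "3 * 2 \<le> int R * (int n + 1)" using assms that by (intro mult_mono) auto
    then show ?thesis by simp
  qed
  ultimately have b4: "4 \<le> b" by fastforce
  have "2 ^ l * (2 * (2 * 2 ^ t * int R * (int n + 1))) = 4 * b"
    by (simp add: b_def power_add)
  also have "\<dots> \<le> b * b" using b4 by (intro mult_right_mono) auto
  also have "\<dots> = b ^ 2" by (simp add: power2_eq_square)
  finally have "(2 ^ l * (2 * (2 * 2 ^ t * int R * (int n + 1)))) ^ 40 \<le> (b ^ 2) ^ 40"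
    by (rule power_mono) simp
  also have "\<dots> = word_bound 80 t l R n" by (simp only: word_bound_def b_def flip: power_mult) simp
  finally show ?thesis .
qed

text \<open>Packing 32 entries per cell makes room for the stream block next to the hot cells even when
  \<open>M = 2 * B\<close>.\<close>

lemma hot_cells_fit:
  assumes "2 \<le> r" "1 \<le> l" "2 \<le> M" "sigma (2 ^ r) t l n \<le> M"
    and A: "A = (min n ((2 ^ l - 1) div r + 1) + 31) div 32"
  shows "3 * A \<le> M \<or> A \<le> 1"
proof -
  define N :: nat where "N = 2 ^ l div (2 * r)"
  have "(2 ^ l - 1) div r \<le> (2::nat) ^ l div r" by (intro div_le_mono) simp
  moreover have "N = (2 ^ l div r) div 2" unfolding N_def by (simp add: div_mult2_eq mult.commute)
  \<comment> \<open>One unit is lost by halving \<open>2 ^ l div r\<close>, the other is the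
    additional group on the left.\<close>
  ultimately have "(2 ^ l - 1) div r + 1 \<le> 2 * N + 2" by linarith
  moreover have "min n N \<le> M" using sigma_lower_bound[OF assms(1,2), of n t] assms(4) unfolding N_def by linarith
  ultimately have "min n ((2 ^ l - 1) div r + 1) \<le> 2 * M + 2" by linarith
  \<comment> \<open>If \<open>A\<close> is at least 2, the minimum is at least 33, so
    \<open>M\<close> is at least 16, and \<open>3 * A\<close> is at most
    \<open>3 * (2 * M + 33) / 32\<close>, which is below \<open>M\<close>.\<close>
  then show ?thesis unfolding A by linarith
qed

theorem theorem4:
  fixes c :: nat
  shows "\<exists>(p :: com) (k :: nat) (K :: nat).
    \<forall>(t :: nat) (l :: nat) (R :: nat) (n :: nat) (xs :: fl list) (m :: memory).
      1 \<le> l \<and> 2 < R \<and> (\<exists>r. R = 2 ^ r) \<and>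
      1 \<le> n \<and> length xs = n \<and> (\<forall>x\<in>set xs. is_fl t l x) \<and>
      (\<exists>ys. length ys \<le> c \<and> (\<forall>y\<in>set ys. is_fl t l y) \<and> fl_sum t l ys = real n) \<and>
      (\<forall>i<n. m i = fl_word t l (xs ! i))
      \<longrightarrow>
      (\<exists>tr s' m' y.
         run (word_bound k t l R n) p (init_regs n t l R, m) tr (s', m') \<and>
         correctly_rounded t l (fl_sum t l xs) y \<and> m' n = fl_word t l y \<and>
         (\<forall>M B. 1 \<le> B \<and> 2 * B \<le> M \<and> sigma R t l n \<le> M \<longrightarrow>
            ios_at_most M B tr (K * scan B n)))"
proof (rule exI[of _ sum_program], rule exI[of _ 80], rule exI[of _ 8], intro allI impI)
  fix t l R n :: nat and xs :: "fl list" and m :: memory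
  assume asm: "1 \<le> l \<and> 2 < R \<and> (\<exists>r. R = 2 ^ r) \<and>
      1 \<le> n \<and> length xs = n \<and> (\<forall>x\<in>set xs. is_fl t l x) \<and>
      (\<exists>ys. length ys \<le> c \<and> (\<forall>y\<in>set ys. is_fl t l y) \<and> fl_sum t l ys = real n) \<and>
      (\<forall>i<n. m i = fl_word t l (xs ! i))"
  then obtain r where R_eq: "R = 2 ^ r" by blast
  have r: "2 \<le> r"
  proof (rule ccontr)
    assume "\<not> 2 \<le> r"
    then have "r = 0 \<or> r = 1" by auto
    then show False using asm R_eq by auto
  qed
  define A where "A = (min n ((2 ^ l - 1) div r + 1) + 31) div 32"
  \<comment> \<open>The hot cells lie within the input region, so fetching them costs no more than a
    scan.\<close>
  have An: "A \<le> n" unfolding A_def using asm by linarith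
  have cover: "min n ((2 ^ l - 1) div r + 1) \<le> 32 * A" unfolding A_def by linarith
  interpret input t l r n "word_bound 80 t l R n" "2 ^ t" "2 ^ l" "2 ^ r" "2 * 2 ^ t * 2 ^ r * (int n + 1)"
    "2 ^ l * (2 * (2 * 2 ^ t * 2 ^ r * (int n + 1)))" xs A
    using asm r cover word_bound_large[of l R t n] R_eq by unfold_locales auto
  have mi: "m i = fl_word t l (xs ! i)" if "i < n" for i using asm that by blast
  obtain tr s' m' y where run: "run (word_bound 80 t l R n) sum_program (init_regs n t l R, m) tr (s', m')"
    "correctly_rounded t l (fl_sum t l xs) y" "m' n = fl_word t l y" "streams A 0 (Suc n) tr"
    using run_sum_program[OF mi, folded R_eq] by blast
  have "ios_at_most M B tr (8 * scan B n)" if "1 \<le> B \<and> 2 * B \<le> M \<and> sigma R t l n \<le> M" for M B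
    using streams_ios[OF run(4) An] hot_cells_fit[OF r _ _ _ A_def] that asm R_eq by auto
  then show "\<exists>tr s' m' y.
         run (word_bound 80 t l R n) sum_program (init_regs n t l R, m) tr (s', m') \<and>
         correctly_rounded t l (fl_sum t l xs) y \<and> m' n = fl_word t l y \<and>
         (\<forall>M B. 1 \<le> B \<and> 2 * B \<le> M \<and> sigma R t l n \<le> M \<longrightarrow>
            ios_at_most M B tr (8 * scan B n))"
    using run(1-3) by blast
qed

end
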